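(* Let $\mathcal{H}$ be a Kreĭn space. If $\mathcal{A}$ is a Kreĭn space which is continuously contained in $\mathcal{H}$, with inclusion mapping $A\in\mathcal{L}(\mathcal{A},\mathcal{H})$, then $\operatorname{ind}_+\mathcal{A}=h_+(C)$ and $\operatorname{ind}_-\mathcal{A}=h_-(C)$, where $C=AA^*$. Moreover, every selfadjoint operator $C\in\mathcal{L}(\mathcal{H})$ arises in this way: there exists a Kreĭn space $\mathcal{A}$ continuously contained in $\mathcal{H}$ whose inclusion mapping $A$ satisfies $C=AA^*$.
   Context: A Kreĭn space is a complex inner product space $(\mathcal{H},\langle\cdot,\cdot\rangle_{\mathcal{H}})$ admitting a fundamental decomposition, that is, an orthogonal direct sum decomposition $\mathcal{H}=\mathcal{H}_+\oplus\mathcal{H}_-$ in which $\mathcal{H}_+$ is a Hilbert space and $\mathcal{H}_-$ is the antispace of a Hilbert space (i.e. it becomes a Hilbert space when its inner product is multiplied by $-1$). Separability is not assumed. The indices $\operatorname{ind}_\pm\mathcal{H}=\dim\mathcal{H}_\pm$ (cardinal numbers) do not depend on the choice of fundamental decomposition. Replacing the inner product of $\mathcal{H}_-$ by its negative gives an associated Hilbert space $|\mathcal{H}|$, equal to $\mathcal{H}$ as a vector space; all associated Hilbert space norms are equivalent and define the strong topology of $\mathcal{H}$. Topological notions (closed, continuous) refer to the strong topology. A subspace is a linear manifold, not necessarily closed; the dimension of a closed subspace is its Hilbert space dimension (cardinality of an orthonormal basis) in any associated Hilbert space. $\mathcal{L}(\mathcal{H},\mathcal{K})$ is the space of everywhere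 defined continuous linear operators from $\mathcal{H}$ to $\mathcal{K}$, and $\mathcal{L}(\mathcal{H})=\mathcal{L}(\mathcal{H},\mathcal{H})$. The adjoint $A^*\in\mathcal{L}(\mathcal{K},\mathcal{H})$ of $A\in\mathcal{L}(\mathcal{H},\mathcal{K})$ is the Kreĭn space adjoint: $\langle Af,g\rangle_{\mathcal{K}}=\langle f,A^*g\rangle_{\mathcal{H}}$; $C\in\mathcal{L}(\mathcal{H})$ is selfadjoint if $C=C^*$. A Kreĭn space $\mathcal{A}$ is continuously contained in a Kreĭn space $\mathcal{H}$ if $\mathcal{A}$ is a linear subspace of $\mathcal{H}$ and the inclusion mapping from $\mathcal{A}$ (with its own strong topology) into $\mathcal{H}$ is continuous; the inner product of $\mathcal{A}$ need not be the restriction of that of $\mathcal{H}$. For a selfadjoint $C\in\mathcal{L}(\mathcal{H})$, the $C$-inner product is $\langle f,g\rangle_C=\langle Cf,g\rangle_{\mathcal{H}}$. A subspace $\mathcal{M}$ is $C$-strictly positive (respectively $C$-strictly negative) if $\langle f,f\rangle_C>0$ (respectively $<0$) for every nonzero $f\in\mathcal{M}$. The hermitian index $h_+(C)$ (respectively $h_-(C)$) is the maximum dimension of a closed $C$-strictly positive (respectively $C$-strictly negative) subspace of $\mathcal{H}$; this maximum is attained. *)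

theory Defs
  imports "HOL-Analysis.Analysis"
begin

unbundle cardinal_syntax

class complex_vector = ab_group_add +
  fixes scaleC :: "complex \<Rightarrow> 'a \<Rightarrow> 'a" (infixr "*\<^sub>C" 75)
  assumes scaleC_add_right: "a *\<^sub>C (x + y) = a *\<^sub>C x + a *\<^sub>C y"
    and scaleC_add_left: "(a + b) *\<^sub>C x = a *\<^sub>C x + b *\<^sub>C x"
    and scaleC_scaleC: "a *\<^sub>C b *\<^sub>C x = (a * b) *\<^sub>C x"
    and scaleC_one: "1 *\<^sub>C x = x"

global_interpretation complex_vector:
  vector_space "scaleC :: complex \<Rightarrow> 'a \<Rightarrow> 'a :: complex_vector"
  by unfold_locales
    (simp_all add: scaleC_add_right scaleC_add_left scaleC_scaleC scaleC_one)

text \<open>Inner product spaces are carried by linear subspaces of a complex vector space, so that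
  one space can be a linear subspace of another and carry a different inner product.
  The inner product is only meaningful on the carrier.\<close>

record 'a inner_space =
  car :: "'a set"
  ip :: "'a \<Rightarrow> 'a \<Rightarrow> complex"

definition inner_product_space :: "'a::complex_vector inner_space \<Rightarrow> bool" where
  "inner_product_space H \<longleftrightarrow>
     complex_vector.subspace (car H) \<and>
     (\<forall>x\<in>car H. \<forall>y\<in>car H. \<forall>z\<in>car H. ip H (x + y) z = ip H x z + ip H y z) \<and>
     (\<forall>a. \<forall>x\<in>car H. \<forall>y\<in>car H. ip H (a *\<^sub>C x) y = a * ip H x y) \<and>
     (\<forall>x\<in>car H. \<forall>y\<in>car H. ip H y x = cnj (ip H x y))"

text \<open>The value off the carrier is irrelevant; it is 0 because the locale
  \<^locale>\<open>Metric_space\<close> asks for nonnegativity and symmetry on the whole type.\<close>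

definition inner_dist :: "'a::complex_vector inner_space \<Rightarrow> 'a \<Rightarrow> 'a \<Rightarrow> real" where
  "inner_dist H x y =
     (if x \<in> car H \<and> y \<in> car H then sqrt (Re (ip H (x - y) (x - y))) else 0)"

definition inner_topology :: "'a::complex_vector inner_space \<Rightarrow> 'a topology" where
  "inner_topology H = Metric_space.mtopology (car H) (inner_dist H)"

definition hilbert_space :: "'a::complex_vector inner_space \<Rightarrow> bool" where
  "hilbert_space H \<longleftrightarrow>
     inner_product_space H \<and>
     (\<forall>x\<in>car H. x \<noteq> 0 \<longrightarrow> 0 < Re (ip H x x)) \<and>
     Metric_space.mcomplete (car H) (inner_dist H)"

definition orthonormal_basis :: "'a::complex_vector inner_space \<Rightarrow> 'a set \<Rightarrow> bool" where
  "orthonormal_basis H B \<longleftrightarrow>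
     B \<subseteq> car H \<and>
     (\<forall>x\<in>B. \<forall>y\<in>B. ip H x y = (if x = y then 1 else 0)) \<and>
     inner_topology H closure_of complex_vector.span B = car H"

text \<open>Cardinal numbers are cardinal orders, to be compared with \<open>=o\<close> and \<open>\<le>o\<close>. The cardinality of
  an orthonormal basis of a Hilbert space does not depend on the chosen basis.\<close>

definition hilbert_dim :: "'a::complex_vector inner_space \<Rightarrow> 'a rel" where
  "hilbert_dim H = |SOME B. orthonormal_basis H B|"

definition antispace :: "'a inner_space \<Rightarrow> 'a inner_space" where
  "antispace H = H\<lparr>ip := (\<lambda>x y. - ip H x y)\<rparr>"

definition fundamental_decomposition ::
    "'a::complex_vector inner_space \<Rightarrow> 'a set \<times> 'a set \<Rightarrow> bool" where
  "fundamental_decomposition H = (\<lambda>(P, N).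
     hilbert_space (H\<lparr>car := P\<rparr>) \<and>
     hilbert_space (antispace (H\<lparr>car := N\<rparr>)) \<and>
     (\<forall>x\<in>P. \<forall>y\<in>N. ip H x y = 0) \<and>
     P \<inter> N = {0} \<and>
     car H = {x + y | x y. x \<in> P \<and> y \<in> N})"

definition krein_space :: "'a::complex_vector inner_space \<Rightarrow> bool" where
  "krein_space H \<longleftrightarrow> inner_product_space H \<and> (\<exists>D. fundamental_decomposition H D)"

text \<open>The notions below are stated with one chosen fundamental decomposition. The strong topology,
  the indices and the dimension of a closed subspace do not depend on this choice.\<close>

definition fund_dec :: "'a::complex_vector inner_space \<Rightarrow> 'a set \<times> 'a set" where
  "fund_dec H = (SOME D. fundamental_decomposition H D)"

definition ind_pos :: "'a::complex_vector inner_space \<Rightarrow> 'a rel" where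
  "ind_pos H = hilbert_dim (H\<lparr>car := fst (fund_dec H)\<rparr>)"

definition ind_neg :: "'a::complex_vector inner_space \<Rightarrow> 'a rel" where
  "ind_neg H = hilbert_dim (antispace (H\<lparr>car := snd (fund_dec H)\<rparr>))"

definition pos_part :: "'a::complex_vector inner_space \<Rightarrow> 'a \<Rightarrow> 'a" where
  "pos_part H x = (THE p. p \<in> fst (fund_dec H) \<and> x - p \<in> snd (fund_dec H))"

definition assoc_hilbert :: "'a::complex_vector inner_space \<Rightarrow> 'a inner_space" where
  "assoc_hilbert H = H\<lparr>ip := (\<lambda>x y.
     ip H (pos_part H x) (pos_part H y) - ip H (x - pos_part H x) (y - pos_part H y))\<rparr>"

definition strong_topology :: "'a::complex_vector inner_space \<Rightarrow> 'a topology" where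
  "strong_topology H = inner_topology (assoc_hilbert H)"

definition closed_subspace :: "'a::complex_vector inner_space \<Rightarrow> 'a set \<Rightarrow> bool" where
  "closed_subspace H M \<longleftrightarrow> complex_vector.subspace M \<and> closedin (strong_topology H) M"

definition subspace_dim :: "'a::complex_vector inner_space \<Rightarrow> 'a set \<Rightarrow> 'a rel" where
  "subspace_dim H M = hilbert_dim ((assoc_hilbert H)\<lparr>car := M\<rparr>)"

text \<open>Operators are extensional functions on the carrier, so that equality of operators is
  equality of functions.\<close>

definition cont_ops ::
    "'a::complex_vector inner_space \<Rightarrow> 'b::complex_vector inner_space \<Rightarrow> ('a \<Rightarrow> 'b) set" where
  "cont_ops H K =
     {T \<in> car H \<rightarrow>\<^sub>E car K.
       (\<forall>x\<in>car H. \<forall>y\<in>car H. T (x + y) = T x + T y) \<and>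
       (\<forall>a. \<forall>x\<in>car H. T (a *\<^sub>C x) = a *\<^sub>C T x) \<and>
       continuous_map (strong_topology H) (strong_topology K) T}"

definition krein_adjoint ::
    "'a::complex_vector inner_space \<Rightarrow> 'b::complex_vector inner_space \<Rightarrow> ('a \<Rightarrow> 'b) \<Rightarrow> 'b \<Rightarrow> 'a" where
  "krein_adjoint H K T =
     (THE S. S \<in> cont_ops K H \<and> (\<forall>f\<in>car H. \<forall>g\<in>car K. ip K (T f) g = ip H f (S g)))"

definition krein_selfadjoint :: "'a::complex_vector inner_space \<Rightarrow> ('a \<Rightarrow> 'a) \<Rightarrow> bool" where
  "krein_selfadjoint H C \<longleftrightarrow> C \<in> cont_ops H H \<and> krein_adjoint H H C = C"

definition inclusion :: "'a inner_space \<Rightarrow> 'a \<Rightarrow> 'a" where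
  "inclusion A = (\<lambda>x\<in>car A. x)"

definition continuously_contained ::
    "'a::complex_vector inner_space \<Rightarrow> 'a inner_space \<Rightarrow> bool" where
  "continuously_contained A H \<longleftrightarrow>
     krein_space A \<and> krein_space H \<and> car A \<subseteq> car H \<and>
     continuous_map (strong_topology A) (strong_topology H) (inclusion A)"

definition op_inner :: "'a inner_space \<Rightarrow> ('a \<Rightarrow> 'a) \<Rightarrow> 'a \<Rightarrow> 'a \<Rightarrow> complex" where
  "op_inner H C f g = ip H (C f) g"

text \<open>For selfadjoint \<open>C\<close> the values \<open>op_inner H C f f\<close> are real.\<close>

definition strictly_positive ::
    "'a::complex_vector inner_space \<Rightarrow> ('a \<Rightarrow> 'a) \<Rightarrow> 'a set \<Rightarrow> bool" where
  "strictly_positive H C M \<longleftrightarrow> (\<forall>f\<in>M. f \<noteq> 0 \<longrightarrow> 0 < Re (op_inner H C f f))"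

definition strictly_negative ::
    "'a::complex_vector inner_space \<Rightarrow> ('a \<Rightarrow> 'a) \<Rightarrow> 'a set \<Rightarrow> bool" where
  "strictly_negative H C M \<longleftrightarrow> (\<forall>f\<in>M. f \<noteq> 0 \<longrightarrow> Re (op_inner H C f f) < 0)"

definition max_cardinal :: "'a rel set \<Rightarrow> 'a rel" where
  "max_cardinal R = (SOME r. r \<in> R \<and> (\<forall>s\<in>R. s \<le>o r))"

definition herm_index_pos :: "'a::complex_vector inner_space \<Rightarrow> ('a \<Rightarrow> 'a) \<Rightarrow> 'a rel" where
  "herm_index_pos H C =
     max_cardinal {subspace_dim H M | M. closed_subspace H M \<and> strictly_positive H C M}"

definition herm_index_neg :: "'a::complex_vector inner_space \<Rightarrow> ('a \<Rightarrow> 'a) \<Rightarrow> 'a rel" where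
  "herm_index_neg H C =
     max_cardinal {subspace_dim H M | M. closed_subspace H M \<and> strictly_negative H C M}"

end

theory Submission
  imports Defs
begin

text \<open>
Let \<open>A\<close> be contained in \<open>H\<close>, and let \<open>S : H \<rightarrow> A\<close> be the adjoint of the inclusion, so that the
\<open>C\<close>-inner product of \<open>f\<close> and \<open>g\<close> is \<open>ip A (S f) (S g)\<close>. If \<open>f\<close> runs through a \<open>C\<close>-strictly positive
subspace, the positive component of \<open>S f\<close> vanishes only for \<open>f = 0\<close>. Thus the subspace is mapped
injectively and continuously into the positive half of \<open>A\<close>, and its dimension is at most \<open>ind_pos A\<close>
(\<open>basis_le_of_injective\<close>). A subspace that attains this bound is the positive spectral subspace
\<open>M\<close> of the Hilbert space operator belonging to the form; its dimension is bounded from below by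
an injective continuous map in the other direction, from the positive half of \<open>A\<close> to \<open>M\<close>
(\<open>definite_subspace_exists\<close>). For finite indices this would be linear algebra. In general the closure
of \<open>S M\<close> can be smaller than a maximal nonnegative subspace of \<open>A\<close>, and the map has to be built from a
maximal nonnegative subspace that is orthogonal to the image under \<open>S\<close> of the complement of \<open>M\<close>.

Conversely, for selfadjoint \<open>C\<close> and a fundamental symmetry \<open>J\<close> the operator \<open>G = C J\<close> is selfadjoint
in the associated Hilbert space. With \<open>S\<close> the square root of its absolute value, the range of \<open>S\<close>
with the inner product transported through \<open>S\<close> and twisted by the sign of \<open>G\<close> is the required space
(\<open>selfadjoint_factorization\<close>). Continuity of its inclusion has to hold for every choice of a
fundamental decomposition, and follows from the uniform boundedness principle
(\<open>weakly_bounded_imp_bounded\<close>).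

Both halves use only a small part of the spectral theorem (\<open>spectral_splitting\<close>): the
absolute value of a selfadjoint operator, the square root of the absolute value, and the
splitting of the space by the sign. The square roots come from an iteration that is dominated by a
numerical sequence (\<open>sqrt_fixed_point\<close>). Hilbert space theory on carriers is derived from one
variational lemma (\<open>riesz\<close>), and all statements on cardinal numbers from a bound on the number of
functionals that separate points (\<open>card_orthonormal_le_functionals\<close>).
\<close>

section \<open>Inner product spaces on a carrier\<close>

definition nrm :: "'a::complex_vector inner_space \<Rightarrow> 'a \<Rightarrow> real" where
  "nrm K x = sqrt (Re (ip K x x))"

locale ip_space =
  fixes K :: "'a::complex_vector inner_space"
  assumes inner_product_space: "inner_product_space K"
begin

lemma subspace_car: "complex_vector.subspace (car K)"
  using inner_product_space unfolding inner_product_space_def by blast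

lemmas zero_mem [simp] = complex_vector.subspace_0[OF subspace_car]
  and add_mem [simp] = complex_vector.subspace_add[OF subspace_car]
  and diff_mem [simp] = complex_vector.subspace_diff[OF subspace_car]
  and minus_mem [simp] = complex_vector.subspace_neg[OF subspace_car]
  and scale_mem [simp] = complex_vector.subspace_scale[OF subspace_car]
  and sum_mem [simp] = complex_vector.subspace_sum[OF subspace_car]

lemma ip_add_left: "x \<in> car K \<Longrightarrow> y \<in> car K \<Longrightarrow> z \<in> car K \<Longrightarrow> ip K (x + y) z = ip K x z + ip K y z"
  using inner_product_space unfolding inner_product_space_def by blast

lemma ip_scale_left: "x \<in> car K \<Longrightarrow> z \<in> car K \<Longrightarrow> ip K (a *\<^sub>C x) z = a * ip K x z"
  using inner_product_space unfolding inner_product_space_def by blast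

lemma ip_cnj: "x \<in> car K \<Longrightarrow> y \<in> car K \<Longrightarrow> ip K y x = cnj (ip K x y)"
  using inner_product_space unfolding inner_product_space_def by blast

lemma ip_add_right: "x \<in> car K \<Longrightarrow> y \<in> car K \<Longrightarrow> z \<in> car K \<Longrightarrow> ip K x (y + z) = ip K x y + ip K x z"
  using ip_cnj[of "y + z" x] ip_cnj[of y x] ip_cnj[of z x] by (simp add: ip_add_left)

lemma ip_scale_right: "x \<in> car K \<Longrightarrow> y \<in> car K \<Longrightarrow> ip K x (a *\<^sub>C y) = cnj a * ip K x y"
  using ip_cnj[of "a *\<^sub>C y" x] ip_cnj[of y x] by (simp add: ip_scale_left)

lemma ip_zero_left [simp]: "x \<in> car K \<Longrightarrow> ip K 0 x = 0"
  using ip_scale_left[of 0 x 0] by simp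

lemma ip_zero_right [simp]: "x \<in> car K \<Longrightarrow> ip K x 0 = 0"
  using ip_scale_right[of x 0 0] by simp

lemma ip_minus_left: "x \<in> car K \<Longrightarrow> y \<in> car K \<Longrightarrow> ip K (- x) y = - ip K x y"
  using ip_scale_left[of x y "-1"] by simp

lemma ip_minus_right: "x \<in> car K \<Longrightarrow> y \<in> car K \<Longrightarrow> ip K x (- y) = - ip K x y"
  using ip_scale_right[of x y "-1"] by simp

lemma ip_diff_left: "x \<in> car K \<Longrightarrow> y \<in> car K \<Longrightarrow> z \<in> car K \<Longrightarrow> ip K (x - y) z = ip K x z - ip K y z"
  using ip_add_left[of x "-y" z] by (simp add: ip_minus_left)

lemma ip_diff_right: "x \<in> car K \<Longrightarrow> y \<in> car K \<Longrightarrow> z \<in> car K \<Longrightarrow> ip K x (y - z) = ip K x y - ip K x z"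
  using ip_add_right[of x y "-z"] by (simp add: ip_minus_right)

lemma ip_sum_left:
  "(\<And>i. i \<in> I \<Longrightarrow> f i \<in> car K) \<Longrightarrow> x \<in> car K \<Longrightarrow> ip K (sum f I) x = (\<Sum>i\<in>I. ip K (f i) x)"
  by (induction I rule: infinite_finite_induct) (auto simp: ip_add_left)

lemmas ip_simps = ip_add_left ip_add_right ip_scale_left ip_scale_right ip_minus_left ip_minus_right
  ip_diff_left ip_diff_right

lemma Im_ip_self [simp]: "x \<in> car K \<Longrightarrow> Im (ip K x x) = 0"
  using ip_cnj[of x x] by (simp add: complex_eq_iff)

lemma ip_self: "x \<in> car K \<Longrightarrow> ip K x x = of_real (Re (ip K x x))"
  by (simp add: complex_eq_iff)

lemma Re_ip_commute: "x \<in> car K \<Longrightarrow> y \<in> car K \<Longrightarrow> Re (ip K y x) = Re (ip K x y)"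
  using ip_cnj[of x y] by simp

lemma restrict_ip_space:
  "complex_vector.subspace M \<Longrightarrow> M \<subseteq> car K \<Longrightarrow> inner_product_space (K\<lparr>car := M\<rparr>)"
  unfolding inner_product_space_def
  by (auto simp: subset_iff ip_add_left ip_scale_left intro: ip_cnj)

end

locale posdef_space = ip_space +
  assumes posdef: "x \<in> car K \<Longrightarrow> x \<noteq> 0 \<Longrightarrow> 0 < Re (ip K x x)"
begin

lemma Re_ip_ge0 [simp]: "x \<in> car K \<Longrightarrow> 0 \<le> Re (ip K x x)"
  using posdef[of x] by (cases "x = 0") auto

lemma nrm_sq: "x \<in> car K \<Longrightarrow> (nrm K x)\<^sup>2 = Re (ip K x x)"
  by (simp add: nrm_def)

lemma ip_self_nrm: "x \<in> car K \<Longrightarrow> ip K x x = of_real ((nrm K x)\<^sup>2)"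
  using ip_self nrm_sq by simp

lemma nrm_ge0 [simp]: "x \<in> car K \<Longrightarrow> 0 \<le> nrm K x"
  by (simp add: nrm_def)

lemma nrm_zero [simp]: "nrm K 0 = 0"
  by (simp add: nrm_def)

lemma nrm_eq0 [simp]: "x \<in> car K \<Longrightarrow> nrm K x = 0 \<longleftrightarrow> x = 0"
  using posdef[of x] by (cases "x = 0") (auto simp: nrm_def)

lemma nrm_pos: "x \<in> car K \<Longrightarrow> x \<noteq> 0 \<Longrightarrow> 0 < nrm K x"
  using posdef[of x] by (auto simp: nrm_def)

lemma ip_self_eq0: "x \<in> car K \<Longrightarrow> ip K x x = 0 \<Longrightarrow> x = 0"
  using posdef[of x] by auto

lemma nrm_scale [simp]: "x \<in> car K \<Longrightarrow> nrm K (a *\<^sub>C x) = cmod a * nrm K x"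
proof -
  assume x: "x \<in> car K"
  have "ip K (a *\<^sub>C x) (a *\<^sub>C x) = of_real ((cmod a)\<^sup>2 * Re (ip K x x))"
    using x ip_self[of x] complex_norm_square[of a]
    by (simp add: ip_simps mult.assoc[symmetric])
  then show ?thesis
    by (simp add: nrm_def real_sqrt_mult)
qed

lemma nrm_minus [simp]: "x \<in> car K \<Longrightarrow> nrm K (- x) = nrm K x"
  using nrm_scale[of x "-1"] by simp

lemma nrm_diff_commute: "x \<in> car K \<Longrightarrow> y \<in> car K \<Longrightarrow> nrm K (x - y) = nrm K (y - x)"
  using nrm_minus[of "x - y"] by simp

lemma nrm_sq_add: "x \<in> car K \<Longrightarrow> y \<in> car K \<Longrightarrow>
    (nrm K (x + y))\<^sup>2 = (nrm K x)\<^sup>2 + 2 * Re (ip K x y) + (nrm K y)\<^sup>2"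
  using Re_ip_commute[of x y] by (simp add: nrm_sq ip_simps)

lemma nrm_sq_diff: "x \<in> car K \<Longrightarrow> y \<in> car K \<Longrightarrow>
    (nrm K (x - y))\<^sup>2 = (nrm K x)\<^sup>2 - 2 * Re (ip K x y) + (nrm K y)\<^sup>2"
  using Re_ip_commute[of x y] by (simp add: nrm_sq ip_simps)

lemma cauchy_schwarz:
  assumes x: "x \<in> car K" and y: "y \<in> car K"
  shows "cmod (ip K x y) \<le> nrm K x * nrm K y"
proof (cases "y = 0")
  case False
  define s where "s = (nrm K y)\<^sup>2"
  have s: "0 < s" using nrm_pos[OF y False] by (simp add: s_def)
  have yy: "ip K y y = of_real s" using ip_self_nrm[OF y] by (simp add: s_def)
  define c where "c = ip K x y"
  have yx: "ip K y x = cnj c" using ip_cnj[OF x y] by (simp add: c_def)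
  have cc: "c * cnj c = of_real ((cmod c)\<^sup>2)" using complex_norm_square[of c] by simp
  define z where "z = of_real s *\<^sub>C x - c *\<^sub>C y"
  have "0 \<le> Re (ip K z z)" using x y by (simp add: z_def)
  also have "ip K z z = of_real s * of_real s * ip K x x - of_real s * (c * cnj c)"
    using x y unfolding z_def by (simp add: ip_simps yy yx c_def[symmetric] algebra_simps)
  also have "Re \<dots> = s * (s * (nrm K x)\<^sup>2 - (cmod c)\<^sup>2)"
    unfolding cc ip_self_nrm[OF x] by (simp add: algebra_simps)
  finally have "0 \<le> s * (nrm K x)\<^sup>2 - (cmod c)\<^sup>2"
    using s by (simp add: zero_le_mult_iff)
  then have "(cmod c)\<^sup>2 \<le> (nrm K x * nrm K y)\<^sup>2"
    by (simp add: s_def power_mult_distrib mult.commute)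
  then show ?thesis
    unfolding c_def by (rule power2_le_imp_le) (simp add: x y)
qed (use x in simp)

lemma Re_ip_le: "x \<in> car K \<Longrightarrow> y \<in> car K \<Longrightarrow> \<bar>Re (ip K x y)\<bar> \<le> nrm K x * nrm K y"
  using cauchy_schwarz[of x y] abs_Re_le_cmod[of "ip K x y"] by linarith

lemma nrm_triangle: assumes "x \<in> car K" "y \<in> car K" shows "nrm K (x + y) \<le> nrm K x + nrm K y"
proof (rule power2_le_imp_le)
  show "(nrm K (x + y))\<^sup>2 \<le> (nrm K x + nrm K y)\<^sup>2"
    using assms Re_ip_le[OF assms] by (simp add: nrm_sq_add power2_sum)
qed (use assms in simp)

lemma nrm_triangle_diff: "x \<in> car K \<Longrightarrow> y \<in> car K \<Longrightarrow> nrm K (x - y) \<le> nrm K x + nrm K y"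
  using nrm_triangle[of x "-y"] by simp

lemma nrm_triangle3: "x \<in> car K \<Longrightarrow> y \<in> car K \<Longrightarrow> z \<in> car K \<Longrightarrow> nrm K (x - z) \<le> nrm K (x - y) + nrm K (y - z)"
  using nrm_triangle[of "x - y" "y - z"] by simp

lemma Metric_space_inner_dist: "Metric_space (car K) (inner_dist K)"
proof
  fix x y z
  show "0 \<le> inner_dist K x y" by (simp add: inner_dist_def)
  show "inner_dist K x y = inner_dist K y x"
    using nrm_diff_commute[of x y] by (simp add: inner_dist_def nrm_def)
  assume "x \<in> car K" "y \<in> car K"
  then show "inner_dist K x y = 0 \<longleftrightarrow> x = y"
    using nrm_eq0[of "x - y"] by (simp add: inner_dist_def nrm_def)
  assume "z \<in> car K"
  with \<open>x \<in> car K\<close> \<open>y \<in> car K\<close> show "inner_dist K x z \<le> inner_dist K x y + inner_dist K y z"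
    using nrm_triangle3[of x y z] by (simp add: inner_dist_def nrm_def)
qed

lemma inner_dist_nrm: "x \<in> car K \<Longrightarrow> y \<in> car K \<Longrightarrow> inner_dist K x y = nrm K (x - y)"
  by (simp add: inner_dist_def nrm_def)

end

section \<open>Convergence and completeness\<close>

definition tends :: "'a::complex_vector inner_space \<Rightarrow> (nat \<Rightarrow> 'a) \<Rightarrow> 'a \<Rightarrow> bool" where
  "tends K s l \<longleftrightarrow> (\<lambda>n. nrm K (s n - l)) \<longlonglongrightarrow> 0"

definition cauchy :: "'a::complex_vector inner_space \<Rightarrow> (nat \<Rightarrow> 'a) \<Rightarrow> bool" where
  "cauchy K s \<longleftrightarrow> (\<forall>e>0. \<exists>N. \<forall>m\<ge>N. \<forall>n\<ge>N. nrm K (s m - s n) < e)"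

lemma nrm_restrict [simp]: "nrm (K\<lparr>car := M\<rparr>) = nrm K"
  and tends_restrict [simp]: "tends (K\<lparr>car := M\<rparr>) = tends K"
  and cauchy_restrict [simp]: "cauchy (K\<lparr>car := M\<rparr>) = cauchy K"
  by (simp_all add: fun_eq_iff nrm_def tends_def cauchy_def)

context posdef_space begin

lemma tends_iff_limitin:
  assumes "range s \<subseteq> car K"
  shows "limitin (inner_topology K) s l sequentially \<longleftrightarrow> l \<in> car K \<and> tends K s l"
proof -
  interpret Metric_space "car K" "inner_dist K" by (rule Metric_space_inner_dist)
  have "inner_dist K (s n) l = nrm K (s n - l)" if "l \<in> car K" for n
    using that assms by (auto intro!: inner_dist_nrm)
  then have "tends K s l \<longleftrightarrow> (\<lambda>n. inner_dist K (s n) l) \<longlonglongrightarrow> 0" if "l \<in> car K"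
    using that by (simp add: tends_def)
  moreover have "\<forall>\<^sub>F n in sequentially. s n \<in> car K"
    using assms by (auto intro: always_eventually)
  ultimately show ?thesis
    unfolding inner_topology_def limitin_metric_dist_null by auto
qed

lemma MCauchy_iff:
  "Metric_space.MCauchy (car K) (inner_dist K) s \<longleftrightarrow> range s \<subseteq> car K \<and> cauchy K s"
proof -
  interpret Metric_space "car K" "inner_dist K" by (rule Metric_space_inner_dist)
  have "inner_dist K (s m) (s n) = nrm K (s m - s n)" if "range s \<subseteq> car K" for m n
    using that by (auto intro!: inner_dist_nrm)
  then show ?thesis
    unfolding MCauchy_def cauchy_def by auto
qed

lemma mcomplete_iff:
  "Metric_space.mcomplete (car K) (inner_dist K) \<longleftrightarrow>
    (\<forall>s. range s \<subseteq> car K \<and> cauchy K s \<longrightarrow> (\<exists>l\<in>car K. tends K s l))"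
  unfolding Metric_space.mcomplete_def[OF Metric_space_inner_dist] MCauchy_iff
  using tends_iff_limitin unfolding inner_topology_def by blast

end

lemma hilbert_space_iff:
  "hilbert_space K \<longleftrightarrow> posdef_space K \<and>
    (\<forall>s. range s \<subseteq> car K \<and> cauchy K s \<longrightarrow> (\<exists>l\<in>car K. tends K s l))"
proof (cases "posdef_space K")
  case True
  then show ?thesis
    using posdef_space.mcomplete_iff[OF True]
    by (auto simp: hilbert_space_def posdef_space_def posdef_space_axioms_def ip_space_def)
next
  case False
  then show ?thesis
    by (auto simp: hilbert_space_def posdef_space_def posdef_space_axioms_def ip_space_def)
qed

locale hilbert = posdef_space +
  assumes complete: "range s \<subseteq> car K \<Longrightarrow> cauchy K s \<Longrightarrow> \<exists>l\<in>car K. tends K s l"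

lemma hilbert_iff: "hilbert_space K \<longleftrightarrow> hilbert K"
  unfolding hilbert_space_iff hilbert_def hilbert_axioms_def by blast

context posdef_space begin

text \<open>If the steps of a sequence are dominated by the increments of a convergent real sequence, the
sequence is Cauchy and inherits the explicit rate of convergence. Both the square root iteration
and the gliding hump argument for uniform boundedness get their limits from this.\<close>

lemma cauchy_telescope:
  fixes b :: "nat \<Rightarrow> real"
  assumes s: "range s \<subseteq> car K" and b: "b \<longlonglongrightarrow> L"
    and step: "\<And>n. nrm K (s (Suc n) - s n) \<le> b (Suc n) - b n"
  shows "cauchy K s" and "m \<le> n \<Longrightarrow> nrm K (s n - s m) \<le> b n - b m"
proof -
  have mem [simp]: "s n \<in> car K" for n using s by auto
  have le: "nrm K (s n - s m) \<le> b n - b m" if "m \<le> n" for m n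
    using that
  proof (induction n rule: dec_induct)
    case (step n)
    then show ?case
      using nrm_triangle3[of "s (Suc n)" "s n" "s m"] assms(3)[of n] by simp
  qed simp
  then show "m \<le> n \<Longrightarrow> nrm K (s n - s m) \<le> b n - b m" .
  show "cauchy K s" unfolding cauchy_def
  proof (intro allI impI)
    fix e :: real assume "e > 0"
    then obtain N where N: "\<And>m n. m \<ge> N \<Longrightarrow> n \<ge> N \<Longrightarrow> dist (b m) (b n) < e"
      using LIMSEQ_imp_Cauchy[OF b] unfolding Cauchy_def by blast
    have "nrm K (s m - s n) < e" if "m \<ge> N" "n \<ge> N" for m n
    proof (cases "n \<le> m")
      case True
      then show ?thesis using le[of n m] N[OF that] by (simp add: dist_real_def)
    next
      case False
      then show ?thesis using le[of m n] N[OF that] nrm_diff_commute[of "s m" "s n"]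
        by (simp add: dist_real_def)
    qed
    then show "\<exists>N. \<forall>m\<ge>N. \<forall>n\<ge>N. nrm K (s m - s n) < e" by blast
  qed
qed

lemma tends_ip:
  assumes s: "\<And>n. s n \<in> car K" and l: "l \<in> car K" and y: "y \<in> car K" and t: "tends K s l"
  shows "(\<lambda>n. ip K (s n) y) \<longlonglongrightarrow> ip K l y"
proof -
  have "(\<lambda>n. ip K (s n) y - ip K l y) \<longlonglongrightarrow> 0"
  proof (rule Lim_null_comparison)
    show "\<forall>\<^sub>F n in sequentially. cmod (ip K (s n) y - ip K l y) \<le> nrm K (s n - l) * nrm K y"
      using cauchy_schwarz[of "s _ - l" y] s l y by (simp add: ip_diff_left)
    show "(\<lambda>n. nrm K (s n - l) * nrm K y) \<longlonglongrightarrow> 0"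
      using t unfolding tends_def by (rule tendsto_mult_left_zero)
  qed
  then show ?thesis by (rule LIM_zero_cancel)
qed

lemma tends_ip_right:
  assumes s: "\<And>n. s n \<in> car K" and l: "l \<in> car K" and y: "y \<in> car K" and t: "tends K s l"
  shows "(\<lambda>n. ip K y (s n)) \<longlonglongrightarrow> ip K y l"
  using tendsto_cnj[OF tends_ip[OF assms]] ip_cnj[OF s y] ip_cnj[OF l y] by simp

lemma tends_nrm:
  assumes s: "\<And>n. s n \<in> car K" and l: "l \<in> car K" and t: "tends K s l"
  shows "(\<lambda>n. nrm K (s n)) \<longlonglongrightarrow> nrm K l"
proof -
  have "(\<lambda>n. nrm K (s n) - nrm K l) \<longlonglongrightarrow> 0"
  proof (rule Lim_null_comparison)
    have "norm (nrm K (s n) - nrm K l) \<le> nrm K (s n - l)" for n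
      using nrm_triangle[of "s n - l" l] nrm_triangle[of "l - s n" "s n"]
        nrm_diff_commute[of l "s n"] s l by auto
    then show "\<forall>\<^sub>F n in sequentially. norm (nrm K (s n) - nrm K l) \<le> nrm K (s n - l)" by simp
    show "(\<lambda>n. nrm K (s n - l)) \<longlonglongrightarrow> 0" using t unfolding tends_def .
  qed
  then show ?thesis by (rule LIM_zero_cancel)
qed

lemma tends_unique:
  assumes s: "\<And>n. s n \<in> car K" and "l \<in> car K" "l' \<in> car K" "tends K s l" "tends K s l'"
  shows "l = l'"
proof -
  have "nrm K (l - l') \<le> nrm K (s n - l) + nrm K (s n - l')" for n
    using nrm_triangle3[of l "s n" l'] nrm_diff_commute[of l "s n"] assms by simp
  then have "nrm K (l - l') \<le> 0"
    using tendsto_lowerbound[OF tendsto_add[OF assms(4,5)[unfolded tends_def]], of "nrm K (l - l')"]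
    by simp
  then show ?thesis
    using nrm_eq0[of "l - l'"] nrm_ge0[of "l - l'"] assms by (auto simp del: nrm_eq0 nrm_ge0)
qed

lemma tends_const [simp]: "tends K (\<lambda>n. l) l"
  by (simp add: tends_def)

lemma tends_add:
  assumes "\<And>n. s n \<in> car K" "\<And>n. s' n \<in> car K" "l \<in> car K" "l' \<in> car K" "tends K s l" "tends K s' l'"
  shows "tends K (\<lambda>n. s n + s' n) (l + l')"
  unfolding tends_def
proof (rule Lim_null_comparison)
  have "nrm K ((s n + s' n) - (l + l')) \<le> nrm K (s n - l) + nrm K (s' n - l')" for n
    using nrm_triangle[of "s n - l" "s' n - l'"] assms by (simp add: algebra_simps)
  then show "\<forall>\<^sub>F n in sequentially. norm (nrm K ((s n + s' n) - (l + l'))) \<le> nrm K (s n - l) + nrm K (s' n - l')"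
    using assms by simp
  show "(\<lambda>n. nrm K (s n - l) + nrm K (s' n - l')) \<longlonglongrightarrow> 0"
    using tendsto_add[OF assms(5,6)[unfolded tends_def]] by simp
qed

lemma tends_scale:
  assumes "\<And>n. s n \<in> car K" "l \<in> car K" "tends K s l"
  shows "tends K (\<lambda>n. a *\<^sub>C s n) (a *\<^sub>C l)"
  unfolding tends_def
proof -
  have "nrm K (a *\<^sub>C s n - a *\<^sub>C l) = cmod a * nrm K (s n - l)" for n
    using nrm_scale[of "s n - l" a] assms by (simp add: complex_vector.scale_right_diff_distrib)
  then show "(\<lambda>n. nrm K (a *\<^sub>C s n - a *\<^sub>C l)) \<longlonglongrightarrow> 0"
    using tendsto_mult_right_zero[OF assms(3)[unfolded tends_def]] by simp
qed

end

section \<open>Bounded linear operators\<close>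

text \<open>Operators act on carriers, so linearity is only demanded there. The domain and the codomain are
sets and not spaces, because the Riesz lemma also uses linear maps on a mere linear manifold.\<close>

definition linear_on :: "'a::complex_vector set \<Rightarrow> 'b::complex_vector set \<Rightarrow> ('a \<Rightarrow> 'b) \<Rightarrow> bool" where
  "linear_on V W T \<longleftrightarrow> (\<forall>x\<in>V. T x \<in> W) \<and> (\<forall>x\<in>V. \<forall>y\<in>V. T (x + y) = T x + T y) \<and>
     (\<forall>a. \<forall>x\<in>V. T (a *\<^sub>C x) = a *\<^sub>C T x)"

definition bounded_op :: "'a::complex_vector inner_space \<Rightarrow> 'b::complex_vector inner_space \<Rightarrow> ('a \<Rightarrow> 'b) \<Rightarrow> bool" where
  "bounded_op K L T \<longleftrightarrow> linear_on (car K) (car L) T \<and> (\<exists>c. \<forall>x\<in>car K. nrm L (T x) \<le> c * nrm K x)"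

lemma linear_on_mem: "linear_on V W T \<Longrightarrow> x \<in> V \<Longrightarrow> T x \<in> W"
  and linear_on_add: "linear_on V W T \<Longrightarrow> x \<in> V \<Longrightarrow> y \<in> V \<Longrightarrow> T (x + y) = T x + T y"
  and linear_on_scale: "linear_on V W T \<Longrightarrow> x \<in> V \<Longrightarrow> T (a *\<^sub>C x) = a *\<^sub>C T x"
  by (simp_all add: linear_on_def)

lemma linear_on_minus: "linear_on V W T \<Longrightarrow> x \<in> V \<Longrightarrow> T (- x) = - T x"
  using linear_on_scale[of V W T x "-1"] by simp

lemma linear_on_zero: "linear_on V W T \<Longrightarrow> complex_vector.subspace V \<Longrightarrow> T 0 = 0"
  using linear_on_scale[of V W T 0 0] complex_vector.subspace_0[of V] by simp

lemma linear_on_diff: "linear_on V W T \<Longrightarrow> complex_vector.subspace V \<Longrightarrow> x \<in> V \<Longrightarrow> y \<in> V \<Longrightarrow> T (x - y) = T x - T y"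
  using linear_on_add[of V W T x "-y"] linear_on_minus[of V W T y] complex_vector.subspace_neg[of V y] by simp

lemma bounded_op_linear: "bounded_op K L T \<Longrightarrow> linear_on (car K) (car L) T"
  by (simp add: bounded_op_def)

text \<open>A strictly positive constant is what one can divide by.\<close>

lemma bounded_op_boundE:
  assumes "bounded_op K L T" "posdef_space K"
  obtains c where "0 < c" "\<And>x. x \<in> car K \<Longrightarrow> nrm L (T x) \<le> c * nrm K x"
proof -
  interpret K: posdef_space K by fact
  obtain c where c: "\<forall>x\<in>car K. nrm L (T x) \<le> c * nrm K x" using assms(1) unfolding bounded_op_def by blast
  have "nrm L (T x) \<le> max c 1 * nrm K x" if "x \<in> car K" for x
    using c that K.nrm_ge0[OF that] mult_right_mono[of c "max c 1" "nrm K x"] by force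
  then show ?thesis using that[of "max c 1"] by auto
qed

lemma bounded_opI:
  assumes "\<And>x. x \<in> car K \<Longrightarrow> T x \<in> car L"
    and "\<And>x y. x \<in> car K \<Longrightarrow> y \<in> car K \<Longrightarrow> T (x + y) = T x + T y"
    and "\<And>a x. x \<in> car K \<Longrightarrow> T (a *\<^sub>C x) = a *\<^sub>C T x"
    and "\<And>x. x \<in> car K \<Longrightarrow> nrm L (T x) \<le> c * nrm K x"
  shows "bounded_op K L T"
  using assms unfolding bounded_op_def linear_on_def by blast

lemma bounded_op_compose:
  assumes K: "posdef_space K" and L: "posdef_space L" and S: "bounded_op K L S" and T: "bounded_op L M T"
  shows "bounded_op K M (\<lambda>x. T (S x))"
proof -
  note [simp] = linear_on_mem[OF bounded_op_linear[OF S]] linear_on_mem[OF bounded_op_linear[OF T]]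
  obtain c where c: "0 < c" "\<And>x. x \<in> car K \<Longrightarrow> nrm L (S x) \<le> c * nrm K x"
    using bounded_op_boundE[OF S K] by blast
  obtain d where d: "0 < d" "\<And>x. x \<in> car L \<Longrightarrow> nrm M (T x) \<le> d * nrm L x"
    using bounded_op_boundE[OF T L] by blast
  show ?thesis
  proof (rule bounded_opI)
    fix x assume x: "x \<in> car K"
    have "nrm M (T (S x)) \<le> d * nrm L (S x)" using x d by simp
    also have "\<dots> \<le> d * (c * nrm K x)" using x c d by (intro mult_left_mono) auto
    finally show "nrm M (T (S x)) \<le> (d * c) * nrm K x" by (simp add: mult.assoc)
  qed (simp_all add: linear_on_add[OF bounded_op_linear[OF S]] linear_on_add[OF bounded_op_linear[OF T]]
      linear_on_scale[OF bounded_op_linear[OF S]] linear_on_scale[OF bounded_op_linear[OF T]])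
qed

lemma bounded_op_diff:
  assumes K: "posdef_space K" and L: "posdef_space L" and S: "bounded_op K L S" and T: "bounded_op K L T"
  shows "bounded_op K L (\<lambda>x. S x - T x)"
proof -
  interpret L: posdef_space L by (rule L)
  note [simp] = linear_on_mem[OF bounded_op_linear[OF S]] linear_on_mem[OF bounded_op_linear[OF T]]
  obtain c where c: "0 < c" "\<And>x. x \<in> car K \<Longrightarrow> nrm L (S x) \<le> c * nrm K x"
    using bounded_op_boundE[OF S K] by blast
  obtain d where d: "0 < d" "\<And>x. x \<in> car K \<Longrightarrow> nrm L (T x) \<le> d * nrm K x"
    using bounded_op_boundE[OF T K] by blast
  show ?thesis
  proof (rule bounded_opI)
    fix x assume x: "x \<in> car K"
    show "nrm L (S x - T x) \<le> (c + d) * nrm K x"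
      using L.nrm_triangle_diff[of "S x" "T x"] c(2)[OF x] d(2)[OF x] x by (simp add: distrib_right)
  qed (simp_all add: linear_on_add[OF bounded_op_linear[OF S]] linear_on_add[OF bounded_op_linear[OF T]]
      linear_on_scale[OF bounded_op_linear[OF S]] linear_on_scale[OF bounded_op_linear[OF T]] complex_vector.scale_right_diff_distrib)
qed

lemma (in posdef_space) tends_bounded_op:
  assumes U: "bounded_op K L U" and L: "posdef_space L" and s: "\<And>n. s n \<in> car K" and l: "l \<in> car K"
    and t: "tends K s l"
  shows "tends L (\<lambda>n. U (s n)) (U l)"
proof -
  interpret L: posdef_space L by (rule L)
  note [simp] = linear_on_mem[OF bounded_op_linear[OF U]]
  obtain c where c: "0 < c" "\<And>x. x \<in> car K \<Longrightarrow> nrm L (U x) \<le> c * nrm K x"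
    using bounded_op_boundE[OF U posdef_space_axioms] by blast
  show ?thesis unfolding tends_def
  proof (rule Lim_null_comparison)
    have "nrm L (U (s n) - U l) \<le> c * nrm K (s n - l)" for n
      using c(2)[of "s n - l"] s l by (simp add: linear_on_diff[OF bounded_op_linear[OF U] subspace_car])
    then show "\<forall>\<^sub>F n in sequentially. norm (nrm L (U (s n) - U l)) \<le> c * nrm K (s n - l)"
      using s l by simp
    show "(\<lambda>n. c * nrm K (s n - l)) \<longlonglongrightarrow> 0"
      using t unfolding tends_def by (rule tendsto_mult_right_zero)
  qed
qed

section \<open>The Riesz representation theorem and adjoints\<close>

text \<open>A functional dominated by the seminorm \<open>nrm K \<circ> T\<close> is represented through \<open>T\<close> by a vector \<open>y\<close>. The
vector is the limit of \<open>T (s n)\<close> along a minimizing sequence of \<open>\<bar>T d\<bar>\<^sup>2 - 2 Re (phi d)\<close>: the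
parallelogram law makes such a sequence Cauchy, and the first variation of the functional at the
limit vanishes. The manifold \<open>D\<close> need not be closed nor \<open>T\<close> injective, so the same statement
yields the Riesz theorem, orthogonal projections, the density of the span of a maximal
orthonormal set, and the extension of a contraction from an arbitrary manifold. That \<open>y\<close> is a limit
of vectors \<open>T (s n)\<close> pins it down uniquely.\<close>

lemma (in hilbert) riesz:
  fixes T :: "'b::complex_vector \<Rightarrow> 'a" and phi :: "'b \<Rightarrow> complex"
  assumes D: "complex_vector.subspace D" and T: "linear_on D (car K) T"
    and add: "\<And>d e. d \<in> D \<Longrightarrow> e \<in> D \<Longrightarrow> phi (d + e) = phi d + phi e"
    and scale: "\<And>a d. d \<in> D \<Longrightarrow> phi (a *\<^sub>C d) = a * phi d"
    and c: "0 \<le> c" and bound: "\<And>d. d \<in> D \<Longrightarrow> cmod (phi d) \<le> c * nrm K (T d)"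
  obtains s y where "\<And>n. s n \<in> D" "y \<in> car K" "tends K (\<lambda>n. T (s n)) y"
    "\<And>d. d \<in> D \<Longrightarrow> phi d = ip K (T d) y" "nrm K y \<le> c"
proof -
  note [simp] = complex_vector.subspace_add[OF D] complex_vector.subspace_scale[OF D]
    complex_vector.subspace_0[OF D]
  note [simp] = linear_on_mem[OF T] linear_on_add[OF T] linear_on_scale[OF T] linear_on_diff[OF T D]
  define F where "F d = (nrm K (T d))\<^sup>2 - 2 * Re (phi d)" for d
  have F_lower: "- c\<^sup>2 \<le> F d" if "d \<in> D" for d
  proof -
    have "Re (phi d) \<le> c * nrm K (T d)"
      using bound[OF that] complex_Re_le_cmod[of "phi d"] by linarith
    then show ?thesis
      using zero_le_power2[of "nrm K (T d) - c"] unfolding F_def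
      by (simp add: power2_diff mult.commute)
  qed
  define m where "m = (INF d\<in>D. F d)"
  have bdd: "bdd_below (F ` D)" using F_lower by (auto intro!: bdd_belowI[of _ "- c\<^sup>2"])
  have ne: "D \<noteq> {}" using D complex_vector.subspace_0 by blast
  have m_le: "m \<le> F d" if "d \<in> D" for d
    unfolding m_def using bdd that by (rule cINF_lower)
  have "\<exists>d\<in>D. F d < m + 1 / real (Suc n)" for n
  proof (rule ccontr)
    assume "\<not> ?thesis"
    then have "m + 1 / real (Suc n) \<le> (INF d\<in>D. F d)"
      by (intro cINF_greatest[OF ne]) (auto simp: not_less)
    then show False unfolding m_def by simp
  qed
  then obtain s where s: "\<And>n. s n \<in> D" "\<And>n. F (s n) < m + 1 / real (Suc n)" by metis
  note [simp] = s(1)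
  have expand: "F (d + of_real t *\<^sub>C e) =
      F d + 2 * t * (Re (ip K (T d) (T e)) - Re (phi e)) + t\<^sup>2 * (nrm K (T e))\<^sup>2"
    if "d \<in> D" "e \<in> D" for d e t
    using that unfolding F_def
    by (simp add: nrm_sq_add add scale ip_simps power_mult_distrib algebra_simps)
  have para: "(nrm K (T d - T e))\<^sup>2 \<le> 2 * (F d + F e - 2 * m)" if "d \<in> D" "e \<in> D" for d e
  proof -
    have "m \<le> F (of_real (1/2) *\<^sub>C (d + e))" using that by (intro m_le) simp
    moreover have "4 * F (of_real (1/2) *\<^sub>C (d + e)) = (nrm K (T d + T e))\<^sup>2 - 4 * (Re (phi d) + Re (phi e))"
      using that unfolding F_def
      by (simp add: add scale power_mult_distrib power_divide algebra_simps del: nrm_scale)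
        (simp add: power_divide complex_vector.scale_right_distrib[symmetric])
    ultimately show ?thesis
      using that unfolding F_def by (simp add: nrm_sq_add nrm_sq_diff)
  qed
  have "cauchy K (\<lambda>n. T (s n))" unfolding cauchy_def
  proof (intro allI impI)
    fix e :: real assume e: "e > 0"
    obtain N where N: "1 / real (Suc N) < e\<^sup>2 / 4"
      using nat_approx_posE[of "e\<^sup>2 / 4"] e by auto
    have "nrm K (T (s i) - T (s j)) < e" if "N \<le> i" "N \<le> j" for i j
    proof -
      have "1 / real (Suc i) \<le> 1 / real (Suc N)" "1 / real (Suc j) \<le> 1 / real (Suc N)"
        using that by (simp_all add: frac_le)
      then have "(nrm K (T (s i) - T (s j)))\<^sup>2 < e\<^sup>2"
        using para[of "s i" "s j"] s(2)[of i] s(2)[of j] N by simp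
      then show ?thesis using e by (rule_tac power2_less_imp_less) simp_all
    qed
    then show "\<exists>N. \<forall>i\<ge>N. \<forall>j\<ge>N. nrm K (T (s i) - T (s j)) < e" by blast
  qed
  then obtain y where y [simp]: "y \<in> car K" and lim: "tends K (\<lambda>n. T (s n)) y"
    using complete[of "\<lambda>n. T (s n)"] by (auto simp: image_subset_iff)
  have Re_eq: "Re (phi d) = Re (ip K (T d) y)" if d: "d \<in> D" for d
  proof -
    define b where "b = Re (ip K y (T d)) - Re (phi d)"
    define q where "q = (nrm K (T d))\<^sup>2"
    \<comment> \<open>the first variation at the minimizer in the direction \<open>d\<close>, with real step \<open>t\<close>\<close>
    have "0 \<le> 2 * t * b + t\<^sup>2 * q" for t
    proof (rule tendsto_lowerbound)
      have "(\<lambda>n. ip K (T (s n)) (T d)) \<longlonglongrightarrow> ip K y (T d)"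
        using lim d by (intro tends_ip) auto
      then have "(\<lambda>n. 2 * t * (Re (ip K (T (s n)) (T d)) - Re (phi d)) + t\<^sup>2 * q + 1 / real (Suc n))
          \<longlonglongrightarrow> 2 * t * b + t\<^sup>2 * q + 0"
        unfolding b_def by (intro tendsto_intros lim_1_over_n[THEN LIMSEQ_Suc])
      then show "(\<lambda>n. 2 * t * (Re (ip K (T (s n)) (T d)) - Re (phi d)) + t\<^sup>2 * q + 1 / real (Suc n))
          \<longlonglongrightarrow> 2 * t * b + t\<^sup>2 * q" by simp
      have "0 \<le> 2 * t * (Re (ip K (T (s n)) (T d)) - Re (phi d)) + t\<^sup>2 * q + 1 / real (Suc n)" for n
        using m_le[of "s n + of_real t *\<^sub>C d"] s(2)[of n] d expand[of "s n" d t] unfolding q_def by simp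
      then show "\<forall>\<^sub>F n in sequentially. 0 \<le> 2 * t * (Re (ip K (T (s n)) (T d)) - Re (phi d)) + t\<^sup>2 * q + 1 / real (Suc n)"
        by simp
    qed simp
    \<comment> \<open>a step for which the quadratic polynomial is negative unless \<open>b = 0\<close>; the summand 1 covers \<open>q = 0\<close>\<close>
    from this[of "- b / (q + 1)"] have "0 \<le> 2 * (- b / (q + 1)) * b + (- b / (q + 1))\<^sup>2 * q" .
    moreover have q: "0 \<le> q" by (simp add: q_def)
    moreover have "2 * (- b / (q + 1)) * b + (- b / (q + 1))\<^sup>2 * q = - (b\<^sup>2 * (q + 2) / (q + 1)\<^sup>2)"
      using q by (simp add: divide_simps power2_eq_square) (simp add: algebra_simps)
    ultimately have "b\<^sup>2 * (q + 2) / (q + 1)\<^sup>2 \<le> 0" by linarith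
    then have "b\<^sup>2 * (q + 2) \<le> 0" using q by (simp add: divide_le_0_iff)
    then have "b = 0" using q by (simp add: mult_le_0_iff)
    then show ?thesis using Re_ip_commute[of y "T d"] d by (simp add: b_def)
  qed
  have eq: "phi d = ip K (T d) y" if d: "d \<in> D" for d
  proof -
    \<comment> \<open>the imaginary part at \<open>d\<close> is minus the real part at \<open>\<i> d\<close>\<close>
    have "Re (\<i> * phi d) = Re (\<i> * ip K (T d) y)"
      using Re_eq[of "\<i> *\<^sub>C d"] d by (simp add: scale ip_simps del: Re_i_times)
    then show ?thesis using Re_eq[OF d] by (simp add: complex_eq_iff)
  qed
  have "(\<lambda>n. cmod (ip K (T (s n)) y)) \<longlonglongrightarrow> cmod (ip K y y)"
    using lim by (intro tendsto_norm tends_ip) auto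
  moreover have "(\<lambda>n. c * nrm K (T (s n))) \<longlonglongrightarrow> c * nrm K y"
    using lim by (intro tendsto_mult_left tends_nrm) auto
  moreover have "cmod (ip K (T (s n)) y) \<le> c * nrm K (T (s n))" for n
    using bound[of "s n"] eq[of "s n"] by simp
  ultimately have "cmod (ip K y y) \<le> c * nrm K y"
    by (blast intro: LIMSEQ_le)
  then have "nrm K y * nrm K y \<le> c * nrm K y"
    by (simp add: ip_self_nrm norm_power power2_eq_square norm_mult)
  then have "nrm K y \<le> c"
    using c nrm_ge0[OF y] by (cases "nrm K y = 0") (auto simp del: nrm_ge0 simp: mult_le_cancel_right)
  with s(1) y lim eq show ?thesis by (rule that)
qed

text \<open>The representing vectors depend linearly on a parameter \<open>x\<close>. They are unique only within the
closure of the range of \<open>T\<close>; here this closure is described as the double orthogonal complement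
\<open>R\<close>, and linearity is read off from uniqueness inside \<open>R\<close>.\<close>

lemma (in hilbert) riesz_operator:
  fixes U :: "'c::complex_vector inner_space" and T :: "'b::complex_vector \<Rightarrow> 'a"
    and b :: "'b \<Rightarrow> 'c \<Rightarrow> complex"
  assumes U: "posdef_space U" and D: "complex_vector.subspace D" and T: "linear_on D (car K) T"
    and add: "\<And>d e x. d \<in> D \<Longrightarrow> e \<in> D \<Longrightarrow> x \<in> car U \<Longrightarrow> b (d + e) x = b d x + b e x"
    and scale: "\<And>a d x. d \<in> D \<Longrightarrow> x \<in> car U \<Longrightarrow> b (a *\<^sub>C d) x = a * b d x"
    and add2: "\<And>d x y. d \<in> D \<Longrightarrow> x \<in> car U \<Longrightarrow> y \<in> car U \<Longrightarrow> b d (x + y) = b d x + b d y"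
    and scale2: "\<And>a d x. d \<in> D \<Longrightarrow> x \<in> car U \<Longrightarrow> b d (a *\<^sub>C x) = cnj a * b d x"
    and c: "0 \<le> c"
    and bound: "\<And>d x. d \<in> D \<Longrightarrow> x \<in> car U \<Longrightarrow> cmod (b d x) \<le> c * nrm U x * nrm K (T d)"
  obtains Q where "bounded_op U K Q" "\<And>d x. d \<in> D \<Longrightarrow> x \<in> car U \<Longrightarrow> b d x = ip K (T d) (Q x)"
proof -
  interpret U: posdef_space U by (rule U)
  note [simp] = linear_on_mem[OF T]
  define R where "R = {y \<in> car K. \<forall>z\<in>car K. (\<forall>d\<in>D. ip K (T d) z = 0) \<longrightarrow> ip K y z = 0}"
  have R_add: "y + z \<in> R" if "y \<in> R" "z \<in> R" for y z
    using that unfolding R_def by (simp add: ip_add_left)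
  have R_scale: "a *\<^sub>C y \<in> R" if "y \<in> R" for a y
    using that unfolding R_def by (simp add: ip_scale_left)
  have R_car: "y \<in> car K" if "y \<in> R" for y using that by (simp add: R_def)
  have uniq: "y = z" if y: "y \<in> R" and z: "z \<in> R" and eq: "\<forall>d\<in>D. ip K (T d) y = ip K (T d) z" for y z
  proof -
    have "\<forall>d\<in>D. ip K (T d) (y - z) = 0" using eq y z R_car by (simp add: ip_diff_right)
    moreover have "y - z \<in> car K" using R_car[OF y] R_car[OF z] by simp
    ultimately have "ip K y (y - z) = 0" "ip K z (y - z) = 0"
      using y z unfolding R_def by blast+
    then have "ip K (y - z) (y - z) = 0" using R_car[OF y] R_car[OF z] by (simp add: ip_diff_left)
    then show ?thesis using ip_self_eq0[of "y - z"] R_car[OF y] R_car[OF z] by simp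
  qed
  have ex: "\<exists>y\<in>R. (\<forall>d\<in>D. b d x = ip K (T d) y) \<and> nrm K y \<le> c * nrm U x" if x: "x \<in> car U" for x
  proof -
    obtain s y where s: "\<And>n. s n \<in> D" and y: "y \<in> car K" and lim: "tends K (\<lambda>n. T (s n)) y"
      and eq: "\<And>d. d \<in> D \<Longrightarrow> b d x = ip K (T d) y" and le: "nrm K y \<le> c * nrm U x"
      using riesz[OF D T, of "\<lambda>d. b d x" "c * nrm U x"] add scale bound x c by auto
    have "ip K y z = 0" if z: "z \<in> car K" "\<forall>d\<in>D. ip K (T d) z = 0" for z
    proof -
      have "(\<lambda>n. ip K (T (s n)) z) \<longlonglongrightarrow> ip K y z"
        using s y lim z by (intro tends_ip) auto
      then show ?thesis using z s by (simp add: LIMSEQ_const_iff)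
    qed
    then show ?thesis using y eq le unfolding R_def by blast
  qed
  then obtain Q where Q: "\<And>x. x \<in> car U \<Longrightarrow> Q x \<in> R"
    "\<And>d x. x \<in> car U \<Longrightarrow> d \<in> D \<Longrightarrow> b d x = ip K (T d) (Q x)"
    "\<And>x. x \<in> car U \<Longrightarrow> nrm K (Q x) \<le> c * nrm U x" by metis
  have QK [simp]: "Q x \<in> car K" if "x \<in> car U" for x using Q(1)[OF that] by (rule R_car)
  have "linear_on (car U) (car K) Q" unfolding linear_on_def
  proof (intro conjI ballI allI)
    fix x y assume x: "x \<in> car U" and y: "y \<in> car U"
    show "Q (x + y) = Q x + Q y"
    proof (rule uniq)
      show "\<forall>d\<in>D. ip K (T d) (Q (x + y)) = ip K (T d) (Q x + Q y)"
        using x y add2 by (simp add: ip_add_right Q(2)[symmetric])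
    qed (use x y Q(1) R_add in auto)
  next
    fix a x assume x: "x \<in> car U"
    show "Q (a *\<^sub>C x) = a *\<^sub>C Q x"
    proof (rule uniq)
      show "\<forall>d\<in>D. ip K (T d) (Q (a *\<^sub>C x)) = ip K (T d) (a *\<^sub>C Q x)"
        using x scale2 by (simp add: ip_scale_right Q(2)[symmetric])
    qed (use x Q(1) R_scale in auto)
  qed simp
  then have "bounded_op U K Q" unfolding bounded_op_def using Q(3) by blast
  with Q(2) show ?thesis by (intro that) auto
qed

lemma adjoint_exists:
  assumes K: "hilbert K" and L: "posdef_space L" and T: "bounded_op K L T"
  obtains S where "bounded_op L K S" "\<And>x y. x \<in> car K \<Longrightarrow> y \<in> car L \<Longrightarrow> ip L (T x) y = ip K x (S y)"
proof -
  interpret K: hilbert K by (rule K)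
  interpret L: posdef_space L by (rule L)
  obtain c where c: "0 < c" "\<And>x. x \<in> car K \<Longrightarrow> nrm L (T x) \<le> c * nrm K x"
    using bounded_op_boundE[OF T K.posdef_space_axioms] by blast
  note [simp] = linear_on_mem[OF bounded_op_linear[OF T]] linear_on_add[OF bounded_op_linear[OF T]] linear_on_scale[OF bounded_op_linear[OF T]]
  show ?thesis
  proof (rule K.riesz_operator[OF L K.subspace_car, of id "\<lambda>x y. ip L (T x) y" c])
    show "linear_on (car K) (car K) id" by (simp add: linear_on_def)
    fix x y assume x: "x \<in> car K" and y: "y \<in> car L"
    have "cmod (ip L (T x) y) \<le> nrm L (T x) * nrm L y" using x y by (intro L.cauchy_schwarz) auto
    also have "\<dots> \<le> (c * nrm K x) * nrm L y" using c x y by (intro mult_right_mono) auto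
    finally show "cmod (ip L (T x) y) \<le> c * nrm L y * nrm K (id x)" by (simp add: mult_ac)
  qed (use c that in \<open>auto simp: L.ip_simps\<close>)
qed

section \<open>Closed subspaces and projections\<close>

definition closed_linear :: "'a::complex_vector inner_space \<Rightarrow> 'a set \<Rightarrow> bool" where
  "closed_linear K M \<longleftrightarrow> complex_vector.subspace M \<and> M \<subseteq> car K \<and>
     (\<forall>s l. (\<forall>n. s n \<in> M) \<and> l \<in> car K \<and> tends K s l \<longrightarrow> l \<in> M)"

lemma closed_linearD:
  assumes "closed_linear K M"
  shows "complex_vector.subspace M" "M \<subseteq> car K"
    "\<And>s l. (\<And>n. s n \<in> M) \<Longrightarrow> l \<in> car K \<Longrightarrow> tends K s l \<Longrightarrow> l \<in> M"
  using assms unfolding closed_linear_def by blast+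

lemma closed_linear_inter: "closed_linear K M \<Longrightarrow> closed_linear K N \<Longrightarrow> closed_linear K (M \<inter> N)"
  unfolding closed_linear_def using complex_vector.subspace_inter by blast

lemma (in posdef_space) restrict_posdef:
  "complex_vector.subspace M \<Longrightarrow> M \<subseteq> car K \<Longrightarrow> posdef_space (K\<lparr>car := M\<rparr>)"
  using restrict_ip_space[of M] posdef
  by (auto simp: posdef_space_def posdef_space_axioms_def ip_space_def)

lemma (in hilbert) restrict_hilbert: assumes M: "closed_linear K M" shows "hilbert (K\<lparr>car := M\<rparr>)"
proof -
  have "\<exists>l\<in>M. tends K s l" if s: "range s \<subseteq> M" "cauchy K s" for s
  proof -
    obtain l where "l \<in> car K" "tends K s l" using complete[of s] s closed_linearD(2)[OF M] by auto
    then show ?thesis using closed_linearD(3)[OF M, of s l] s by auto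
  qed
  then show ?thesis
    using restrict_posdef[OF closed_linearD(1,2)[OF M]] unfolding hilbert_def hilbert_axioms_def by simp
qed

lemma (in posdef_space) closed_linear_orthogonal:
  assumes A: "A \<subseteq> car K" shows "closed_linear K {x \<in> car K. \<forall>a\<in>A. ip K x a = 0}"
proof -
  have "complex_vector.subspace {x \<in> car K. \<forall>a\<in>A. ip K x a = 0}"
    unfolding complex_vector.subspace_def using A by (auto simp: subset_iff ip_simps)
  moreover have "ip K l a = 0" if "\<forall>n. s n \<in> car K \<and> (\<forall>a\<in>A. ip K (s n) a = 0)"
    "l \<in> car K" "tends K s l" "a \<in> A" for s l a
    using tends_ip[of s l a] that A by (auto simp: LIMSEQ_const_iff subset_iff)
  ultimately show ?thesis unfolding closed_linear_def by blast
qed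

lemma (in hilbert) orthogonal_projection:
  assumes M: "closed_linear K M" and v: "v \<in> car K"
  obtains m where "m \<in> M" "\<And>x. x \<in> M \<Longrightarrow> ip K x (v - m) = 0"
proof -
  interpret M: hilbert "K\<lparr>car := M\<rparr>" by (rule restrict_hilbert[OF M])
  have MK [simp]: "x \<in> car K" if "x \<in> M" for x using closed_linearD(2)[OF M] that by blast
  show ?thesis
  proof (rule M.riesz[of M id "\<lambda>x. ip K x v" "nrm K v"])
    fix s y assume "y \<in> car (K\<lparr>car := M\<rparr>)"
      and "\<And>d. d \<in> M \<Longrightarrow> ip K d v = ip (K\<lparr>car := M\<rparr>) (id d) y"
    then show ?thesis using that[of y] v by (simp add: ip_diff_right)
  qed (use v M.subspace_car cauchy_schwarz[of _ v] in \<open>auto simp: linear_on_def ip_simps mult.commute\<close>)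
qed

section \<open>Orthonormal bases\<close>

text \<open>Orthogonality passes from \<open>B\<close> to its span by linearity and to the closure by Cauchy-Schwarz.\<close>

lemma (in posdef_space) basis_total:
  assumes M: "complex_vector.subspace M" "M \<subseteq> car K" and B: "orthonormal_basis (K\<lparr>car := M\<rparr>) B"
    and x: "x \<in> car K" and orth: "\<And>b. b \<in> B \<Longrightarrow> ip K x b = 0" and m: "m \<in> M"
  shows "ip K x m = 0"
proof -
  interpret M: posdef_space "K\<lparr>car := M\<rparr>" using restrict_posdef[OF M] .
  interpret Metric_space M "inner_dist (K\<lparr>car := M\<rparr>)" using M.Metric_space_inner_dist by simp
  have BM: "B \<subseteq> M" and cl: "mtopology closure_of complex_vector.span B = M"
    using B by (simp_all add: orthonormal_basis_def inner_topology_def)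
  have sp: "complex_vector.span B \<subseteq> M" using BM M(1) by (rule complex_vector.span_minimal)
  have "complex_vector.subspace {y \<in> car K. ip K x y = 0}"
    unfolding complex_vector.subspace_def using x by (auto simp: ip_simps)
  moreover have "B \<subseteq> {y \<in> car K. ip K x y = 0}" using BM M(2) orth by auto
  ultimately have sp0: "complex_vector.span B \<subseteq> {y \<in> car K. ip K x y = 0}"
    using complex_vector.span_minimal by blast
  have le: "cmod (ip K x m) \<le> nrm K x * r" if r: "r > 0" for r
  proof -
    obtain y where y: "y \<in> complex_vector.span B" "y \<in> mball m r"
      using m cl r unfolding metric_closure_of by blast
    have y0: "ip K x y = 0" and yK: "y \<in> car K" using y sp0 by auto
    have "nrm K (m - y) < r"
      using y sp M.inner_dist_nrm[of m y] m by auto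
    moreover have "ip K x m = ip K x (m - y)"
      using y0 yK m M(2) x by (auto simp: ip_diff_right)
    moreover have "cmod (ip K x (m - y)) \<le> nrm K x * nrm K (m - y)"
      using yK m M(2) x by (intro cauchy_schwarz) auto
    ultimately show ?thesis
      using mult_left_mono[of "nrm K (m - y)" r "nrm K x"] x by auto
  qed
  have "cmod (ip K x m) \<le> 0"
  proof (rule field_le_epsilon)
    fix e :: real assume e: "e > 0"
    have "cmod (ip K x m) \<le> nrm K x * (e / (nrm K x + 1))"
      using e x nrm_ge0[OF x] by (intro le) (auto intro: divide_pos_pos simp del: nrm_ge0)
    also have "\<dots> \<le> e" using e nrm_ge0[OF x] by (simp add: field_simps)
    finally show "cmod (ip K x m) \<le> 0 + e" by simp
  qed
  then show ?thesis by simp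
qed

text \<open>A maximal orthonormal set \<open>B\<close> is a basis: the Riesz lemma on the span of \<open>B\<close> gives for each \<open>v\<close>
a limit \<open>y\<close> of vectors of the span with \<open>v - y\<close> orthogonal to \<open>B\<close>, and a nonzero \<open>v - y\<close>
could be normalized and added to \<open>B\<close>.\<close>

lemma (in hilbert) basis_exists: "\<exists>B. orthonormal_basis K B"
proof -
  define ON where "ON B \<longleftrightarrow> B \<subseteq> car K \<and> (\<forall>x\<in>B. \<forall>y\<in>B. ip K x y = (if x = y then 1 else 0))" for B
  have "\<exists>B\<in>Collect ON. \<forall>X\<in>Collect ON. B \<subseteq> X \<longrightarrow> X = B"
  proof (rule subset_Zorn)
    fix C assume C: "subset.chain (Collect ON) C"
    have "ON (\<Union>C)" unfolding ON_def
    proof (intro conjI ballI)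
      show "\<Union>C \<subseteq> car K" using C unfolding subset.chain_def ON_def by blast
      fix x y assume "x \<in> \<Union>C" "y \<in> \<Union>C"
      then obtain X Y where XY: "X \<in> C" "Y \<in> C" "x \<in> X" "y \<in> Y" by blast
      then have "X \<subseteq> Y \<or> Y \<subseteq> X" using C unfolding subset.chain_def by blast
      then obtain Z where "Z \<in> C" "x \<in> Z" "y \<in> Z" using XY by blast
      then show "ip K x y = (if x = y then 1 else 0)"
        using C unfolding subset.chain_def ON_def by blast
    qed
    then show "\<exists>U\<in>Collect ON. \<forall>X\<in>C. X \<subseteq> U" by blast
  qed
  then obtain B where B: "ON B" and maxi: "\<And>X. ON X \<Longrightarrow> B \<subseteq> X \<Longrightarrow> X = B" by blast
  have BK: "B \<subseteq> car K" using B by (simp add: ON_def)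
  interpret Metric_space "car K" "inner_dist K" by (rule Metric_space_inner_dist)
  have sp: "complex_vector.span B \<subseteq> car K" using BK subspace_car by (rule complex_vector.span_minimal)
  have dense: "\<exists>y\<in>complex_vector.span B. y \<in> mball v r" if v: "v \<in> car K" and r: "r > 0" for v r
  proof -
    obtain s y where s: "\<And>n. s n \<in> complex_vector.span B" and y: "y \<in> car K"
      and lim: "tends K s y" and eq: "\<And>d. d \<in> complex_vector.span B \<Longrightarrow> ip K d v = ip K d y"
    proof (rule riesz[of "complex_vector.span B" id "\<lambda>x. ip K x v" "nrm K v"])
      show "linear_on (complex_vector.span B) (car K) id" using sp by (auto simp: linear_on_def)
    qed (use v sp cauchy_schwarz[of _ v] in
        \<open>auto simp: ip_simps subset_iff mult.commute complex_vector.subspace_span\<close>)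
    have "v = y"
    proof (rule ccontr)
      assume ne: "v \<noteq> y"
      define e where "e = of_real (1 / nrm K (v - y)) *\<^sub>C (v - y)"
      have pos: "0 < nrm K (v - y)" using ne v y by (intro nrm_pos) auto
      have e: "e \<in> car K" using v y by (simp add: e_def)
      have ee: "ip K e e = 1"
        using v y pos ne unfolding e_def by (simp add: ip_scale_left ip_scale_right ip_self_nrm power2_eq_square norm_divide)
      have be: "ip K b e = 0" if "b \<in> B" for b
        using eq[of b] that BK v y complex_vector.span_base[OF that] unfolding e_def
        by (auto simp: ip_scale_right ip_diff_right)
      have eb: "ip K e b = 0" if "b \<in> B" for b
        using be[OF that] ip_cnj[of b e] that BK e by auto
      have "ON (insert e B)" unfolding ON_def
        using B BK e ee be eb by (auto simp: ON_def)
      then have "e \<in> B" using maxi by blast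
      then show False using be[of e] ee by simp
    qed
    moreover obtain n where "nrm K (s n - y) < r"
      using lim r unfolding tends_def LIMSEQ_iff
      by (metis abs_less_iff diff_zero le_refl real_norm_def)
    ultimately have "s n \<in> mball v r"
      using s[of n] sp v y inner_dist_nrm[of v "s n"] nrm_diff_commute[of y "s n"] by auto
    then show ?thesis using s by blast
  qed
  have "orthonormal_basis K B"
    unfolding orthonormal_basis_def inner_topology_def metric_closure_of
    using B dense by (auto simp: ON_def)
  then show ?thesis by blast
qed

lemma (in hilbert) hilbert_dim_basis:
  obtains B where "orthonormal_basis K B" "hilbert_dim K = |B|"
  using someI_ex[OF basis_exists] unfolding hilbert_dim_def by blast

section \<open>Bounding the size of an orthonormal family\<close>

text \<open>Gaussian elimination for a system with fewer equations than unknowns. It is the finite case of the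
cardinality bound below.\<close>

lemma homogeneous_system:
  fixes a :: "'i \<Rightarrow> 'b \<Rightarrow> complex"
  assumes "finite I" "finite B" "card I < card B"
  shows "\<exists>c. (\<exists>b\<in>B. c b \<noteq> 0) \<and> (\<forall>i\<in>I. (\<Sum>b\<in>B. c b * a i b) = 0)"
  using assms
proof (induction I arbitrary: a B rule: finite_induct)
  case empty
  then have "B \<noteq> {}" by auto
  then show ?case by (intro exI[of _ "\<lambda>_. 1"]) auto
next
  case (insert i I)
  show ?case
  proof (cases "\<forall>b\<in>B. a i b = 0")
    case True
    then show ?thesis using insert.IH[of B a] insert.prems insert.hyps by auto
  next
    case False
    then obtain b0 where b0: "b0 \<in> B" "a i b0 \<noteq> 0" by blast
    define B' where "B' = B - {b0}"
    have B': "finite B'" "card I < card B'" "b0 \<notin> B'" "B = insert b0 B'"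
      using insert b0 by (auto simp: B'_def)
    obtain c where c: "\<exists>b\<in>B'. c b \<noteq> 0"
      "\<And>j. j \<in> I \<Longrightarrow> (\<Sum>b\<in>B'. c b * (a j b - a j b0 * (a i b / a i b0))) = 0"
      using insert.IH[of B' "\<lambda>j b. a j b - a j b0 * (a i b / a i b0)"] B' by auto
    define t where "t = - (\<Sum>b\<in>B'. c b * a i b) / a i b0"
    define c' where "c' = c(b0 := t)"
    have sum': "(\<Sum>b\<in>B. c' b * a j b) = t * a j b0 + (\<Sum>b\<in>B'. c b * a j b)" for j
    proof -
      have "(\<Sum>b\<in>B'. c' b * a j b) = (\<Sum>b\<in>B'. c b * a j b)"
        using B'(3) by (intro sum.cong) (auto simp: c'_def)
      then show ?thesis using B' by (simp add: c'_def)
    qed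
    have "(\<Sum>b\<in>B. c' b * a j b) = 0" if "j \<in> I" for j
    proof -
      have "(\<Sum>b\<in>B'. c b * a j b) - (a j b0 / a i b0) * (\<Sum>b\<in>B'. c b * a i b) = 0"
        using c(2)[OF that] by (simp add: algebra_simps sum_subtractf sum_distrib_left)
      then show ?thesis unfolding sum' t_def by simp
    qed
    moreover have "(\<Sum>b\<in>B. c' b * a i b) = 0" using b0 unfolding sum' t_def by simp
    moreover have "\<exists>b\<in>B. c' b \<noteq> 0" using c(1) B' by (auto simp: c'_def)
    ultimately show ?thesis by auto
  qed
qed

definition bounded_functional :: "'a::complex_vector inner_space \<Rightarrow> ('a \<Rightarrow> complex) \<Rightarrow> bool" where
  "bounded_functional K phi \<longleftrightarrow> (\<forall>x\<in>car K. \<forall>y\<in>car K. phi (x + y) = phi x + phi y) \<and>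
     (\<forall>a. \<forall>x\<in>car K. phi (a *\<^sub>C x) = a * phi x) \<and>
     (\<exists>c. \<forall>x\<in>car K. cmod (phi x) \<le> c * nrm K x)"

context posdef_space begin

lemma functional_sum:
  assumes "bounded_functional K phi" "\<And>b. b \<in> F \<Longrightarrow> b \<in> car K"
  shows "phi (\<Sum>b\<in>F. c b *\<^sub>C b) = (\<Sum>b\<in>F. c b * phi b)"
proof -
  have add: "\<And>x y. x \<in> car K \<Longrightarrow> y \<in> car K \<Longrightarrow> phi (x + y) = phi x + phi y"
    and sc: "\<And>a x. x \<in> car K \<Longrightarrow> phi (a *\<^sub>C x) = a * phi x"
    using assms(1) unfolding bounded_functional_def by blast+
  have z: "phi 0 = 0" using sc[of 0 0] by simp
  show ?thesis using assms(2)
    by (induction F rule: infinite_finite_induct) (auto simp: add sc z)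
qed

lemma orthonormal_ip_sum:
  assumes "finite F" "F \<subseteq> car K" "\<forall>x\<in>F. \<forall>y\<in>F. ip K x y = (if x = y then 1 else 0)" "y \<in> F"
  shows "ip K (\<Sum>b\<in>F. c b *\<^sub>C b) y = c y"
proof -
  have "ip K (\<Sum>b\<in>F. c b *\<^sub>C b) y = (\<Sum>b\<in>F. c b * ip K b y)"
    using assms by (subst ip_sum_left) (auto simp: subset_iff ip_scale_left)
  also have "\<dots> = (\<Sum>b\<in>F. if b = y then c y else 0)"
    using assms by (intro sum.cong) auto
  finally show ?thesis using assms by simp
qed

text \<open>Bessel's inequality for a functional instead of a vector: test \<open>phi\<close> on the combination of \<open>F\<close>
whose coefficients are the conjugates of the values of \<open>phi\<close>.\<close>

lemma bessel_functional:
  assumes phi: "bounded_functional K phi" and c: "\<And>x. x \<in> car K \<Longrightarrow> cmod (phi x) \<le> c * nrm K x"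
    and F: "finite F" "F \<subseteq> car K" "\<forall>x\<in>F. \<forall>y\<in>F. ip K x y = (if x = y then 1 else 0)"
  shows "(\<Sum>b\<in>F. (cmod (phi b))\<^sup>2) \<le> c\<^sup>2"
proof -
  define S where "S = (\<Sum>b\<in>F. (cmod (phi b))\<^sup>2)"
  define x where "x = (\<Sum>b\<in>F. cnj (phi b) *\<^sub>C b)"
  have x: "x \<in> car K" using F by (auto simp: x_def subset_iff)
  have phx: "phi x = of_real S"
    unfolding x_def S_def functional_sum[OF phi subsetD[OF F(2)], of F "\<lambda>b. cnj (phi b)", simplified]
    by (simp add: complex_norm_square mult.commute del: of_real_power)
  have "ip K x x = (\<Sum>b\<in>F. cnj (phi b) * ip K b x)"
    using F x unfolding x_def[of] by (subst ip_sum_left) (auto simp: subset_iff ip_scale_left)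
  also have "\<dots> = of_real S"
    unfolding S_def of_real_sum
  proof (intro sum.cong refl)
    fix b assume b: "b \<in> F"
    have "ip K b x = cnj (ip K x b)" using b F x by (intro ip_cnj) auto
    also have "ip K x b = cnj (phi b)" unfolding x_def using F b by (rule orthonormal_ip_sum)
    finally show "cnj (phi b) * ip K b x = of_real ((cmod (phi b))\<^sup>2)"
      by (simp add: complex_norm_square mult.commute del: of_real_power)
  qed
  finally have nx: "(nrm K x)\<^sup>2 = S" using x by (simp add: nrm_sq)
  have S0: "0 \<le> S" unfolding S_def by (simp add: sum_nonneg)
  have "S \<le> c * nrm K x" using c[OF x] S0 by (simp add: phx)
  then have "S * S \<le> (c * nrm K x) * (c * nrm K x)" using S0 by (intro mult_mono) auto
  also have "\<dots> = c\<^sup>2 * S" unfolding nx[symmetric] by (simp add: power2_eq_square)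
  finally show ?thesis using S0 unfolding S_def[symmetric] by (cases "S = 0") auto
qed

text \<open>By Bessel's inequality only finitely many members of \<open>B\<close> can have \<open>\<bar>phi b\<bar>\<close> above a given
positive bound.\<close>

lemma countable_support:
  assumes phi: "bounded_functional K phi"
    and B: "B \<subseteq> car K" "\<forall>x\<in>B. \<forall>y\<in>B. ip K x y = (if x = y then 1 else 0)"
  shows "countable {b \<in> B. phi b \<noteq> 0}"
proof -
  obtain c where c: "\<And>x. x \<in> car K \<Longrightarrow> cmod (phi x) \<le> c * nrm K x"
    using phi unfolding bounded_functional_def by blast
  define E where "E n = {b \<in> B. 1 / real (Suc n) \<le> cmod (phi b)}" for n
  have "finite (E n)" for n
  proof -
    have "card F \<le> nat \<lceil>c\<^sup>2 * (real (Suc n))\<^sup>2\<rceil>" if F: "F \<subseteq> E n" "finite F" for F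
    proof -
      have FB: "F \<subseteq> B" using F by (auto simp: E_def)
      have "real (card F) * (1 / real (Suc n))\<^sup>2 = (\<Sum>b\<in>F. (1 / real (Suc n))\<^sup>2)" by simp
      also have "\<dots> \<le> (\<Sum>b\<in>F. (cmod (phi b))\<^sup>2)"
        using F by (intro sum_mono power_mono) (auto simp: E_def)
      also have "\<dots> \<le> c\<^sup>2"
        using FB B by (intro bessel_functional[OF phi c F(2)]) (auto simp: subset_iff)
      finally have "real (card F) \<le> c\<^sup>2 * (real (Suc n))\<^sup>2"
        by (simp add: field_simps)
      then show ?thesis by linarith
    qed
    then show ?thesis using finite_if_finite_subsets_card_bdd by blast
  qed
  moreover have "{b \<in> B. phi b \<noteq> 0} \<subseteq> (\<Union>n. E n)"
  proof
    fix b assume b: "b \<in> {b \<in> B. phi b \<noteq> 0}"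
    then obtain n where "1 / real (Suc n) < cmod (phi b)"
      using nat_approx_posE[of "cmod (phi b)"] by auto
    then show "b \<in> (\<Union>n. E n)" using b by (auto simp: E_def intro!: exI[of _ n])
  qed
  ultimately show ?thesis
    by (meson countable_UN countable_finite countable_subset countableI_type)
qed

text \<open>All comparisons of dimensions rest on this bound. If finitely many functionals separate points, a
larger orthonormal family would contain a nontrivial combination that they all annihilate. If \<open>I\<close>
is infinite, each functional is nonzero on countably many members of \<open>B\<close> only, while every member
is seen by some functional; a union of \<open>\<bar>I\<bar>\<close> countable sets has at most \<open>\<bar>I\<bar>\<close> elements.\<close>

lemma card_orthonormal_le_functionals:
  fixes phi :: "'i \<Rightarrow> 'a \<Rightarrow> complex"
  assumes B: "B \<subseteq> car K" "\<forall>x\<in>B. \<forall>y\<in>B. ip K x y = (if x = y then 1 else 0)"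
    and phi: "\<And>i. i \<in> I \<Longrightarrow> bounded_functional K (phi i)"
    and sep: "\<And>x. x \<in> car K \<Longrightarrow> \<forall>i\<in>I. phi i x = 0 \<Longrightarrow> x = 0"
  shows "|B| \<le>o |I|"
proof (cases "finite I")
  case True
  have small: "card F \<le> card I" if F: "F \<subseteq> B" "finite F" for F
  proof (rule ccontr)
    assume "\<not> card F \<le> card I"
    then obtain c where c: "\<exists>b\<in>F. c b \<noteq> 0" "\<And>i. i \<in> I \<Longrightarrow> (\<Sum>b\<in>F. c b * phi i b) = 0"
      using homogeneous_system[OF True F(2), of phi] by auto
    define x where "x = (\<Sum>b\<in>F. c b *\<^sub>C b)"
    have x: "x \<in> car K" using F B by (auto simp: x_def subset_iff)
    have "\<forall>i\<in>I. phi i x = 0"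
      using functional_sum[OF phi, of _ F c] c(2) F B unfolding x_def by auto
    then have "x = 0" using sep x by blast
    obtain b where b: "b \<in> F" "c b \<noteq> 0" using c by blast
    have FK: "F \<subseteq> car K" and Fo: "\<forall>x\<in>F. \<forall>y\<in>F. ip K x y = (if x = y then 1 else 0)"
      using F B by (auto simp: subset_iff)
    have "ip K x b = c b" unfolding x_def by (rule orthonormal_ip_sum[OF F(2) FK Fo b(1)])
    then show False using b FK \<open>x = 0\<close> by auto
  qed
  then have "finite B \<and> card B \<le> card I" using finite_if_finite_subsets_card_bdd by blast
  then show ?thesis using True inj_on_iff_card_le[of B I] card_of_ordLeq[of B I] by blast
next
  case False
  have "B \<subseteq> (\<Union>i\<in>I. {b \<in> B. phi i b \<noteq> 0})"
  proof
    fix b assume b: "b \<in> B"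
    then have "b \<noteq> 0" using B by force
    then show "b \<in> (\<Union>i\<in>I. {b \<in> B. phi i b \<noteq> 0})" using sep[of b] b B by auto
  qed
  then have "|B| \<le>o |\<Union>i\<in>I. {b \<in> B. phi i b \<noteq> 0}|" by (rule card_of_mono1)
  also have "|\<Union>i\<in>I. {b \<in> B. phi i b \<noteq> 0}| \<le>o |I|"
  proof (rule card_of_UNION_ordLeq_infinite[OF False])
    show "|I| \<le>o |I|" by (rule ordLeq_refl[OF card_of_Card_order])
    show "\<forall>i\<in>I. |{b \<in> B. phi i b \<noteq> 0}| \<le>o |I|"
    proof
      fix i assume "i \<in> I"
      then obtain f :: "'a \<Rightarrow> nat" where "inj_on f {b \<in> B. phi i b \<noteq> 0}"
        using countable_support[OF phi B] unfolding countable_def by blast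
      then have "|{b \<in> B. phi i b \<noteq> 0}| \<le>o |UNIV :: nat set|"
        using card_of_ordLeq by blast
      then show "|{b \<in> B. phi i b \<noteq> 0}| \<le>o |I|"
        using False infinite_iff_card_of_nat ordLeq_transitive by blast
    qed
  qed
  finally show ?thesis .
qed

end

section \<open>Square roots of positive operators\<close>

text \<open>The square root of \<open>1 - X\<close> is \<open>1 - Y\<close> where \<open>Y\<close> solves \<open>2 Y = X + Y\<^sup>2\<close>. Iterating this equation
from 0 gives polynomials in \<open>X\<close>. The same iteration for the number 1 in place of \<open>X\<close> is
\<open>sqrt_bound\<close>; it dominates norms and increments of the operator iteration, so that no monotone
convergence of operators is needed.\<close>

primrec sqrt_iter :: "('a::complex_vector \<Rightarrow> 'a) \<Rightarrow> nat \<Rightarrow> 'a \<Rightarrow> 'a" where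
  "sqrt_iter X 0 = (\<lambda>x. 0)"
| "sqrt_iter X (Suc n) = (\<lambda>x. (1/2) *\<^sub>C (X x + sqrt_iter X n (sqrt_iter X n x)))"

primrec sqrt_bound :: "nat \<Rightarrow> real" where
  "sqrt_bound 0 = 0"
| "sqrt_bound (Suc n) = (1 + (sqrt_bound n)\<^sup>2) / 2"

lemma sqrt_bound_range: "0 \<le> sqrt_bound n" "sqrt_bound n \<le> 1"
proof -
  have "0 \<le> sqrt_bound n \<and> sqrt_bound n \<le> 1"
    by (induction n) (auto simp: power_le_one)
  then show "0 \<le> sqrt_bound n" "sqrt_bound n \<le> 1" by auto
qed

lemma sqrt_bound_convergent: "\<exists>L\<le>1. sqrt_bound \<longlonglongrightarrow> L"
proof -
  have "sqrt_bound n \<le> sqrt_bound (Suc n)" for n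
    using zero_le_power2[of "sqrt_bound n - 1"] by (simp add: power2_diff)
  then have "incseq sqrt_bound" by (rule incseq_SucI)
  then obtain L where "sqrt_bound \<longlonglongrightarrow> L" "\<forall>i. sqrt_bound i \<le> L"
    using incseq_convergent[of sqrt_bound 1] sqrt_bound_range by blast
  moreover have "L \<le> 1" using calculation(1) sqrt_bound_range(2)
    by (intro LIMSEQ_le_const2) auto
  ultimately show ?thesis by blast
qed

context hilbert begin

lemma linear_on_iter: "linear_on (car K) (car K) X \<Longrightarrow> linear_on (car K) (car K) (sqrt_iter X n)"
proof (induction n)
  case (Suc n)
  note X = Suc.prems and Y = Suc.IH[OF Suc.prems]
  note [simp] = linear_on_mem[OF X] linear_on_mem[OF Y]
  show ?case unfolding linear_on_def
    by (auto simp: linear_on_add[OF X] linear_on_add[OF Y] linear_on_scale[OF X] linear_on_scale[OF Y]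
        complex_vector.scale_right_distrib mult.commute)
qed (simp add: linear_on_def)

lemma iter_commute:
  assumes X: "linear_on (car K) (car K) X" and U: "linear_on (car K) (car K) U"
    and comm: "\<And>x. x \<in> car K \<Longrightarrow> U (X x) = X (U x)" and x: "x \<in> car K"
  shows "U (sqrt_iter X n x) = sqrt_iter X n (U x)"
  using x
proof (induction n arbitrary: x)
  case 0
  then show ?case using linear_on_zero[OF U subspace_car] by simp
next
  case (Suc n)
  note [simp] = linear_on_mem[OF X] linear_on_mem[OF U] linear_on_mem[OF linear_on_iter[OF X]]
  show ?case using Suc by (simp add: linear_on_scale[OF U] linear_on_add[OF U] comm)
qed

lemma iter_bound:
  assumes X: "linear_on (car K) (car K) X" and c: "\<And>x. x \<in> car K \<Longrightarrow> nrm K (X x) \<le> nrm K x"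
    and x: "x \<in> car K"
  shows "nrm K (sqrt_iter X n x) \<le> sqrt_bound n * nrm K x"
  using x
proof (induction n arbitrary: x)
  case (Suc n)
  note [simp] = linear_on_mem[OF X] linear_on_mem[OF linear_on_iter[OF X]]
  let ?Y = "sqrt_iter X n" and ?a = "sqrt_bound n"
  have "nrm K (?Y (?Y x)) \<le> ?a * nrm K (?Y x)" using Suc by simp
  also have "\<dots> \<le> ?a * (?a * nrm K x)" using Suc sqrt_bound_range by (intro mult_left_mono) auto
  finally have "nrm K (X x + ?Y (?Y x)) \<le> nrm K x + ?a\<^sup>2 * nrm K x"
    using nrm_triangle[of "X x" "?Y (?Y x)"] c[of x] Suc.prems
    by (simp add: power2_eq_square mult.assoc)
  moreover have "nrm K (sqrt_iter X (Suc n) x) = nrm K (X x + ?Y (?Y x)) / 2" using Suc.prems by simp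
  ultimately show ?case by (simp add: field_simps del: sqrt_iter.simps)
qed simp

text \<open>Since the iterates commute, a difference of squares factors:
\<open>Y' Y' - Y Y = Y' (Y' - Y) + Y (Y' - Y)\<close>. The estimate is the operator shadow of
\<open>b\<^sup>2 - a\<^sup>2 = (b + a) (b - a)\<close>.\<close>

lemma iter_step:
  assumes X: "linear_on (car K) (car K) X" and c: "\<And>x. x \<in> car K \<Longrightarrow> nrm K (X x) \<le> nrm K x"
    and x: "x \<in> car K"
  shows "nrm K (sqrt_iter X (Suc n) x - sqrt_iter X n x) \<le> (sqrt_bound (Suc n) - sqrt_bound n) * nrm K x"
  using x
proof (induction n arbitrary: x)
  case 0
  then show ?case using c[of x] linear_on_mem[OF X] by simp
next
  case (Suc n)
  let ?Y = "sqrt_iter X n" and ?Z = "sqrt_iter X (Suc n)"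
  let ?a = "sqrt_bound n" and ?b = "sqrt_bound (Suc n)"
  note Y = linear_on_iter[OF X, of n] and Z = linear_on_iter[OF X, of "Suc n"]
  note [simp] = linear_on_mem[OF X] linear_on_mem[OF Y] linear_on_mem[OF Z] Suc.prems
  note [simp del] = sqrt_iter.simps sqrt_bound.simps
  define z where "z = ?Z x - ?Y x"
  have z [simp]: "z \<in> car K" by (simp add: z_def)
  have comm: "?Y (?Z x) = ?Z (?Y x)"
    using iter_commute[OF X Y, of x "Suc n"] iter_commute[OF X X, of _ n] by simp
  have "sqrt_iter X (Suc (Suc n)) x - ?Z x = (1/2) *\<^sub>C (?Z (?Z x) - ?Y (?Y x))"
    using sqrt_iter.simps(2)[of X "Suc n"] sqrt_iter.simps(2)[of X n]
    by (simp add: complex_vector.scale_right_diff_distrib[symmetric])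
  also have "\<dots> = (1/2) *\<^sub>C (?Z z + ?Y z)"
    by (simp add: z_def linear_on_diff[OF Y subspace_car] linear_on_diff[OF Z subspace_car] comm)
  finally have "nrm K (sqrt_iter X (Suc (Suc n)) x - ?Z x) = nrm K (?Z z + ?Y z) / 2" by simp
  also have "\<dots> \<le> (nrm K (?Z z) + nrm K (?Y z)) / 2" using nrm_triangle[of "?Z z" "?Y z"] by simp
  also have "\<dots> \<le> (?b * nrm K z + ?a * nrm K z) / 2"
    using iter_bound[OF X c z, of "Suc n"] iter_bound[OF X c z, of n] by simp
  also have "\<dots> = (?b + ?a) / 2 * nrm K z" by (simp add: algebra_simps)
  also have "\<dots> \<le> (?b + ?a) / 2 * ((?b - ?a) * nrm K x)"
    using Suc.IH[of x] sqrt_bound_range[of n] sqrt_bound_range[of "Suc n"] unfolding z_def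
    by (intro mult_left_mono) simp_all
  also have "\<dots> = (sqrt_bound (Suc (Suc n)) - ?b) * nrm K x"
    using sqrt_bound.simps(2)[of "Suc n"] sqrt_bound.simps(2)[of n]
    by (simp add: power2_eq_square algebra_simps add_divide_distrib diff_divide_distrib)
  finally show ?case .
qed

text \<open>With \<open>Y\<close> as below, \<open>(1 - Y)\<^sup>2 = 1 - X\<close>. The bound on \<open>Y\<close> says that \<open>1 - (1 - Y)\<close> is again a
contraction, so that the construction can be applied a second time, and the commutation property
passes from \<open>X\<close> to \<open>Y\<close>.\<close>

lemma sqrt_fixed_point:
  assumes X: "linear_on (car K) (car K) X" and c: "\<And>x. x \<in> car K \<Longrightarrow> nrm K (X x) \<le> nrm K x"
    and sym: "\<And>x y. x \<in> car K \<Longrightarrow> y \<in> car K \<Longrightarrow> ip K (X x) y = ip K x (X y)"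
  obtains Y where "linear_on (car K) (car K) Y" "\<And>x. x \<in> car K \<Longrightarrow> nrm K (Y x) \<le> nrm K x"
    "\<And>x y. x \<in> car K \<Longrightarrow> y \<in> car K \<Longrightarrow> ip K (Y x) y = ip K x (Y y)"
    "\<And>x. x \<in> car K \<Longrightarrow> Y x + Y x = X x + Y (Y x)"
    "\<And>U x. bounded_op K K U \<Longrightarrow> (\<And>x. x \<in> car K \<Longrightarrow> U (X x) = X (U x)) \<Longrightarrow> x \<in> car K \<Longrightarrow> U (Y x) = Y (U x)"
proof -
  let ?Y = "sqrt_iter X"
  note Yn = linear_on_iter[OF X]
  note [simp] = linear_on_mem[OF X] linear_on_mem[OF Yn]
  obtain L where L: "L \<le> 1" "sqrt_bound \<longlonglongrightarrow> L" using sqrt_bound_convergent by blast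
  have bnd: "nrm K (?Y n x) \<le> nrm K x" if "x \<in> car K" for n x
    using iter_bound[OF X c that, of n] sqrt_bound_range[of n] that mult_right_mono[of "sqrt_bound n" 1 "nrm K x"]
    by simp
  have "\<exists>l\<in>car K. tends K (\<lambda>n. ?Y n x) l" if x: "x \<in> car K" for x
  proof (rule complete)
    show "range (\<lambda>n. ?Y n x) \<subseteq> car K" using x by auto
    then show "cauchy K (\<lambda>n. ?Y n x)"
    proof (rule cauchy_telescope(1))
      show "(\<lambda>n. sqrt_bound n * nrm K x) \<longlonglongrightarrow> L * nrm K x" using L by (intro tendsto_intros)
      show "\<And>n. nrm K (?Y (Suc n) x - ?Y n x) \<le> sqrt_bound (Suc n) * nrm K x - sqrt_bound n * nrm K x"
        using iter_step[OF X c x] by (simp only: left_diff_distrib)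
    qed
  qed
  then obtain Y where Y [simp]: "\<And>x. x \<in> car K \<Longrightarrow> Y x \<in> car K"
    and lim: "\<And>x. x \<in> car K \<Longrightarrow> tends K (\<lambda>n. ?Y n x) (Y x)" by metis
  have linY: "linear_on (car K) (car K) Y" unfolding linear_on_def
  proof (intro conjI ballI allI)
    fix x y assume xy: "x \<in> car K" "y \<in> car K"
    have "tends K (\<lambda>n. ?Y n (x + y)) (Y x + Y y)"
      using tends_add[OF _ _ _ _ lim lim, of x y] xy by (simp add: linear_on_add[OF Yn])
    then show "Y (x + y) = Y x + Y y"
      using xy by (intro tends_unique[OF _ _ _ lim]) auto
  next
    fix a x assume x: "x \<in> car K"
    have "tends K (\<lambda>n. ?Y n (a *\<^sub>C x)) (a *\<^sub>C Y x)"
      using tends_scale[OF _ _ lim, of x a] x by (simp add: linear_on_scale[OF Yn])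
    then show "Y (a *\<^sub>C x) = a *\<^sub>C Y x"
      using x by (intro tends_unique[OF _ _ _ lim]) auto
  qed simp
  have bndY: "nrm K (Y x) \<le> nrm K x" if x: "x \<in> car K" for x
    using x by (intro LIMSEQ_le_const2[OF tends_nrm[OF _ _ lim]]) (auto intro: bnd)
  have symn: "ip K (?Y n x) y = ip K x (?Y n y)" if "x \<in> car K" "y \<in> car K" for n x y
    using that
    by (induction n arbitrary: x y) (simp_all add: sym ip_scale_left ip_scale_right ip_add_left ip_add_right)
  have symY: "ip K (Y x) y = ip K x (Y y)" if x: "x \<in> car K" and y: "y \<in> car K" for x y
  proof (rule LIMSEQ_unique)
    show "(\<lambda>n. ip K (?Y n x) y) \<longlonglongrightarrow> ip K (Y x) y"
      using x y by (intro tends_ip[OF _ _ _ lim]) auto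
    show "(\<lambda>n. ip K (?Y n x) y) \<longlonglongrightarrow> ip K x (Y y)"
      using tends_ip_right[OF _ _ _ lim, of y x] x y by (simp add: symn)
  qed
  have commY: "U (Y x) = Y (U x)"
    if U: "bounded_op K K U" and comm: "\<And>x. x \<in> car K \<Longrightarrow> U (X x) = X (U x)" and x: "x \<in> car K" for U x
  proof -
    note [simp] = linear_on_mem[OF bounded_op_linear[OF U]]
    have "tends K (\<lambda>n. U (?Y n x)) (U (Y x))"
      using x lim by (intro tends_bounded_op[OF U posdef_space_axioms]) auto
    then have "tends K (\<lambda>n. ?Y n (U x)) (U (Y x))"
      using iter_commute[OF X bounded_op_linear[OF U] comm x] by simp
    then show ?thesis using x lim[of "U x"] by (intro tends_unique[of "\<lambda>n. ?Y n (U x)"]) auto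
  qed
  have eq: "Y x + Y x = X x + Y (Y x)" if x: "x \<in> car K" for x
  proof (rule tends_unique)
    show "tends K (\<lambda>n. ?Y (Suc n) x + ?Y (Suc n) x) (Y x + Y x)"
      using x lim[OF x] LIMSEQ_Suc unfolding tends_def[symmetric]
      by (intro tends_add) (auto simp: tends_def intro: LIMSEQ_Suc simp del: sqrt_iter.simps)
    have "tends K (\<lambda>n. ?Y n (?Y n x)) (Y (Y x))"
      unfolding tends_def
    proof (rule Lim_null_comparison)
      have "nrm K (?Y n (?Y n x) - Y (Y x)) \<le> nrm K (?Y n x - Y x) + nrm K (?Y n (Y x) - Y (Y x))" for n
        using nrm_triangle3[of "?Y n (?Y n x)" "?Y n (Y x)" "Y (Y x)"] bnd[of "?Y n x - Y x" n] x
        by (simp add: linear_on_diff[OF Yn subspace_car])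
      then show "\<forall>\<^sub>F n in sequentially. norm (nrm K (?Y n (?Y n x) - Y (Y x)))
          \<le> nrm K (?Y n x - Y x) + nrm K (?Y n (Y x) - Y (Y x))" using x by simp
      show "(\<lambda>n. nrm K (?Y n x - Y x) + nrm K (?Y n (Y x) - Y (Y x))) \<longlonglongrightarrow> 0"
        using tendsto_add[OF lim[OF x, unfolded tends_def] lim[of "Y x", unfolded tends_def]] x by simp
    qed
    then have "tends K (\<lambda>n. X x + ?Y n (?Y n x)) (X x + Y (Y x))"
      using x by (intro tends_add) auto
    moreover have "?Y (Suc n) x + ?Y (Suc n) x = X x + ?Y n (?Y n x)" for n
      by (simp add: complex_vector.scale_left_distrib[symmetric])
    ultimately show "tends K (\<lambda>n. ?Y (Suc n) x + ?Y (Suc n) x) (X x + Y (Y x))" by simp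
  qed (use x in \<open>auto simp del: sqrt_iter.simps\<close>)
  show ?thesis using that[OF linY bndY symY eq commY] by blast
qed

end

section \<open>Uniform boundedness and the spectral splitting\<close>

context hilbert begin

text \<open>The uniform boundedness principle for the functionals given by the vectors of \<open>E\<close>, with an
elementary proof by a gliding hump. If \<open>E\<close> were unbounded, choose \<open>x n \<in> E\<close> of rapidly growing
norm and build \<open>g\<close> by adding or subtracting, at stage \<open>n\<close>, the multiple \<open>v n\<close> of \<open>x n\<close> of norm
\<open>3\<^sup>-\<^sup>n\<close>. One of the two signs keeps \<open>\<bar>ip g (x n)\<bar>\<close> at least \<open>3\<^sup>-\<^sup>n \<bar>x n\<bar>\<close>, and all later stages
together move \<open>g\<close> by at most half of \<open>3\<^sup>-\<^sup>n\<close>.\<close>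

lemma weakly_bounded_imp_bounded:
  assumes E: "E \<subseteq> car K" and weak: "\<And>g. g \<in> car K \<Longrightarrow> \<exists>c. \<forall>x\<in>E. cmod (ip K g x) \<le> c"
  shows "\<exists>c. \<forall>x\<in>E. nrm K x \<le> c"
proof (rule ccontr)
  assume "\<not> ?thesis"
  then have "\<forall>n::nat. \<exists>x\<in>E. 2 * 3 ^ n * (real n + 1) < nrm K x" by (meson not_le)
  then obtain x where xE: "\<And>n. x n \<in> E" and big: "\<And>n. 2 * 3 ^ n * (real n + 1) < nrm K (x n)"
    by metis
  have x [simp]: "x n \<in> car K" for n using xE E by blast
  have pos: "0 < nrm K (x n)" for n
    using big[of n] by (rule less_trans[rotated]) simp
  have ne [simp]: "x n \<noteq> 0" for n using pos[of n] by auto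
  define v where "v n = of_real ((1/3) ^ n / nrm K (x n)) *\<^sub>C x n" for n
  have v [simp]: "v n \<in> car K" for n by (simp add: v_def)
  have nv: "nrm K (v n) = (1/3) ^ n" for n
    using pos[of n] by (simp add: v_def norm_divide norm_power del: of_real_divide of_real_power)
  have vx: "ip K (v n) (x n) = of_real ((1/3) ^ n * nrm K (x n))" for n
    using pos[of n] by (simp add: v_def ip_scale_left ip_self_nrm power2_eq_square)
  \<comment> \<open>the two candidates differ by \<open>2 v n\<close>, so one of them is large at \<open>x n\<close>\<close>
  have choice: "\<exists>w\<in>{v n, - v n}. (1/3) ^ n * nrm K (x n) \<le> cmod (ip K (g + w) (x n))"
    if g: "g \<in> car K" for g n
  proof -
    have "ip K (g + v n) (x n) - ip K (g + - v n) (x n) = 2 * ip K (v n) (x n)"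
      using g by (simp add: ip_diff_left ip_add_left)
    then have "2 * cmod (ip K (v n) (x n)) \<le> cmod (ip K (g + v n) (x n)) + cmod (ip K (g + - v n) (x n))"
      using norm_triangle_ineq4[of "ip K (g + v n) (x n)" "ip K (g + - v n) (x n)"] by (simp add: norm_mult)
    moreover have "cmod (ip K (v n) (x n)) = (1/3) ^ n * nrm K (x n)"
      unfolding vx using pos[of n] by (simp only: norm_of_real abs_of_nonneg) simp
    ultimately show ?thesis by auto
  qed
  define w where "w g n = (SOME w. w \<in> {v n, - v n} \<and> (1/3) ^ n * nrm K (x n) \<le> cmod (ip K (g + w) (x n)))"
    for g n
  have w: "w g n \<in> {v n, - v n}" "(1/3) ^ n * nrm K (x n) \<le> cmod (ip K (g + w g n) (x n))"
    if "g \<in> car K" for g n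
    using someI_ex[OF choice[OF that, of n, unfolded Bex_def]] unfolding w_def by blast+
  have wK [simp]: "w g n \<in> car K" and nw: "nrm K (w g n) = (1/3) ^ n" if "g \<in> car K" for g n
    using w(1)[OF that, of n] nv[of n] by auto
  define g where "g = rec_nat 0 (\<lambda>n g. g + w g n)"
  have g0: "g 0 = 0" and gS: "g (Suc n) = g n + w (g n) n" for n by (simp_all add: g_def)
  have g [simp]: "g n \<in> car K" for n by (induction n) (simp_all add: g0 gS)
  \<comment> \<open>\<open>b\<close> is minus the tail of the geometric series: its increment at \<open>n\<close> is \<open>3\<^sup>-\<^sup>n\<close>\<close>
  define b :: "nat \<Rightarrow> real" where "b n = - (3/2) * (1/3) ^ n" for n
  have b: "b \<longlonglongrightarrow> 0"
    unfolding b_def by (rule tendsto_mult_right_zero) (rule LIMSEQ_power_zero, simp)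
  have rg: "range g \<subseteq> car K" by auto
  have step: "nrm K (g (Suc n) - g n) \<le> b (Suc n) - b n" for n
    by (simp add: gS nw b_def)
  obtain l where l [simp]: "l \<in> car K" and lim: "tends K g l"
    using complete[OF rg cauchy_telescope(1)[OF rg b step]] by blast
  have close: "nrm K (l - g m) \<le> - b m" for m
  proof (rule LIMSEQ_le)
    show "(\<lambda>n. nrm K (g n - g m)) \<longlonglongrightarrow> nrm K (l - g m)"
      using tends_add[OF _ _ _ _ lim tends_const, of "- g m"] by (intro tends_nrm) auto
    show "(\<lambda>n. b n - b m) \<longlonglongrightarrow> - b m" using tendsto_diff[OF b tendsto_const[of "b m"]] by simp
    show "\<exists>N. \<forall>n\<ge>N. nrm K (g n - g m) \<le> b n - b m"
      using cauchy_telescope(2)[OF rg b step] by blast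
  qed
  obtain c where c: "\<And>n. cmod (ip K l (x n)) \<le> c" using weak[OF l] xE by blast
  have "real n + 1 \<le> c" for n
  proof -
    have "(1/3) ^ n * nrm K (x n) \<le> cmod (ip K (g (Suc n)) (x n))" unfolding gS by (rule w) simp
    also have "\<dots> \<le> cmod (ip K l (x n)) + cmod (ip K (l - g (Suc n)) (x n))"
      using norm_triangle_ineq4[of "ip K l (x n)" "ip K (l - g (Suc n)) (x n)"] by (simp add: ip_diff_left)
    also have "cmod (ip K (l - g (Suc n)) (x n)) \<le> (1/2) * (1/3) ^ n * nrm K (x n)"
      using cauchy_schwarz[of "l - g (Suc n)" "x n"] mult_right_mono[OF close[of "Suc n"], of "nrm K (x n)"]
      by (simp add: b_def)
    finally have "(1/2) * (1/3) ^ n * nrm K (x n) \<le> c" using c[of n] by simp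
    moreover have "(1/2) * (1/3) ^ n * (2 * 3 ^ n * (real n + 1)) \<le> (1/2) * (1/3) ^ n * nrm K (x n)"
      using big[of n] by (intro mult_left_mono) auto
    moreover have "(1/2) * (1/3) ^ n * (2 * 3 ^ n * (real n + 1)) = real n + 1"
      by (simp add: power_divide)
    ultimately show ?thesis by linarith
  qed
  moreover obtain n where "c < real n" using reals_Archimedean2 by blast
  ultimately show False by (smt (verit))
qed

text \<open>What is used of the spectral theorem: a selfadjoint \<open>G\<close> is reduced by an orthogonal splitting into
subspaces \<open>M\<close> and \<open>N\<close> on which it is \<open>S\<^sup>2\<close> and \<open>- S\<^sup>2\<close>. Here \<open>S\<^sup>2\<close> is the absolute value \<open>R\<close> of
\<open>G\<close>, the square root of \<open>G\<^sup>2\<close>, and \<open>N\<close> is the kernel of \<open>R + G\<close>. Because \<open>R\<close> commutes with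
\<open>G\<close>, the range of \<open>R - G\<close> lies in \<open>N\<close>, so \<open>R = G\<close> on the complement \<open>M\<close>. The whole kernel of \<open>G\<close> is
in \<open>N\<close>, which makes \<open>S\<close> injective on \<open>M\<close>.\<close>

lemma spectral_contraction:
  assumes G: "linear_on (car K) (car K) G" and c: "\<And>x. x \<in> car K \<Longrightarrow> nrm K (G x) \<le> nrm K x"
    and sym: "\<And>x y. x \<in> car K \<Longrightarrow> y \<in> car K \<Longrightarrow> ip K (G x) y = ip K x (G y)"
  obtains S M N where "bounded_op K K S" "\<And>x y. x \<in> car K \<Longrightarrow> y \<in> car K \<Longrightarrow> ip K (S x) y = ip K x (S y)"
    "closed_linear K M" "closed_linear K N" "\<And>x y. x \<in> M \<Longrightarrow> y \<in> N \<Longrightarrow> ip K x y = 0"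
    "\<And>x. x \<in> car K \<Longrightarrow> \<exists>m\<in>M. \<exists>n\<in>N. x = m + n"
    "\<And>x. x \<in> M \<Longrightarrow> S x \<in> M" "\<And>x. x \<in> N \<Longrightarrow> S x \<in> N"
    "\<And>x. x \<in> M \<Longrightarrow> G x = S (S x)" "\<And>x. x \<in> N \<Longrightarrow> G x = - S (S x)"
    "\<And>x. x \<in> M \<Longrightarrow> S x = 0 \<Longrightarrow> x = 0"
proof -
  note [simp] = linear_on_mem[OF G]
  have Gb: "bounded_op K K G" unfolding bounded_op_def using G c by (intro conjI exI[of _ 1]) auto
  define X where "X x = x - G (G x)" for x
  have X: "linear_on (car K) (car K) X"
    unfolding linear_on_def X_def
    by (auto simp: linear_on_add[OF G] linear_on_scale[OF G] complex_vector.scale_right_diff_distrib)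
  have Xc: "nrm K (X x) \<le> nrm K x" if x: "x \<in> car K" for x
  proof (rule power2_le_imp_le)
    have "nrm K (G (G x)) \<le> nrm K (G x)" using c x by simp
    then have "(nrm K (G (G x)))\<^sup>2 \<le> (nrm K (G x))\<^sup>2" using x by (intro power_mono) auto
    moreover have "Re (ip K x (G (G x))) = (nrm K (G x))\<^sup>2" using x by (simp add: sym[symmetric] nrm_sq)
    moreover have "0 \<le> (nrm K (G x))\<^sup>2" by simp
    moreover have "(nrm K (X x))\<^sup>2 = (nrm K x)\<^sup>2 - 2 * Re (ip K x (G (G x))) + (nrm K (G (G x)))\<^sup>2"
      unfolding X_def using x by (intro nrm_sq_diff) auto
    ultimately show "(nrm K (X x))\<^sup>2 \<le> (nrm K x)\<^sup>2" by linarith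
  qed (use x in simp)
  have Xs: "ip K (X x) y = ip K x (X y)" if "x \<in> car K" "y \<in> car K" for x y
    using that by (simp add: X_def ip_diff_left ip_diff_right sym)
  obtain Y1 where Y1: "linear_on (car K) (car K) Y1" "\<And>x. x \<in> car K \<Longrightarrow> nrm K (Y1 x) \<le> nrm K x"
    "\<And>x y. x \<in> car K \<Longrightarrow> y \<in> car K \<Longrightarrow> ip K (Y1 x) y = ip K x (Y1 y)"
    "\<And>x. x \<in> car K \<Longrightarrow> Y1 x + Y1 x = X x + Y1 (Y1 x)"
    "\<And>U x. bounded_op K K U \<Longrightarrow> (\<And>x. x \<in> car K \<Longrightarrow> U (X x) = X (U x)) \<Longrightarrow> x \<in> car K \<Longrightarrow> U (Y1 x) = Y1 (U x)"
    using sqrt_fixed_point[OF X Xc Xs] by blast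
  obtain Y2 where Y2: "linear_on (car K) (car K) Y2" "\<And>x. x \<in> car K \<Longrightarrow> nrm K (Y2 x) \<le> nrm K x"
    "\<And>x y. x \<in> car K \<Longrightarrow> y \<in> car K \<Longrightarrow> ip K (Y2 x) y = ip K x (Y2 y)"
    "\<And>x. x \<in> car K \<Longrightarrow> Y2 x + Y2 x = Y1 x + Y2 (Y2 x)"
    "\<And>U x. bounded_op K K U \<Longrightarrow> (\<And>x. x \<in> car K \<Longrightarrow> U (Y1 x) = Y1 (U x)) \<Longrightarrow> x \<in> car K \<Longrightarrow> U (Y2 x) = Y2 (U x)"
    using sqrt_fixed_point[OF Y1(1,2,3)] by blast
  note [simp] = linear_on_mem[OF Y1(1)] linear_on_mem[OF Y2(1)]
  have GY1: "G (Y1 x) = Y1 (G x)" if "x \<in> car K" for x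
    using Y1(5)[OF Gb _ that] by (simp add: X_def linear_on_diff[OF G subspace_car])
  have GY2: "G (Y2 x) = Y2 (G x)" if "x \<in> car K" for x
    using Y2(5)[OF Gb GY1 that] by simp
  \<comment> \<open>\<open>R\<close> is the square root of \<open>G\<^sup>2 = 1 - X\<close>, and \<open>S\<close> that of \<open>R = 1 - Y1\<close>\<close>
  define S where "S x = x - Y2 x" for x
  define R where "R x = x - Y1 x" for x
  have S: "bounded_op K K S"
  proof (rule bounded_opI)
    fix x assume "x \<in> car K"
    then show "nrm K (S x) \<le> 2 * nrm K x"
      using nrm_triangle_diff[of x "Y2 x"] Y2(2)[of x] by (simp add: S_def)
  qed (simp_all add: S_def linear_on_add[OF Y2(1)] linear_on_scale[OF Y2(1)] complex_vector.scale_right_diff_distrib)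
  have S_mem [simp]: "S x \<in> car K" if "x \<in> car K" for x using that by (simp add: S_def)
  have S_sym: "ip K (S x) y = ip K x (S y)" if "x \<in> car K" "y \<in> car K" for x y
    using that by (simp add: S_def ip_diff_left ip_diff_right Y2(3))
  have SS: "S (S x) = R x" if x: "x \<in> car K" for x
  proof -
    have "S (S x) = x - (Y2 x + Y2 x) + Y2 (Y2 x)"
      using x by (simp add: S_def linear_on_diff[OF Y2(1) subspace_car])
    then show ?thesis using Y2(4)[OF x] by (simp add: R_def)
  qed
  have RR: "R (R x) = G (G x)" if x: "x \<in> car K" for x
  proof -
    have "R (R x) = x - (Y1 x + Y1 x) + Y1 (Y1 x)"
      using x by (simp add: R_def linear_on_diff[OF Y1(1) subspace_car])
    then show ?thesis using Y1(4)[OF x] by (simp add: X_def)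
  qed
  have R: "linear_on (car K) (car K) R" unfolding linear_on_def
    by (auto simp: R_def linear_on_add[OF Y1(1)] linear_on_scale[OF Y1(1)] complex_vector.scale_right_diff_distrib)
  note [simp] = linear_on_mem[OF R]
  have R_sym: "ip K (R x) y = ip K x (R y)" if "x \<in> car K" "y \<in> car K" for x y
    using that by (simp add: R_def ip_diff_left ip_diff_right Y1(3))
  have GR: "G (R x) = R (G x)" if "x \<in> car K" for x
    using that by (simp add: R_def linear_on_diff[OF G subspace_car] GY1)
  have GS: "G (S x) = S (G x)" if "x \<in> car K" for x
    using that by (simp add: S_def linear_on_diff[OF G subspace_car] GY2)
  have RS: "R (S x) = S (R x)" if "x \<in> car K" for x
    using SS[of x] SS[of "S x"] that by simp
  \<comment> \<open>as \<open>R + G\<close> is selfadjoint, the complement of its range is its kernel\<close>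
  define N where "N = {x \<in> car K. \<forall>a\<in>(\<lambda>y. R y + G y) ` car K. ip K x a = 0}"
  define M where "M = {x \<in> car K. \<forall>n\<in>N. ip K x n = 0}"
  have N: "closed_linear K N" unfolding N_def by (rule closed_linear_orthogonal) auto
  have NK: "N \<subseteq> car K" by (auto simp: N_def)
  have M: "closed_linear K M" unfolding M_def using NK by (rule closed_linear_orthogonal)
  have MK: "M \<subseteq> car K" by (auto simp: M_def)
  have N_iff: "x \<in> N \<longleftrightarrow> R x + G x = 0" if x: "x \<in> car K" for x
  proof
    assume "x \<in> N"
    then have "ip K x (R (R x + G x) + G (R x + G x)) = 0" using x unfolding N_def by simp
    then have "ip K (R x + G x) (R x + G x) = 0"
      using x by (simp add: ip_add_left ip_add_right R_sym sym linear_on_add[OF R] linear_on_add[OF G] GR)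
    then show "R x + G x = 0" using ip_self_eq0[of "R x + G x"] x by simp
  next
    assume 0: "R x + G x = 0"
    have "ip K x (R y + G y) = 0" if y: "y \<in> car K" for y
    proof -
      have "ip K x (R y + G y) = ip K (R x + G x) y"
        using x y by (simp add: ip_add_left ip_add_right R_sym sym)
      then show ?thesis using 0 y by simp
    qed
    then show "x \<in> N" using x by (auto simp: N_def)
  qed
  have QN: "R y - G y \<in> N" if y: "y \<in> car K" for y
    using y by (subst N_iff) (simp_all add: linear_on_diff[OF R subspace_car] linear_on_diff[OF G subspace_car] RR GR)
  have M_eq: "R x = G x" if x: "x \<in> M" for x
  proof -
    have xK: "x \<in> car K" using x MK by blast
    have "ip K x (R (R x - G x) - G (R x - G x)) = 0"
      using x QN[of "R x - G x"] xK unfolding M_def by simp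
    then have "ip K (R x - G x) (R x - G x) = 0"
      using xK by (simp add: ip_diff_left ip_diff_right R_sym sym
          linear_on_diff[OF R subspace_car] linear_on_diff[OF G subspace_car] GR)
    then show ?thesis using ip_self_eq0[of "R x - G x"] xK by simp
  qed
  have MN: "ip K x y = 0" if "x \<in> M" "y \<in> N" for x y using that by (simp add: M_def)
  have SN: "S x \<in> N" if x: "x \<in> N" for x
  proof -
    have xK: "x \<in> car K" using x NK by blast
    have "R (S x) + G (S x) = S (R x + G x)"
      using xK by (simp add: RS GS linear_on_add[OF bounded_op_linear[OF S]])
    also have "\<dots> = 0" using x N_iff[OF xK] linear_on_zero[OF bounded_op_linear[OF S] subspace_car] by simp
    finally show ?thesis using N_iff[of "S x"] xK by simp
  qed
  have SM: "S x \<in> M" if x: "x \<in> M" for x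
  proof -
    have xK: "x \<in> car K" using x MK by blast
    have "ip K (S x) n = 0" if n: "n \<in> N" for n
      using S_sym[of x n] MN[OF x SN[OF n]] xK n NK by auto
    then show ?thesis using xK by (simp add: M_def)
  qed
  show ?thesis
  proof (rule that[OF S S_sym M N MN _ SM SN])
    fix x assume x: "x \<in> car K"
    obtain n where n: "n \<in> N" "\<And>y. y \<in> N \<Longrightarrow> ip K y (x - n) = 0"
      using orthogonal_projection[OF N x] by blast
    have nK: "n \<in> car K" using n NK by blast
    have "ip K (x - n) y = 0" if "y \<in> N" for y
      using n(2)[OF that] ip_cnj[of y "x - n"] that NK x nK by auto
    then have "x - n \<in> M" using x nK by (simp add: M_def)
    then show "\<exists>m\<in>M. \<exists>n\<in>N. x = m + n" using n(1) by (metis diff_add_cancel)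
  next
    fix x assume x: "x \<in> M"
    then have xK: "x \<in> car K" using MK by blast
    show "G x = S (S x)" using M_eq[OF x] SS[OF xK] by simp
    assume "S x = 0"
    then have "R x = 0" using SS[OF xK] linear_on_zero[OF bounded_op_linear[OF S] subspace_car] by simp
    then have "x \<in> N" using M_eq[OF x] N_iff[OF xK] by simp
    then show "x = 0" using MN[OF x] ip_self_eq0[OF xK] by blast
  next
    fix x assume x: "x \<in> N"
    then have xK: "x \<in> car K" using NK by blast
    show "G x = - S (S x)" using N_iff[OF xK] x SS[OF xK] by (simp add: eq_neg_iff_add_eq_0 add.commute)
  qed
qed

text \<open>The general case by scaling \<open>G\<close> to a contraction; \<open>S\<close> scales with the square root of the bound.\<close>

lemma spectral_splitting:
  assumes G: "bounded_op K K G"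
    and sym: "\<And>x y. x \<in> car K \<Longrightarrow> y \<in> car K \<Longrightarrow> ip K (G x) y = ip K x (G y)"
  obtains S M N where "bounded_op K K S" "\<And>x y. x \<in> car K \<Longrightarrow> y \<in> car K \<Longrightarrow> ip K (S x) y = ip K x (S y)"
    "closed_linear K M" "closed_linear K N" "\<And>x y. x \<in> M \<Longrightarrow> y \<in> N \<Longrightarrow> ip K x y = 0"
    "\<And>x. x \<in> car K \<Longrightarrow> \<exists>m\<in>M. \<exists>n\<in>N. x = m + n"
    "\<And>x. x \<in> M \<Longrightarrow> S x \<in> M" "\<And>x. x \<in> N \<Longrightarrow> S x \<in> N"
    "\<And>x. x \<in> M \<Longrightarrow> G x = S (S x)" "\<And>x. x \<in> N \<Longrightarrow> G x = - S (S x)"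
    "\<And>x. x \<in> M \<Longrightarrow> S x = 0 \<Longrightarrow> x = 0"
proof -
  note [simp] = linear_on_mem[OF bounded_op_linear[OF G]]
  obtain c where c: "0 < c" "\<And>x. x \<in> car K \<Longrightarrow> nrm K (G x) \<le> c * nrm K x"
    using bounded_op_boundE[OF G posdef_space_axioms] by blast
  define H where "H x = of_real (1 / c) *\<^sub>C G x" for x
  have H: "linear_on (car K) (car K) H" unfolding linear_on_def H_def
    by (auto simp: linear_on_add[OF bounded_op_linear[OF G]] linear_on_scale[OF bounded_op_linear[OF G]]
        complex_vector.scale_right_distrib mult.commute)
  have Hc: "nrm K (H x) \<le> nrm K x" if "x \<in> car K" for x
    using c(1) c(2)[OF that] that unfolding H_def by (simp add: norm_divide field_simps)
  have Hs: "ip K (H x) y = ip K x (H y)" if "x \<in> car K" "y \<in> car K" for x y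
    using that sym unfolding H_def by (simp add: ip_scale_left ip_scale_right)
  obtain S M N where S: "bounded_op K K S" "\<And>x y. x \<in> car K \<Longrightarrow> y \<in> car K \<Longrightarrow> ip K (S x) y = ip K x (S y)"
    and MN: "closed_linear K M" "closed_linear K N" "\<And>x y. x \<in> M \<Longrightarrow> y \<in> N \<Longrightarrow> ip K x y = 0"
    "\<And>x. x \<in> car K \<Longrightarrow> \<exists>m\<in>M. \<exists>n\<in>N. x = m + n"
    and SMN: "\<And>x. x \<in> M \<Longrightarrow> S x \<in> M" "\<And>x. x \<in> N \<Longrightarrow> S x \<in> N"
    and HS: "\<And>x. x \<in> M \<Longrightarrow> H x = S (S x)" "\<And>x. x \<in> N \<Longrightarrow> H x = - S (S x)"
    and ker: "\<And>x. x \<in> M \<Longrightarrow> S x = 0 \<Longrightarrow> x = 0"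
    using spectral_contraction[OF H Hc Hs] by blast
  note Sl = bounded_op_linear[OF S(1)]
  define r where "r = complex_of_real (sqrt c)"
  have rr: "r * r = of_real c" and r: "r \<noteq> 0" and rc: "cnj r = r"
    using c by (simp_all add: r_def of_real_mult[symmetric] del: of_real_mult)
  have GH: "G x = (r * r) *\<^sub>C H x" for x using c by (simp add: H_def rr)
  have memK: "x \<in> car K" if "x \<in> M \<or> x \<in> N" for x using that closed_linearD(2) MN(1,2) by blast
  have rSS: "r *\<^sub>C S (r *\<^sub>C S x) = (r * r) *\<^sub>C S (S x)" if "x \<in> car K" for x
    using that by (simp add: linear_on_scale[OF Sl] linear_on_mem[OF Sl])
  show ?thesis
  proof (rule that[of "\<lambda>x. r *\<^sub>C S x" M N])
    show "bounded_op K K (\<lambda>x. r *\<^sub>C S x)"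
    proof -
      obtain d where d: "0 < d" "\<And>x. x \<in> car K \<Longrightarrow> nrm K (S x) \<le> d * nrm K x"
        using bounded_op_boundE[OF S(1) posdef_space_axioms] by blast
      show ?thesis
      proof (rule bounded_opI)
        fix x assume "x \<in> car K"
        then show "nrm K (r *\<^sub>C S x) \<le> (cmod r * d) * nrm K x"
          using mult_left_mono[OF d(2), of x "cmod r"] by (simp add: linear_on_mem[OF Sl] mult.assoc)
      qed (simp_all add: linear_on_mem[OF Sl] linear_on_add[OF Sl] linear_on_scale[OF Sl]
          complex_vector.scale_right_distrib mult.commute)
    qed
    show "ip K (r *\<^sub>C S x) y = ip K x (r *\<^sub>C S y)" if "x \<in> car K" "y \<in> car K" for x y
      using that S(2) by (simp add: ip_scale_left ip_scale_right linear_on_mem[OF Sl] rc)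
    show "r *\<^sub>C S x \<in> M" if "x \<in> M" for x
      using complex_vector.subspace_scale[OF closed_linearD(1)[OF MN(1)]] SMN that by blast
    show "r *\<^sub>C S x \<in> N" if "x \<in> N" for x
      using complex_vector.subspace_scale[OF closed_linearD(1)[OF MN(2)]] SMN that by blast
    show "G x = r *\<^sub>C S (r *\<^sub>C S x)" if "x \<in> M" for x
      using that memK[of x] by (simp add: GH HS rSS)
    show "G x = - (r *\<^sub>C S (r *\<^sub>C S x))" if "x \<in> N" for x
      using that memK[of x] by (simp add: GH HS rSS)
    show "x = 0" if "x \<in> M" "r *\<^sub>C S x = 0" for x using that ker r by simp
  qed (use MN in auto)
qed

end

section \<open>Definite subspaces of a difference of two squares\<close>

text \<open>An injective bounded operator into \<open>U\<close> cannot lower the dimension: its coordinates with respect to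
a basis of \<open>U\<close> are bounded functionals that separate points.\<close>

lemma basis_le_of_injective:
  assumes L: "posdef_space L" and U: "posdef_space U" and u: "bounded_op L U u"
    and inj: "\<And>x. x \<in> car L \<Longrightarrow> u x = 0 \<Longrightarrow> x = 0"
    and B: "orthonormal_basis L B" and B': "orthonormal_basis U B'"
  shows "|B| \<le>o |B'|"
proof -
  interpret L: posdef_space L by (rule L)
  interpret U: posdef_space U by (rule U)
  note [simp] = linear_on_mem[OF bounded_op_linear[OF u]]
  obtain c where c: "0 < c" "\<And>x. x \<in> car L \<Longrightarrow> nrm U (u x) \<le> c * nrm L x"
    using bounded_op_boundE[OF u L] by blast
  have BU: "b \<in> car U" if "b \<in> B'" for b using B' that by (auto simp: orthonormal_basis_def)
  show ?thesis
  proof (rule L.card_orthonormal_le_functionals[where phi = "\<lambda>b x. ip U (u x) b"])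
    show "B \<subseteq> car L" "\<forall>x\<in>B. \<forall>y\<in>B. ip L x y = (if x = y then 1 else 0)"
      using B by (auto simp: orthonormal_basis_def)
  next
    fix b assume b: "b \<in> B'"
    have "cmod (ip U (u x) b) \<le> (c * nrm U b) * nrm L x" if x: "x \<in> car L" for x
    proof -
      have "cmod (ip U (u x) b) \<le> nrm U (u x) * nrm U b" using x BU[OF b] by (intro U.cauchy_schwarz) auto
      also have "\<dots> \<le> (c * nrm L x) * nrm U b" using c x BU[OF b] by (intro mult_right_mono) auto
      finally show ?thesis by (simp add: mult_ac)
    qed
    then show "bounded_functional L (\<lambda>x. ip U (u x) b)"
      unfolding bounded_functional_def using BU[OF b]
      by (auto simp: linear_on_add[OF bounded_op_linear[OF u]] linear_on_scale[OF bounded_op_linear[OF u]] U.ip_add_left U.ip_scale_left)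
  next
    fix x assume x: "x \<in> car L" and 0: "\<forall>b\<in>B'. ip U (u x) b = 0"
    have "ip U (u x) (u x) = 0"
      using U.basis_total[OF U.subspace_car order_refl, of B' "u x" "u x"] x 0 B' by simp
    then show "x = 0" using inj[OF x] U.ip_self_eq0[of "u x"] x by simp
  qed
qed

text \<open>The form \<open>\<bar>u f\<bar>\<^sup>2 - \<bar>w f\<bar>\<^sup>2\<close> is given by \<open>G = e u - d w\<close>, where \<open>e\<close> and \<open>d\<close> are the adjoints of \<open>u\<close>
and \<open>w\<close>, and \<open>M\<close> is the positive part of the spectral splitting of \<open>G\<close>. To see that \<open>M\<close> is as
large as \<open>U\<close>, one needs an injective bounded operator from \<open>U\<close> to \<open>M\<close>. The obvious candidate, \<open>e\<close>
followed by the projection \<open>P\<close> onto \<open>M\<close>, may fail to be injective and has to be corrected. On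
\<open>N\<close> the form is not positive, so \<open>u\<close> is there a contractive function of \<open>w\<close>; the adjoint \<open>Q\<close>
of this contraction, defined on all of \<open>U\<close>, makes \<open>T = e - d Q\<close> have range orthogonal to \<open>N\<close>.
Therefore \<open>T x\<close> is determined by its projection onto \<open>M\<close>, and \<open>T x = 0\<close> forces \<open>x = 0\<close> by the
independence of the ranges of \<open>e\<close> and \<open>d\<close>.\<close>

lemma definite_subspace_exists:
  fixes K :: "'a::complex_vector inner_space" and U :: "'b::complex_vector inner_space"
    and W :: "'c::complex_vector inner_space"
  assumes K: "hilbert K" and U: "hilbert U" and W: "hilbert W"
    and u: "bounded_op K U u" and w: "bounded_op K W w" and e: "bounded_op U K e" and d: "bounded_op W K d"
    and ue: "\<And>x f. x \<in> car U \<Longrightarrow> f \<in> car K \<Longrightarrow> ip K (e x) f = ip U x (u f)"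
    and wd: "\<And>y f. y \<in> car W \<Longrightarrow> f \<in> car K \<Longrightarrow> ip K (d y) f = ip W y (w f)"
    and inj: "\<And>x y. x \<in> car U \<Longrightarrow> y \<in> car W \<Longrightarrow> e x = d y \<Longrightarrow> x = 0"
  obtains M where "closed_linear K M" "\<And>f. f \<in> M \<Longrightarrow> f \<noteq> 0 \<Longrightarrow> nrm W (w f) < nrm U (u f)"
    "\<And>B B'. orthonormal_basis U B \<Longrightarrow> orthonormal_basis (K\<lparr>car := M\<rparr>) B' \<Longrightarrow> |B| \<le>o |B'|"
proof -
  interpret K: hilbert K by (rule K)
  interpret U: hilbert U by (rule U)
  interpret W: hilbert W by (rule W)
  note [simp] = linear_on_mem[OF bounded_op_linear[OF u]] linear_on_mem[OF bounded_op_linear[OF w]] linear_on_mem[OF bounded_op_linear[OF e]]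
    linear_on_mem[OF bounded_op_linear[OF d]]
  have ue': "ip K f (e x) = ip U (u f) x" if "x \<in> car U" "f \<in> car K" for x f
    using ue[OF that] K.ip_cnj[of "e x" f] U.ip_cnj[of x "u f"] that by simp
  have wd': "ip K f (d y) = ip W (w f) y" if "y \<in> car W" "f \<in> car K" for y f
    using wd[OF that] K.ip_cnj[of "d y" f] W.ip_cnj[of y "w f"] that by simp
  define G where "G f = e (u f) - d (w f)" for f
  have G: "bounded_op K K G" unfolding G_def
    by (intro bounded_op_diff bounded_op_compose[OF _ _ u e] bounded_op_compose[OF _ _ w d]
        K.posdef_space_axioms U.posdef_space_axioms W.posdef_space_axioms)
  have Gip: "ip K (G f) g = ip U (u f) (u g) - ip W (w f) (w g)" if "f \<in> car K" "g \<in> car K" for f g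
    using that by (simp add: G_def K.ip_diff_left ue wd)
  have Gip': "ip K f (G g) = ip U (u f) (u g) - ip W (w f) (w g)" if "f \<in> car K" "g \<in> car K" for f g
    using that by (simp add: G_def K.ip_diff_right ue' wd')
  have Gself: "Re (ip K (G f) f) = (nrm U (u f))\<^sup>2 - (nrm W (w f))\<^sup>2" if "f \<in> car K" for f
    using that by (simp add: Gip U.nrm_sq W.nrm_sq)
  have Gsym: "ip K (G f) g = ip K f (G g)" if "f \<in> car K" "g \<in> car K" for f g
    using that by (simp add: Gip Gip')
  obtain S M N where S: "bounded_op K K S" "\<And>x y. x \<in> car K \<Longrightarrow> y \<in> car K \<Longrightarrow> ip K (S x) y = ip K x (S y)"
    and M: "closed_linear K M" and N: "closed_linear K N" and orth: "\<And>x y. x \<in> M \<Longrightarrow> y \<in> N \<Longrightarrow> ip K x y = 0"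
    and split: "\<And>x. x \<in> car K \<Longrightarrow> \<exists>m\<in>M. \<exists>n\<in>N. x = m + n"
    and GM: "\<And>x. x \<in> M \<Longrightarrow> G x = S (S x)" and GN: "\<And>x. x \<in> N \<Longrightarrow> G x = - S (S x)"
    and ker: "\<And>x. x \<in> M \<Longrightarrow> S x = 0 \<Longrightarrow> x = 0"
    by (rule K.spectral_splitting[OF G]) ((rule Gsym that; assumption)+)
  note [simp] = linear_on_mem[OF bounded_op_linear[OF S(1)]]
  have MK [simp]: "x \<in> car K" if "x \<in> M" for x using closed_linearD(2)[OF M] that by blast
  have NK [simp]: "x \<in> car K" if "x \<in> N" for x using closed_linearD(2)[OF N] that by blast
  have pos: "nrm W (w f) < nrm U (u f)" if f: "f \<in> M" "f \<noteq> 0" for f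
  proof -
    have "Re (ip K (G f) f) = (nrm K (S f))\<^sup>2"
      using f GM[OF f(1)] S(2)[of "S f" f] by (simp add: K.nrm_sq)
    moreover have "0 < nrm K (S f)" using ker[of f] f by (intro K.nrm_pos) auto
    ultimately have "(nrm W (w f))\<^sup>2 < (nrm U (u f))\<^sup>2"
      using Gself[of f] MK[OF f(1)] zero_less_power[of "nrm K (S f)" 2] by linarith
    then show ?thesis using f by (intro power2_less_imp_less[of "nrm W (w f)"]) auto
  qed
  have neg: "nrm U (u f) \<le> nrm W (w f)" if f: "f \<in> N" for f
  proof -
    have "Re (ip K (G f) f) = - (nrm K (S f))\<^sup>2"
      using f GN[OF f(1)] S(2)[of "S f" f] by (simp add: K.nrm_sq K.ip_minus_left)
    then have "(nrm U (u f))\<^sup>2 \<le> (nrm W (w f))\<^sup>2"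
      using Gself[of f] NK[OF f] zero_le_power2[of "nrm K (S f)"] by linarith
    then show ?thesis using f by (intro power2_le_imp_le[of "nrm U (u f)"]) auto
  qed
  obtain Q where Q: "bounded_op U W Q" and Qeq: "\<And>n x. n \<in> N \<Longrightarrow> x \<in> car U \<Longrightarrow> ip U (u n) x = ip W (w n) (Q x)"
  proof (rule W.riesz_operator[OF U.posdef_space_axioms closed_linearD(1)[OF N], of w "\<lambda>n x. ip U (u n) x" 1])
    show "linear_on N (car W) w" using bounded_op_linear[OF w] unfolding linear_on_def by auto
    fix n x assume n: "n \<in> N" and x: "x \<in> car U"
    have "cmod (ip U (u n) x) \<le> nrm U (u n) * nrm U x" using n x by (intro U.cauchy_schwarz) auto
    also have "\<dots> \<le> nrm W (w n) * nrm U x" using neg[OF n] x by (intro mult_right_mono) auto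
    finally show "cmod (ip U (u n) x) \<le> 1 * nrm U x * nrm W (w n)" by (simp add: mult.commute)
  qed (auto simp: linear_on_add[OF bounded_op_linear[OF u]] linear_on_scale[OF bounded_op_linear[OF u]] U.ip_simps)
  note [simp] = linear_on_mem[OF bounded_op_linear[OF Q]]
  interpret M: hilbert "K\<lparr>car := M\<rparr>" by (rule K.restrict_hilbert[OF M])
  have "bounded_op (K\<lparr>car := M\<rparr>) K (\<lambda>x. x)" by (rule bounded_opI[where c = 1]) auto
  then obtain P where P: "bounded_op K (K\<lparr>car := M\<rparr>) P"
    and Peq: "\<And>x y. x \<in> M \<Longrightarrow> y \<in> car K \<Longrightarrow> ip K x y = ip K x (P y)"
    using adjoint_exists[OF M.hilbert_axioms K.posdef_space_axioms, of "\<lambda>x. x"] by auto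
  define T where "T x = e x - d (Q x)" for x
  have T: "bounded_op U K T" unfolding T_def
    by (intro bounded_op_diff bounded_op_compose[OF _ _ Q d] e
        K.posdef_space_axioms U.posdef_space_axioms W.posdef_space_axioms)
  note [simp] = linear_on_mem[OF bounded_op_linear[OF T]]
  have TN: "ip K n (T x) = 0" if "n \<in> N" "x \<in> car U" for n x
    using that Qeq[OF that] by (simp add: T_def K.ip_diff_right ue' wd')
  have PT_inj: "x = 0" if x: "x \<in> car U" and 0: "P (T x) = 0" for x
  proof -
    have TM: "ip K m (T x) = 0" if "m \<in> M" for m using Peq[OF that, of "T x"] x 0 that by simp
    obtain m n where mn: "m \<in> M" "n \<in> N" "T x = m + n" using split[of "T x"] x by auto
    have "ip K (m + n) (T x) = 0" using mn(1,2) TM TN x by (simp add: K.ip_add_left)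
    then have "T x = 0" using K.ip_self_eq0[of "T x"] x mn by simp
    then show ?thesis using inj[OF x, of "Q x"] x by (simp add: T_def)
  qed
  have PT: "bounded_op U (K\<lparr>car := M\<rparr>) (\<lambda>x. P (T x))"
    by (rule bounded_op_compose[OF U.posdef_space_axioms K.posdef_space_axioms T P])
  show ?thesis
  proof (rule that[OF M pos])
    show "|B| \<le>o |B'|" if "orthonormal_basis U B" "orthonormal_basis (K\<lparr>car := M\<rparr>) B'" for B B'
      by (rule basis_le_of_injective[OF U.posdef_space_axioms M.posdef_space_axioms PT PT_inj that])
  qed
qed

section \<open>Krein spaces\<close>

lemma continuous_map_linear_iff:
  assumes K: "posdef_space K" and L: "posdef_space L" and T: "linear_on (car K) (car L) T"
  shows "continuous_map (inner_topology K) (inner_topology L) T \<longleftrightarrow> bounded_op K L T"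
proof -
  interpret K: posdef_space K by (rule K)
  interpret L: posdef_space L by (rule L)
  note [simp] = linear_on_mem[OF T]
  have cont: "continuous_map (inner_topology K) (inner_topology L) T \<longleftrightarrow>
      (\<forall>a\<in>car K. \<forall>e>0. \<exists>r>0. \<forall>x. x \<in> car K \<and> nrm K (a - x) < r \<longrightarrow> nrm L (T (a - x)) < e)"
    unfolding inner_topology_def
      Metric_space.metric_continuous_map[OF K.Metric_space_inner_dist L.Metric_space_inner_dist]
    by (auto simp: K.inner_dist_nrm L.inner_dist_nrm linear_on_diff[OF T K.subspace_car] cong: conj_cong)
  show ?thesis
  proof
    assume "bounded_op K L T"
    then obtain c where c: "0 < c" "\<And>x. x \<in> car K \<Longrightarrow> nrm L (T x) \<le> c * nrm K x"
      using bounded_op_boundE[OF _ K] by blast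
    have "nrm L (T (a - x)) < e" if "a \<in> car K" "x \<in> car K" "nrm K (a - x) < e / c" for a x e
      using c(2)[of "a - x"] c(1) that by (simp add: pos_less_divide_eq mult.commute)
    then show "continuous_map (inner_topology K) (inner_topology L) T"
      unfolding cont using c(1) by (metis divide_pos_pos)
  next
    assume "continuous_map (inner_topology K) (inner_topology L) T"
    then obtain r where r: "r > 0" "\<And>x. x \<in> car K \<Longrightarrow> nrm K (0 - x) < r \<Longrightarrow> nrm L (T (0 - x)) < 1"
      unfolding cont using K.zero_mem zero_less_one by blast
    have r': "nrm L (T x) < 1" if "x \<in> car K" "nrm K x < r" for x
      using r(2)[of "- x"] that by simp
    have "nrm L (T x) \<le> (2 / r) * nrm K x" if x: "x \<in> car K" for x
    proof (cases "x = 0")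
      case True
      then show ?thesis using linear_on_zero[OF T K.subspace_car] by simp
    next
      case False
      define t where "t = r / (2 * nrm K x)"
      have pos: "0 < nrm K x" using x False by (rule K.nrm_pos)
      have t: "0 < t" using pos r(1) by (simp add: t_def)
      have "nrm K (of_real t *\<^sub>C x) < r" using x pos r(1) by (simp add: t_def norm_divide norm_mult)
      then have "nrm L (T (of_real t *\<^sub>C x)) < 1" using x by (intro r') auto
      then have "t * nrm L (T x) < 1" using x t by (simp add: linear_on_scale[OF T])
      then have "nrm L (T x) < 1 / t" using t by (simp add: field_simps)
      then show ?thesis using pos r(1) by (simp add: t_def)
    qed
    then show "bounded_op K L T" using T unfolding bounded_op_def by blast
  qed
qed

text \<open>The chosen fundamental decomposition \<open>P \<oplus> N\<close> turns questions about \<open>H\<close> into questions about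
the associated Hilbert space \<open>K\<close> and the fundamental symmetry \<open>J\<close>, which converts one inner product
into the other. \<open>HP\<close> and \<open>HN\<close> are the two halves as Hilbert spaces.\<close>

locale krein =
  fixes H :: "'a::complex_vector inner_space"
  assumes krein_space: "krein_space H"
begin

sublocale ip_space H
  using krein_space by unfold_locales (simp add: krein_space_def)

abbreviation "P \<equiv> fst (fund_dec H)"
abbreviation "N \<equiv> snd (fund_dec H)"
abbreviation "p \<equiv> pos_part H"
definition "q x = x - p x"
definition "J x = p x - q x"
abbreviation "HP \<equiv> H\<lparr>car := P\<rparr>"
abbreviation "HN \<equiv> antispace (H\<lparr>car := N\<rparr>)"
abbreviation "K \<equiv> assoc_hilbert H"

lemma fund_dec: "fundamental_decomposition H (fund_dec H)"
proof -
  have "\<exists>D. fundamental_decomposition H D" using krein_space by (simp add: krein_space_def)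
  then show ?thesis unfolding fund_dec_def by (rule someI_ex)
qed

lemma decomposition:
  shows "hilbert HP" "hilbert HN" "\<forall>x\<in>P. \<forall>y\<in>N. ip H x y = 0" "P \<inter> N = {0}"
    "car H = {x + y | x y. x \<in> P \<and> y \<in> N}"
  using fund_dec by (simp_all add: fundamental_decomposition_def split_beta hilbert_iff)

lemma car_HP [simp]: "car HP = P" and car_HN [simp]: "car HN = N" and car_K [simp]: "car K = car H"
  and ip_HP [simp]: "ip HP = ip H" and ip_HN [simp]: "ip HN = (\<lambda>x y. - ip H x y)"
  by (simp_all add: antispace_def assoc_hilbert_def)

sublocale HP: hilbert HP by (rule decomposition)

sublocale HN: hilbert HN by (rule decomposition)

lemma P_subspace: "complex_vector.subspace P" and N_subspace: "complex_vector.subspace N"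
  using HP.subspace_car HN.subspace_car by simp_all

lemma P_mem [simp]: "x \<in> P \<Longrightarrow> y \<in> P \<Longrightarrow> x + y \<in> P" "x \<in> P \<Longrightarrow> y \<in> P \<Longrightarrow> x - y \<in> P" "0 \<in> P"
    "x \<in> P \<Longrightarrow> a *\<^sub>C x \<in> P"
  using P_subspace by (auto intro: complex_vector.subspace_add complex_vector.subspace_diff
      complex_vector.subspace_0 complex_vector.subspace_scale)

lemma N_mem [simp]: "x \<in> N \<Longrightarrow> y \<in> N \<Longrightarrow> x + y \<in> N" "x \<in> N \<Longrightarrow> y \<in> N \<Longrightarrow> x - y \<in> N" "0 \<in> N"
    "x \<in> N \<Longrightarrow> a *\<^sub>C x \<in> N" "x \<in> N \<Longrightarrow> - x \<in> N"
  using N_subspace by (auto intro: complex_vector.subspace_add complex_vector.subspace_diff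
      complex_vector.subspace_0 complex_vector.subspace_scale complex_vector.subspace_neg)

lemma car_eq: "car H = {x + y | x y. x \<in> P \<and> y \<in> N}" and PN: "P \<inter> N = {0}"
  and ip_PN [simp]: "x \<in> P \<Longrightarrow> y \<in> N \<Longrightarrow> ip H x y = 0"
  using decomposition(3-5) by blast+

lemma P_car [simp]: "x \<in> P \<Longrightarrow> x \<in> car H" and N_car [simp]: "x \<in> N \<Longrightarrow> x \<in> car H"
  unfolding car_eq using P_mem(3) N_mem(3) by force+

lemma ip_NP [simp]: "x \<in> N \<Longrightarrow> y \<in> P \<Longrightarrow> ip H x y = 0"
  using ip_cnj[of y x] by simp

lemma pos_part_add: assumes "a \<in> P" "b \<in> N" shows "p (a + b) = a"
  unfolding pos_part_def
proof (rule the_equality)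
  fix c assume c: "c \<in> P \<and> a + b - c \<in> N"
  have "(a + b - c) - b \<in> N" using c assms by (blast intro: N_mem(2))
  then have "a - c \<in> P \<inter> N" using c assms by simp
  then show "c = a" using PN by simp
qed (use assms in simp)

lemma p_mem [simp]: "x \<in> car H \<Longrightarrow> p x \<in> P" and q_mem [simp]: "x \<in> car H \<Longrightarrow> q x \<in> N"
  unfolding car_eq by (auto simp: pos_part_add q_def)

lemma pq: "p x + q x = x" by (simp add: q_def)

lemma p_of_P [simp]: "x \<in> P \<Longrightarrow> p x = x" and q_of_P [simp]: "x \<in> P \<Longrightarrow> q x = 0"
  using pos_part_add[of x 0] by (simp_all add: q_def)

lemma p_of_N [simp]: "x \<in> N \<Longrightarrow> p x = 0" and q_of_N [simp]: "x \<in> N \<Longrightarrow> q x = x"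
  using pos_part_add[of 0 x] by (simp_all add: q_def)

lemma p_add [simp]: assumes "x \<in> car H" "y \<in> car H" shows "p (x + y) = p x + p y"
proof -
  have "(p x + p y) + (q x + q y) = (p x + q x) + (p y + q y)" by (simp only: ac_simps)
  then have "x + y = (p x + p y) + (q x + q y)" by (simp only: pq)
  then show ?thesis using pos_part_add[of "p x + p y" "q x + q y"] assms by simp
qed

lemma p_scale [simp]: assumes "x \<in> car H" shows "p (a *\<^sub>C x) = a *\<^sub>C p x"
proof -
  have "a *\<^sub>C x = a *\<^sub>C p x + a *\<^sub>C q x" by (simp only: complex_vector.scale_right_distrib[symmetric] pq)
  then show ?thesis using pos_part_add[of "a *\<^sub>C p x" "a *\<^sub>C q x"] assms by simp
qed

lemma linear_on_p: "linear_on (car H) P p" unfolding linear_on_def by simp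

lemma linear_on_q: "linear_on (car H) N q" unfolding linear_on_def
  using q_mem by (auto simp: q_def complex_vector.scale_right_diff_distrib)

lemma linear_on_J: "linear_on (car H) (car H) J" unfolding linear_on_def J_def
  by (auto simp: linear_on_add[OF linear_on_q] linear_on_scale[OF linear_on_q] complex_vector.scale_right_diff_distrib)

lemma J_mem [simp]: "x \<in> car H \<Longrightarrow> J x \<in> car H" using linear_on_mem[OF linear_on_J] .

lemma p_J [simp]: assumes "x \<in> car H" shows "p (J x) = p x"
proof -
  have "p (p x - q x) = p (p x) - p (q x)"
    using assms by (intro linear_on_diff[OF linear_on_p subspace_car] P_car N_car) auto
  then show ?thesis unfolding J_def using p_mem[OF assms] q_mem[OF assms] by simp
qed

lemma q_J [simp]: "x \<in> car H \<Longrightarrow> q (J x) = - q x"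
  by (simp add: q_def[of "J x"]) (simp add: J_def)

lemma J_J [simp]: "x \<in> car H \<Longrightarrow> J (J x) = x"
  using pq[of x] by (simp add: J_def[of "J x"])

lemma ip_K: "ip K x y = ip H (p x) (p y) - ip H (q x) (q y)"
  by (simp add: assoc_hilbert_def q_def)

lemma ip_H_parts: assumes "x \<in> car H" "y \<in> car H"
  shows "ip H x y = ip H (p x) (p y) + ip H (q x) (q y)"
proof -
  have "ip H (p x + q x) (p y + q y) = ip H (p x) (p y) + ip H (q x) (q y)"
    using assms by (simp add: ip_add_left ip_add_right)
  then show ?thesis by (simp add: pq)
qed

lemma ip_J_left: "x \<in> car H \<Longrightarrow> y \<in> car H \<Longrightarrow> ip K (J x) y = ip H x y"
  by (simp add: ip_K ip_H_parts[of x y] ip_minus_left)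

lemma ip_J_right: "x \<in> car H \<Longrightarrow> y \<in> car H \<Longrightarrow> ip K x (J y) = ip H x y"
  by (simp add: ip_K ip_H_parts[of x y] ip_minus_right)

lemma ip_H_J: "x \<in> car H \<Longrightarrow> y \<in> car H \<Longrightarrow> ip H (J x) y = ip K x y"
  using ip_J_left[of "J x" y] by simp

lemma ip_H_J_right: "x \<in> car H \<Longrightarrow> y \<in> car H \<Longrightarrow> ip H x (J y) = ip K x y"
  using ip_J_right[of x "J y"] by simp

lemma ip_K_P: "x \<in> P \<Longrightarrow> y \<in> P \<Longrightarrow> ip K x y = ip H x y"
  and ip_K_N: "x \<in> N \<Longrightarrow> y \<in> N \<Longrightarrow> ip K x y = - ip H x y"
  by (simp_all add: ip_K)

lemma nrm_HP: "x \<in> P \<Longrightarrow> nrm HP x = nrm K x" and nrm_HN: "x \<in> N \<Longrightarrow> nrm HN x = nrm K x"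
  by (simp_all add: nrm_def ip_K_P ip_K_N)

lemma K_ip_space: "inner_product_space K"
  unfolding inner_product_space_def
proof (intro conjI ballI allI)
  fix x y assume "x \<in> car K" "y \<in> car K"
  then show "ip K y x = cnj (ip K x y)"
    using ip_cnj[of "p x" "p y"] ip_cnj[of "q x" "q y"] by (simp add: ip_K)
qed (simp_all add: subspace_car ip_K ip_add_left ip_scale_left linear_on_add[OF linear_on_q] linear_on_scale[OF linear_on_q]
    algebra_simps)

lemma Re_ip_K_self: "Re (ip K x x) = Re (ip HP (p x) (p x)) + Re (ip HN (q x) (q x))"
  by (simp add: ip_K)

lemma K_posdef: "posdef_space K"
proof
  fix x assume x: "x \<in> car K" and ne: "x \<noteq> 0"
  have "p x \<noteq> 0 \<or> q x \<noteq> 0" using ne pq[of x] by auto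
  then show "0 < Re (ip K x x)"
    using HP.Re_ip_ge0[of "p x"] HN.Re_ip_ge0[of "q x"] HP.posdef[of "p x"] HN.posdef[of "q x"] x
    unfolding Re_ip_K_self car_HP car_HN by (fastforce simp del: ip_HP ip_HN)
qed (rule K_ip_space)

lemma nrm_K_sq: assumes "x \<in> car H" shows "(nrm K x)\<^sup>2 = (nrm HP (p x))\<^sup>2 + (nrm HN (q x))\<^sup>2"
  using posdef_space.nrm_sq[OF K_posdef, of x] HP.nrm_sq[of "p x"] HN.nrm_sq[of "q x"]
    Re_ip_K_self[of x] assms by simp

lemma nrm_p_le: "x \<in> car H \<Longrightarrow> nrm HP (p x) \<le> nrm K x"
  and nrm_q_le: "x \<in> car H \<Longrightarrow> nrm HN (q x) \<le> nrm K x"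
  using nrm_K_sq[of x] posdef_space.nrm_ge0[OF K_posdef, of x]
  by (auto intro!: power2_le_imp_le[of _ "nrm K x"])

lemma nrm_K_le: assumes "x \<in> car H" shows "nrm K x \<le> nrm HP (p x) + nrm HN (q x)"
proof (rule power2_le_imp_le)
  show "(nrm K x)\<^sup>2 \<le> (nrm HP (p x) + nrm HN (q x))\<^sup>2"
    using assms HP.nrm_ge0[of "p x"] HN.nrm_ge0[of "q x"] by (simp add: nrm_K_sq power2_sum)
qed (use assms HP.nrm_ge0[of "p x"] HN.nrm_ge0[of "q x"] in simp)

lemma bounded_op_p: "bounded_op K HP p" and bounded_op_q: "bounded_op K HN q"
  using linear_on_p linear_on_q nrm_p_le nrm_q_le unfolding bounded_op_def by (auto intro!: exI[of _ 1])

lemma K_hilbert: "hilbert K"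
proof -
  interpret K: posdef_space K by (rule K_posdef)
  have "\<exists>l\<in>car K. tends K s l" if s: "range s \<subseteq> car K" and c: "cauchy K s" for s
  proof -
    have s' [simp]: "s n \<in> car H" for n using s by auto
    have "cauchy HP (\<lambda>n. p (s n))"
      unfolding cauchy_def
    proof (intro allI impI)
      fix e :: real assume "e > 0"
      then obtain M where M: "\<forall>m\<ge>M. \<forall>n\<ge>M. nrm K (s m - s n) < e" using c unfolding cauchy_def by blast
      have "nrm HP (p (s m) - p (s n)) \<le> nrm K (s m - s n)" for m n
        using nrm_p_le[of "s m - s n"] by (simp add: linear_on_diff[OF linear_on_p subspace_car])
      then show "\<exists>N. \<forall>m\<ge>N. \<forall>n\<ge>N. nrm HP (p (s m) - p (s n)) < e"
        using M by (meson le_less_trans)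
    qed
    then obtain a where a: "a \<in> P" "tends HP (\<lambda>n. p (s n)) a"
      using HP.complete[of "\<lambda>n. p (s n)"] by (auto simp: image_subset_iff)
    have "cauchy HN (\<lambda>n. q (s n))"
      unfolding cauchy_def
    proof (intro allI impI)
      fix e :: real assume "e > 0"
      then obtain M where M: "\<forall>m\<ge>M. \<forall>n\<ge>M. nrm K (s m - s n) < e" using c unfolding cauchy_def by blast
      have "nrm HN (q (s m) - q (s n)) \<le> nrm K (s m - s n)" for m n
        using nrm_q_le[of "s m - s n"] by (simp add: linear_on_diff[OF linear_on_q subspace_car])
      then show "\<exists>N. \<forall>m\<ge>N. \<forall>n\<ge>N. nrm HN (q (s m) - q (s n)) < e"
        using M by (meson le_less_trans)
    qed
    then obtain b where b: "b \<in> N" "tends HN (\<lambda>n. q (s n)) b"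
      using HN.complete[of "\<lambda>n. q (s n)"] by (auto simp: image_subset_iff)
    have "tends K s (a + b)" unfolding tends_def
    proof (rule Lim_null_comparison)
      have "nrm K (s n - (a + b)) \<le> nrm HP (p (s n) - a) + nrm HN (q (s n) - b)" for n
        using nrm_K_le[of "s n - (a + b)"] a b
        by (simp add: linear_on_diff[OF linear_on_p subspace_car] linear_on_diff[OF linear_on_q subspace_car] pos_part_add
            linear_on_add[OF linear_on_q])
      then show "\<forall>\<^sub>F n in sequentially. norm (nrm K (s n - (a + b)))
          \<le> nrm HP (p (s n) - a) + nrm HN (q (s n) - b)"
        using a b K.nrm_ge0[of "s _ - (a + b)"] by simp
      show "(\<lambda>n. nrm HP (p (s n) - a) + nrm HN (q (s n) - b)) \<longlonglongrightarrow> 0"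
        using tendsto_add[OF a(2)[unfolded tends_def] b(2)[unfolded tends_def]] by simp
    qed
    moreover have "a + b \<in> car K" using a b by simp
    ultimately show ?thesis by blast
  qed
  then show ?thesis using K_posdef by (simp add: hilbert_def hilbert_axioms_def)
qed

sublocale K: hilbert K by (rule K_hilbert)

lemma nrm_J [simp]: "x \<in> car H \<Longrightarrow> nrm K (J x) = nrm K x"
  by (simp add: nrm_def ip_J_left ip_H_J_right)

lemma bounded_op_J: "bounded_op K K J"
  using linear_on_J by (auto simp: bounded_op_def intro!: exI[of _ 1])

lemma nondegenerate:
  assumes "x \<in> car H" "\<And>f. f \<in> car H \<Longrightarrow> ip H f x = 0" shows "x = 0"
  using assms(2)[of "J x"] assms(1) K.ip_self_eq0[of x] by (simp add: ip_H_J)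

lemma closed_subspace_iff: "closed_subspace H M \<longleftrightarrow> closed_linear K M"
proof -
  interpret Metric_space "car K" "inner_dist K" by (rule K.Metric_space_inner_dist)
  have top: "strong_topology H = mtopology" by (simp add: strong_topology_def inner_topology_def)
  have "(\<forall>s l. range s \<subseteq> M \<and> limitin mtopology s l sequentially \<longrightarrow> l \<in> M) \<longleftrightarrow>
        (\<forall>s l. (\<forall>n. s n \<in> M) \<and> l \<in> car K \<and> tends K s l \<longrightarrow> l \<in> M)" if M: "M \<subseteq> car K"
  proof -
    have "limitin mtopology s l sequentially \<longleftrightarrow> l \<in> car K \<and> tends K s l" if "range s \<subseteq> M" for s l
      using K.tends_iff_limitin[of s l] that M unfolding inner_topology_def by blast
    moreover have "range s \<subseteq> M \<longleftrightarrow> (\<forall>n. s n \<in> M)" for s :: "nat \<Rightarrow> 'a" by auto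
    ultimately show ?thesis by metis
  qed
  then show ?thesis
    unfolding closed_subspace_def top metric_closedin_iff_sequentially_closed closed_linear_def by blast
qed

end

lemma cont_ops_iff:
  assumes "krein H" "krein L"
  shows "T \<in> cont_ops H L \<longleftrightarrow> T \<in> extensional (car H) \<and> bounded_op (assoc_hilbert H) (assoc_hilbert L) T"
proof -
  interpret H: krein H by fact
  interpret L: krein L by fact
  have "continuous_map (strong_topology H) (strong_topology L) T \<longleftrightarrow> bounded_op H.K L.K T"
    if "linear_on (car H) (car L) T"
    using continuous_map_linear_iff[OF H.K_posdef L.K_posdef] that by (simp add: strong_topology_def)
  moreover have "T \<in> cont_ops H L \<longleftrightarrow> T \<in> extensional (car H) \<and> linear_on (car H) (car L) T \<and>
      continuous_map (strong_topology H) (strong_topology L) T"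
    unfolding cont_ops_def linear_on_def by (auto simp: PiE_iff)
  ultimately show ?thesis using bounded_op_linear[of H.K L.K T] by auto
qed

text \<open>The Krein space adjoint is \<open>J S J\<close> with the Hilbert space adjoint \<open>S\<close>; nondegeneracy of the inner
product makes it unique.\<close>

lemma krein_adjoint:
  assumes "krein H" "krein L" and T: "bounded_op (assoc_hilbert H) (assoc_hilbert L) T"
  shows "krein_adjoint H L T \<in> cont_ops L H"
    and "\<And>f g. f \<in> car H \<Longrightarrow> g \<in> car L \<Longrightarrow> ip L (T f) g = ip H f (krein_adjoint H L T g)"
proof -
  interpret H: krein H by fact
  interpret L: krein L by fact
  note [simp] = linear_on_mem[OF bounded_op_linear[OF T], simplified]
  obtain S where S: "bounded_op L.K H.K S" "\<And>x y. x \<in> car H \<Longrightarrow> y \<in> car L \<Longrightarrow> ip L.K (T x) y = ip H.K x (S y)"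
    using adjoint_exists[OF H.K_hilbert L.K_posdef T] by auto
  note [simp] = linear_on_mem[OF bounded_op_linear[OF S(1)], simplified]
  define A where "A g = H.J (S (L.J g))" for g
  have A: "bounded_op L.K H.K A" unfolding A_def
    by (intro bounded_op_compose[OF L.K_posdef H.K_posdef _ H.bounded_op_J] bounded_op_compose[OF L.K_posdef L.K_posdef L.bounded_op_J S(1)])
  have Aip: "ip L (T f) g = ip H f (A g)" if "f \<in> car H" "g \<in> car L" for f g
    using that by (simp add: A_def H.ip_H_J_right S(2)[symmetric] L.ip_J_right)
  let ?Q = "\<lambda>S. S \<in> cont_ops L H \<and> (\<forall>f\<in>car H. \<forall>g\<in>car L. ip L (T f) g = ip H f (S g))"
  have ex: "?Q (restrict A (car L))"
  proof -
    have "bounded_op L.K H.K (restrict A (car L))" using A unfolding bounded_op_def linear_on_def by simp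
    then show ?thesis using Aip unfolding cont_ops_iff[OF assms(2,1)] by auto
  qed
  have uniq: "S = S'" if S: "?Q S" and S': "?Q S'" for S S'
  proof
    fix g
    show "S g = S' g"
    proof (cases "g \<in> car L")
      case True
      have mem: "S g \<in> car H" "S' g \<in> car H"
        using S S' True unfolding cont_ops_def by (auto simp: PiE_iff)
      have "S g - S' g = 0"
      proof (rule H.nondegenerate)
        fix f assume f: "f \<in> car H"
        then have "ip H f (S g) = ip H f (S' g)" using S S' True by metis
        then show "ip H f (S g - S' g) = 0" using f mem by (simp add: H.ip_diff_right)
      qed (use mem in simp)
      then show ?thesis by simp
    next
      case False
      then show ?thesis using S S' unfolding cont_ops_def by (auto simp: PiE_iff extensional_def)
    qed
  qed
  have "\<exists>!S. ?Q S" by (rule ex1I[of ?Q, OF ex]) (rule uniq[OF _ ex])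
  then have "?Q (krein_adjoint H L T)" unfolding krein_adjoint_def by (rule theI')
  then show "krein_adjoint H L T \<in> cont_ops L H"
    and "\<And>f g. f \<in> car H \<Longrightarrow> g \<in> car L \<Longrightarrow> ip L (T f) g = ip H f (krein_adjoint H L T g)" by blast+
qed

section \<open>The indices of a contained space\<close>

lemma ordIso_max_cardinal:
  fixes t :: "'b rel" and R :: "'a rel set"
  assumes r: "r \<in> R" and t: "t \<le>o r" and le: "\<And>s. s \<in> R \<Longrightarrow> s \<le>o t"
  shows "t =o max_cardinal R"
proof -
  have "\<exists>r. r \<in> R \<and> (\<forall>s\<in>R. s \<le>o r)"
    using r t le by (intro exI[of _ r]) (auto intro: ordLeq_transitive)
  then have max: "max_cardinal R \<in> R \<and> (\<forall>s\<in>R. s \<le>o max_cardinal R)"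
    unfolding max_cardinal_def by (rule someI_ex)
  then have "t \<le>o max_cardinal R" using r t by (blast intro: ordLeq_transitive)
  then show ?thesis using le max by (simp add: ordIso_iff_ordLeq)
qed

text \<open>On a subspace where \<open>\<bar>w f\<bar> < \<bar>u f\<bar>\<close> for nonzero \<open>f\<close>, the operator \<open>u\<close> is injective; this bounds the
dimension by that of \<open>U\<close>, and the subspace constructed above attains the bound.\<close>

lemma (in krein) dim_eq_max_definite:
  fixes U :: "'b::complex_vector inner_space" and W :: "'c::complex_vector inner_space"
  assumes U: "hilbert U" and W: "hilbert W"
    and u: "bounded_op K U u" and w: "bounded_op K W w" and e: "bounded_op U K e" and d: "bounded_op W K d"
    and ue: "\<And>x f. x \<in> car U \<Longrightarrow> f \<in> car H \<Longrightarrow> ip K (e x) f = ip U x (u f)"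
    and wd: "\<And>y f. y \<in> car W \<Longrightarrow> f \<in> car H \<Longrightarrow> ip K (d y) f = ip W y (w f)"
    and inj: "\<And>x y. x \<in> car U \<Longrightarrow> y \<in> car W \<Longrightarrow> e x = d y \<Longrightarrow> x = 0"
  shows "hilbert_dim U =o max_cardinal {subspace_dim H M | M. closed_subspace H M \<and>
    (\<forall>f\<in>M. f \<noteq> 0 \<longrightarrow> nrm W (w f) < nrm U (u f))}"
proof -
  let ?R = "{subspace_dim H M | M. closed_subspace H M \<and>
    (\<forall>f\<in>M. f \<noteq> 0 \<longrightarrow> nrm W (w f) < nrm U (u f))}"
  interpret U: hilbert U by (rule U)
  interpret W: hilbert W by (rule W)
  note [simp] = linear_on_mem[OF bounded_op_linear[OF u], simplified] linear_on_mem[OF bounded_op_linear[OF w], simplified]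
  obtain B where B: "orthonormal_basis U B" "hilbert_dim U = |B|" by (rule U.hilbert_dim_basis)
  obtain M where M: "closed_linear K M" and def: "\<And>f. f \<in> M \<Longrightarrow> f \<noteq> 0 \<Longrightarrow> nrm W (w f) < nrm U (u f)"
    and le: "\<And>B B'. orthonormal_basis U B \<Longrightarrow> orthonormal_basis (K\<lparr>car := M\<rparr>) B' \<Longrightarrow> |B| \<le>o |B'|"
    by (rule definite_subspace_exists[OF K_hilbert U W u w e d])
      ((rule ue[folded car_K] wd[folded car_K] inj that; assumption)+)
  interpret M: hilbert "K\<lparr>car := M\<rparr>" using M by (rule K.restrict_hilbert)
  obtain B' where B': "orthonormal_basis (K\<lparr>car := M\<rparr>) B'" "subspace_dim H M = |B'|"
    unfolding subspace_dim_def by (rule M.hilbert_dim_basis)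
  show ?thesis
  proof (rule ordIso_max_cardinal)
    show "subspace_dim H M \<in> ?R" using M def by (auto simp: closed_subspace_iff)
    show "hilbert_dim U \<le>o subspace_dim H M" using le[OF B(1) B'(1)] by (simp add: B B')
  next
    fix s assume "s \<in> ?R"
    then obtain L where L: "closed_linear K L" and defL: "\<forall>f\<in>L. f \<noteq> 0 \<longrightarrow> nrm W (w f) < nrm U (u f)"
      and s: "s = subspace_dim H L" by (auto simp: closed_subspace_iff)
    interpret L: hilbert "K\<lparr>car := L\<rparr>" using L by (rule K.restrict_hilbert)
    obtain B'' where B'': "orthonormal_basis (K\<lparr>car := L\<rparr>) B''" "s = |B''|"
      unfolding s subspace_dim_def by (rule L.hilbert_dim_basis)
    have LH: "x \<in> car H" if "x \<in> L" for x using closed_linearD(2)[OF L] that by auto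
    have "bounded_op (K\<lparr>car := L\<rparr>) U u"
      using u closed_linearD(2)[OF L] unfolding bounded_op_def linear_on_def by (simp add: subset_iff) blast
    moreover have "x = 0" if x: "x \<in> L" "u x = 0" for x
    proof (rule ccontr)
      assume "x \<noteq> 0"
      then have "nrm W (w x) < nrm U (u x)" using defL x by blast
      moreover have "nrm U (u x) = 0" using x(2) by simp
      moreover have "0 \<le> nrm W (w x)" using LH[OF x(1)] by simp
      ultimately show False by linarith
    qed
    ultimately have "|B''| \<le>o |B|"
      by (intro basis_le_of_injective[OF L.posdef_space_axioms U.posdef_space_axioms _ _ B''(1) B(1)]) auto
    then show "s \<le>o hilbert_dim U" by (simp add: B B'')
  qed
qed

lemma inclusion_bounded_op:
  assumes "continuously_contained A H"
  shows "bounded_op (assoc_hilbert A) (assoc_hilbert H) (inclusion A)"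
proof -
  interpret A: krein A using assms by unfold_locales (simp add: continuously_contained_def)
  interpret H: krein H using assms by unfold_locales (simp add: continuously_contained_def)
  have "linear_on (car A.K) (car H.K) (inclusion A)"
    using assms by (auto simp: linear_on_def inclusion_def continuously_contained_def)
  then show ?thesis
    using continuous_map_linear_iff[OF A.K_posdef H.K_posdef] assms
    by (simp add: continuously_contained_def strong_topology_def)
qed

text \<open>With \<open>S\<close> the adjoint of the inclusion, the form of \<open>C\<close> is \<open>ip A (S f) (S f)\<close>, a difference of two
squares of norms in the halves of \<open>A\<close>. The adjoints of the two components of \<open>S\<close> are plus and minus
the fundamental symmetry of \<open>H\<close>, restricted to the halves of \<open>A\<close>, so the independence of their
ranges is that of the two halves. The negative index is the same statement with the halves
exchanged.\<close>

lemma indices_of_contained_space: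
  assumes cont: "continuously_contained A H"
    and C: "C = compose (car H) (inclusion A) (krein_adjoint A H (inclusion A))"
  shows "ind_pos A =o herm_index_pos H C" and "ind_neg A =o herm_index_neg H C"
proof -
  interpret A: krein A using cont by unfold_locales (simp add: continuously_contained_def)
  interpret H: krein H using cont by unfold_locales (simp add: continuously_contained_def)
  have AH [simp]: "x \<in> car H" if "x \<in> car A" for x using cont that by (auto simp: continuously_contained_def)
  have incl [simp]: "inclusion A x = x" if "x \<in> car A" for x using that by (simp add: inclusion_def)
  note I = inclusion_bounded_op[OF cont]
  define S where "S = krein_adjoint A H (inclusion A)"
  have S: "bounded_op H.K A.K S" and Sip: "\<And>f g. f \<in> car A \<Longrightarrow> g \<in> car H \<Longrightarrow> ip H f g = ip A f (S g)"
    using krein_adjoint[OF A.krein_axioms H.krein_axioms I] unfolding S_def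
    by (simp_all add: cont_ops_iff[OF H.krein_axioms A.krein_axioms])
  note [simp] = linear_on_mem[OF bounded_op_linear[OF S], simplified]
  define u where "u f = A.p (S f)" for f
  define w where "w f = A.q (S f)" for f
  have u: "bounded_op H.K A.HP u" unfolding u_def by (rule bounded_op_compose[OF H.K_posdef A.K_posdef S A.bounded_op_p])
  have w: "bounded_op H.K A.HN w" unfolding w_def by (rule bounded_op_compose[OF H.K_posdef A.K_posdef S A.bounded_op_q])
  have uw_mem [simp]: "u f \<in> A.P" "w f \<in> A.N" if "f \<in> car H" for f using that by (simp_all add: u_def w_def)
  obtain c where c: "\<And>x. x \<in> car A \<Longrightarrow> nrm H.K x \<le> c * nrm A.K x"
    using bounded_op_boundE[OF I A.K_posdef] by (metis incl A.car_K)
  have JP: "bounded_op A.HP H.K H.J"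
    using c by (intro bounded_opI[where c = c]) (simp_all add: A.nrm_HP linear_on_add[OF H.linear_on_J] linear_on_scale[OF H.linear_on_J] del: nrm_restrict)
  have JN: "bounded_op A.HN H.K H.J"
    using c by (intro bounded_opI[where c = c]) (simp_all add: A.nrm_HN linear_on_add[OF H.linear_on_J] linear_on_scale[OF H.linear_on_J])
  have neg: "bounded_op L H.K (\<lambda>x. - H.J x)" if L: "posdef_space L" and J: "bounded_op L H.K H.J" for L
  proof -
    have "bounded_op H.K H.K uminus" by (rule bounded_opI[where c = 1]) simp_all
    then show ?thesis by (rule bounded_op_compose[OF L H.K_posdef J])
  qed
  have SP: "ip A x (S f) = ip A x (u f)" if "x \<in> A.P" "f \<in> car H" for x f
    using that by (simp add: A.ip_H_parts[of x "S f"] u_def)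
  have SN: "ip A y (S f) = ip A y (w f)" if "y \<in> A.N" "f \<in> car H" for y f
    using that by (simp add: A.ip_H_parts[of y "S f"] w_def)
  have eP: "ip H.K (H.J x) f = ip A x (u f)" if "x \<in> A.P" "f \<in> car H" for x f
    using that by (simp add: H.ip_J_left Sip SP)
  have eN: "ip H.K (H.J y) f = ip A y (w f)" if "y \<in> A.N" "f \<in> car H" for y f
    using that by (simp add: H.ip_J_left Sip SN)
  have inj: "x = 0 \<and> y = 0" if x: "x \<in> A.P" and y: "y \<in> A.N" and eq: "H.J x = - H.J y" for x y
  proof -
    have "H.J (H.J x) = - H.J (H.J y)" using eq x y by (simp add: linear_on_minus[OF H.linear_on_J])
    then have "x = - y" using x y by simp
    then have "x \<in> A.P \<inter> A.N" using x y by simp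
    then have "x = 0" using A.PN by simp
    then show ?thesis using \<open>x = - y\<close> by simp
  qed
  have CS: "C f = S f" if "f \<in> car H" for f using that by (simp add: C compose_def S_def[symmetric])
  have form: "Re (op_inner H C f f) = (nrm A.HP (u f))\<^sup>2 - (nrm A.HN (w f))\<^sup>2" if f: "f \<in> car H" for f
  proof -
    have "op_inner H C f f = ip A (S f) (S f)" using f by (simp add: op_inner_def CS Sip)
    also have "\<dots> = ip A (u f) (u f) + ip A (w f) (w f)"
      using f by (simp add: A.ip_H_parts[of "S f" "S f"] u_def w_def)
    finally show ?thesis using f A.HP.nrm_sq[of "u f"] A.HN.nrm_sq[of "w f"] by simp
  qed
  have pos: "0 < Re (op_inner H C f f) \<longleftrightarrow> nrm A.HN (w f) < nrm A.HP (u f)"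
    and neg': "Re (op_inner H C f f) < 0 \<longleftrightarrow> nrm A.HP (u f) < nrm A.HN (w f)" if f: "f \<in> car H" for f
  proof -
    have sq: "a\<^sup>2 < b\<^sup>2 \<longleftrightarrow> a < b" if "0 \<le> a" "0 \<le> b" for a b :: real
      using that power2_less_imp_less[of a b] power_strict_mono[of a b 2] by auto
    have nn: "0 \<le> nrm A.HP (u f)" "0 \<le> nrm A.HN (w f)"
      using f A.HP.nrm_ge0[of "u f"] A.HN.nrm_ge0[of "w f"] by simp_all
    show "0 < Re (op_inner H C f f) \<longleftrightarrow> nrm A.HN (w f) < nrm A.HP (u f)"
      unfolding form[OF f] using sq[OF nn(2,1)] by linarith
    show "Re (op_inner H C f f) < 0 \<longleftrightarrow> nrm A.HP (u f) < nrm A.HN (w f)"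
      unfolding form[OF f] using sq[OF nn(1,2)] by linarith
  qed
  have MH: "f \<in> car H" if "closed_subspace H M" "f \<in> M" for f M
    using that closed_linearD(2)[of H.K M] by (auto simp: H.closed_subspace_iff)
  have "ind_pos A =o max_cardinal {subspace_dim H M | M. closed_subspace H M \<and>
      (\<forall>f\<in>M. f \<noteq> 0 \<longrightarrow> nrm A.HN (w f) < nrm A.HP (u f))}"
    unfolding ind_pos_def
  proof (rule H.dim_eq_max_definite[OF A.HP.hilbert_axioms A.HN.hilbert_axioms u w JP])
    show "bounded_op A.HN H.K (\<lambda>y. - H.J y)" by (rule neg[OF A.HN.posdef_space_axioms JN])
  qed (use eP eN inj H.K.ip_minus_left in auto)
  moreover have "{subspace_dim H M | M. closed_subspace H M \<and>
      (\<forall>f\<in>M. f \<noteq> 0 \<longrightarrow> nrm A.HN (w f) < nrm A.HP (u f))} =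
      {subspace_dim H M | M. closed_subspace H M \<and> strictly_positive H C M}"
    unfolding strictly_positive_def using pos MH by (metis (no_types, lifting))
  ultimately show "ind_pos A =o herm_index_pos H C" by (simp add: herm_index_pos_def)
  have "ind_neg A =o max_cardinal {subspace_dim H M | M. closed_subspace H M \<and>
      (\<forall>f\<in>M. f \<noteq> 0 \<longrightarrow> nrm A.HP (u f) < nrm A.HN (w f))}"
    unfolding ind_neg_def
  proof (rule H.dim_eq_max_definite[OF A.HN.hilbert_axioms A.HP.hilbert_axioms w u _ JP])
    show "bounded_op A.HN H.K (\<lambda>y. - H.J y)" by (rule neg[OF A.HN.posdef_space_axioms JN])
    show "x = 0" if "x \<in> car A.HN" "y \<in> car A.HP" "- H.J x = H.J y" for x y
      using inj[of y x] that by simp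
  qed (use eP eN H.K.ip_minus_left in auto)
  moreover have "{subspace_dim H M | M. closed_subspace H M \<and>
      (\<forall>f\<in>M. f \<noteq> 0 \<longrightarrow> nrm A.HP (u f) < nrm A.HN (w f))} =
      {subspace_dim H M | M. closed_subspace H M \<and> strictly_negative H C M}"
    unfolding strictly_negative_def using neg' MH by (metis (no_types, lifting))
  ultimately show "ind_neg A =o herm_index_neg H C" by (simp add: herm_index_neg_def)
qed

section \<open>Factorization of selfadjoint operators\<close>

lemma hilbert_space_transport:
  fixes L :: "'a::complex_vector inner_space" and A :: "'b::complex_vector inner_space"
  assumes L: "hilbert L" and T: "linear_on (car L) (car A) T" and car: "car A = T ` car L"
    and ip: "\<And>x y. x \<in> car L \<Longrightarrow> y \<in> car L \<Longrightarrow> ip A (T x) (T y) = ip L x y"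
  shows "hilbert_space A"
proof -
  interpret L: hilbert L by (rule L)
  note T_add = linear_on_add[OF T, symmetric] and T_scale = linear_on_scale[OF T, symmetric]
    and T_diff = linear_on_diff[OF T L.subspace_car, symmetric] and T0 = linear_on_zero[OF T L.subspace_car]
  have sub: "complex_vector.subspace (T ` car L)"
    unfolding complex_vector.subspace_def
  proof (intro conjI ballI allI)
    show "0 \<in> T ` car L" using T0 by (metis L.zero_mem imageI)
  qed (auto simp: T_add T_scale)
  have "inner_product_space A"
    unfolding inner_product_space_def car
  proof (intro conjI ballI allI)
    fix x y assume "x \<in> T ` car L" "y \<in> T ` car L"
    then obtain a b where "a \<in> car L" "b \<in> car L" "x = T a" "y = T b" by blast
    then show "ip A y x = cnj (ip A x y)" using L.ip_cnj[of a b] by (simp add: ip)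
  qed (auto simp: sub T_add T_scale ip L.ip_add_left L.ip_scale_left)
  moreover have "0 < Re (ip L x x)" if "x \<in> car L" "T x \<noteq> 0" for x
    using L.posdef[of x] T0 that by metis
  ultimately have pos: "posdef_space A"
    by unfold_locales (auto simp: car ip)
  have nrm: "nrm A (T x) = nrm L x" if "x \<in> car L" for x using that by (simp add: nrm_def ip)
  have "\<exists>l\<in>car A. tends A s l" if s: "range s \<subseteq> car A" and c: "cauchy A s" for s
  proof -
    have "\<forall>n. \<exists>x\<in>car L. s n = T x" using s unfolding car by blast
    then obtain t where t: "\<And>n. t n \<in> car L" and st: "\<And>n. s n = T (t n)" by metis
    have "cauchy L t" using c t by (simp add: cauchy_def st T_diff nrm)
    then obtain l where l: "l \<in> car L" "tends L t l" using L.complete[of t] t by blast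
    then have "tends A s (T l)" using t by (simp add: tends_def st T_diff nrm)
    then show ?thesis using l unfolding car by blast
  qed
  then show ?thesis using pos by (simp add: hilbert_space_iff)
qed

text \<open>A weak adjoint of the inclusion forces its continuity, whatever fundamental decomposition of \<open>A\<close>
defines the topology: the unit ball of \<open>A\<close> is weakly bounded in \<open>H\<close>, because the functionals of \<open>H\<close>
are functionals of \<open>A\<close>, hence it is bounded. The equivalence of all associated norms is thereby bypassed.\<close>

lemma (in krein) inclusion_continuous:
  assumes A: "krein_space A" and sub: "car A \<subseteq> car H"
    and adj: "\<And>g. g \<in> car H \<Longrightarrow> \<exists>y\<in>car A. \<forall>x\<in>car A. ip H x g = ip A x y"
  shows "continuously_contained A H"
proof -
  interpret A: krein A by unfold_locales (rule A)
  have AH [simp]: "x \<in> car H" if "x \<in> car A" for x using sub that by blast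
  have "\<exists>c. \<forall>x\<in>{x \<in> car A. nrm A.K x \<le> 1}. nrm K x \<le> c"
  proof (rule K.weakly_bounded_imp_bounded)
    fix g assume "g \<in> car K"
    then have g: "g \<in> car H" by simp
    obtain y where y: "y \<in> car A" "\<And>x. x \<in> car A \<Longrightarrow> ip H x (J g) = ip A x y"
      using adj[of "J g"] g by auto
    have "cmod (ip K g x) \<le> nrm A.K y" if x: "x \<in> car A" "nrm A.K x \<le> 1" for x
    proof -
      have "cmod (ip K g x) = cmod (ip K x g)" using K.ip_cnj[of x g] x g by simp
      also have "ip K x g = ip A.K (A.J x) y" using x y g by (simp add: ip_H_J_right[symmetric] A.ip_J_left)
      also have "cmod \<dots> \<le> nrm A.K x * nrm A.K y" using A.K.cauchy_schwarz[of "A.J x" y] x y by simp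
      also have "\<dots> \<le> nrm A.K y" using x y A.K.nrm_ge0[of y] mult_right_mono[of "nrm A.K x" 1 "nrm A.K y"] by simp
      finally show ?thesis .
    qed
    then show "\<exists>c. \<forall>x\<in>{x \<in> car A. nrm A.K x \<le> 1}. cmod (ip K g x) \<le> c" by blast
  qed auto
  then obtain c where c: "\<And>x. x \<in> car A \<Longrightarrow> nrm A.K x \<le> 1 \<Longrightarrow> nrm K x \<le> c" by blast
  have "bounded_op A.K K (inclusion A)"
  proof (rule bounded_opI)
    fix x assume x: "x \<in> car A.K"
    show "nrm K (inclusion A x) \<le> c * nrm A.K x"
    proof (cases "x = 0")
      case False
      then have pos: "0 < nrm A.K x" using x by (intro A.K.nrm_pos)
      have "nrm K (of_real (1 / nrm A.K x) *\<^sub>C x) \<le> c"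
        using x pos False A.K.nrm_scale[of x "of_real (1 / nrm A.K x)"]
        by (intro c) (simp_all add: norm_divide)
      then have "nrm K x / nrm A.K x \<le> c"
        using x pos K.nrm_scale[of x "of_real (1 / nrm A.K x)"] by (simp add: norm_divide)
      then show ?thesis using x pos by (simp add: inclusion_def field_simps)
    qed (simp add: inclusion_def)
  qed (auto simp: inclusion_def)
  then show ?thesis
    using A krein_space sub continuous_map_linear_iff[OF A.K_posdef K_posdef bounded_op_linear]
    by (auto simp: continuously_contained_def strong_topology_def)
qed

text \<open>For the Hilbert space selfadjoint operator \<open>G = C J\<close> take \<open>S\<close>, \<open>M\<close> and \<open>N\<close> from the spectral splitting.
The space \<open>A\<close> is the range of \<open>S\<close>, that is of \<open>\<bar>G\<bar>\<close> to the power one half, with the inner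
product transported from the domain and taken with the sign of \<open>G\<close>: positive on \<open>S M\<close>, negative
on \<open>S N\<close>. On \<open>N\<close> the operator \<open>S\<close> may have a kernel \<open>Z\<close>, so \<open>N\<close> is replaced by the part \<open>L\<close>
orthogonal to \<open>Z\<close>. For \<open>x \<in> A\<close> and \<open>g \<in> H\<close> one computes \<open>ip H x g = ip A x (C g)\<close>; this gives
the continuity of the inclusion and identifies its adjoint with \<open>C\<close>.\<close>

lemma (in krein) selfadjoint_factorization:
  assumes C: "krein_selfadjoint H C"
  shows "\<exists>A. continuously_contained A H \<and>
    C = compose (car H) (inclusion A) (krein_adjoint A H (inclusion A))"
proof -
  have CH: "C \<in> cont_ops H H" and adjC: "krein_adjoint H H C = C"
    using C by (simp_all add: krein_selfadjoint_def)
  have Cext: "C \<in> extensional (car H)" and Cb: "bounded_op K K C"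
    using CH cont_ops_iff[OF krein_axioms krein_axioms] by simp_all
  have Csym: "ip H (C f) g = ip H f (C g)" if "f \<in> car H" "g \<in> car H" for f g
    using krein_adjoint(2)[OF krein_axioms krein_axioms Cb that] by (simp add: adjC)
  note [simp] = linear_on_mem[OF bounded_op_linear[OF Cb], simplified]
  define G where "G f = C (J f)" for f
  have G: "bounded_op K K G" unfolding G_def by (rule bounded_op_compose[OF K_posdef K_posdef bounded_op_J Cb])
  have Gsym: "ip K (G f) g = ip K f (G g)" if "f \<in> car K" "g \<in> car K" for f g
  proof -
    have "ip K (G f) g = ip H (C (J f)) (J g)" using that by (simp add: G_def ip_H_J_right)
    also have "\<dots> = ip H (J f) (C (J g))" using that by (simp add: Csym)
    also have "\<dots> = ip K f (G g)" using that by (simp add: G_def ip_H_J)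
    finally show ?thesis .
  qed
  obtain S M N where S: "bounded_op K K S" and Ssym: "\<And>x y. x \<in> car K \<Longrightarrow> y \<in> car K \<Longrightarrow> ip K (S x) y = ip K x (S y)"
    and M: "closed_linear K M" and N: "closed_linear K N" and orth: "\<And>x y. x \<in> M \<Longrightarrow> y \<in> N \<Longrightarrow> ip K x y = 0"
    and split: "\<And>x. x \<in> car K \<Longrightarrow> \<exists>m\<in>M. \<exists>n\<in>N. x = m + n"
    and SM: "\<And>x. x \<in> M \<Longrightarrow> S x \<in> M" and SN: "\<And>x. x \<in> N \<Longrightarrow> S x \<in> N"
    and GM: "\<And>x. x \<in> M \<Longrightarrow> G x = S (S x)" and GN: "\<And>x. x \<in> N \<Longrightarrow> G x = - S (S x)"
    and ker: "\<And>x. x \<in> M \<Longrightarrow> S x = 0 \<Longrightarrow> x = 0"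
    by (rule K.spectral_splitting[OF G]) ((rule Gsym that; assumption)+)
  note Sl = bounded_op_linear[OF S, simplified]
  have S_mem [simp]: "S x \<in> car H" if "x \<in> car H" for x using linear_on_mem[OF Sl that] .
  have S0: "S 0 = 0" by (rule linear_on_zero[OF Sl subspace_car])
  have MK [simp]: "x \<in> car H" if "x \<in> M" for x using closed_linearD(2)[OF M] that by auto
  have orth': "ip K y x = 0" if "x \<in> M" "y \<in> N" for x y
    using orth[OF that] K.ip_cnj[of x y] that closed_linearD(2)[OF N] by auto
  define Z where "Z = {x \<in> car H. S x = 0}"
  define L where "L = N \<inter> {x \<in> car K. \<forall>z\<in>Z. ip K x z = 0}"
  have L: "closed_linear K L" unfolding L_def by (intro closed_linear_inter N K.closed_linear_orthogonal) (auto simp: Z_def)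
  have LN: "x \<in> N" if "x \<in> L" for x using that by (simp add: L_def)
  have LK [simp]: "x \<in> car H" if "x \<in> L" for x using that by (simp add: L_def)
  have NK: "x \<in> car H" if "x \<in> N" for x using closed_linearD(2)[OF N] that by auto
  have SL: "S x \<in> L" if x: "x \<in> N" for x
  proof -
    have "ip K (S x) z = 0" if z: "z \<in> Z" for z
      using Ssym[of x z] NK[OF x] z by (simp add: Z_def)
    then show ?thesis unfolding L_def using SN[OF x] NK[OF x] by simp
  qed
  have kerL: "x = 0" if x: "x \<in> L" "S x = 0" for x
    using K.ip_self_eq0[of x] LK[OF x(1)] x unfolding L_def Z_def by auto
  have Msub: "complex_vector.subspace M" and Lsub: "complex_vector.subspace L"
    using closed_linearD(1) M L by blast+
  have M_mem: "0 \<in> M" "\<And>x y. x \<in> M \<Longrightarrow> y \<in> M \<Longrightarrow> x + y \<in> M" "\<And>a x. x \<in> M \<Longrightarrow> a *\<^sub>C x \<in> M"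
      "\<And>x y. x \<in> M \<Longrightarrow> y \<in> M \<Longrightarrow> x - y \<in> M"
    and L_mem: "0 \<in> L" "\<And>x y. x \<in> L \<Longrightarrow> y \<in> L \<Longrightarrow> x + y \<in> L" "\<And>a x. x \<in> L \<Longrightarrow> a *\<^sub>C x \<in> L"
      "\<And>x y. x \<in> L \<Longrightarrow> y \<in> L \<Longrightarrow> x - y \<in> L" "\<And>x. x \<in> L \<Longrightarrow> - x \<in> L"
    using Msub Lsub by (auto intro: complex_vector.subspace_add complex_vector.subspace_diff
        complex_vector.subspace_0 complex_vector.subspace_scale complex_vector.subspace_neg)
  \<comment> \<open>\<open>S M\<close> and \<open>S L\<close> are orthogonal in \<open>K\<close>, so the sum of the two ranges is direct\<close>
  have inj: "a = 0 \<and> b = 0" if a: "a \<in> M" and b: "b \<in> L" and eq: "S a + S b = 0" for a b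
  proof -
    have "ip K (S a + S b) (S a) = ip K (S a) (S a)"
      using a b orth'[OF SM[OF a] SN[OF LN[OF b]]] by (simp add: K.ip_add_left)
    then have "ip K (S a) (S a) = 0" using eq a by simp
    then have "S a = 0" using K.ip_self_eq0[of "S a"] a by simp
    then show ?thesis using ker[OF a] kerL[OF b] eq by simp
  qed
  define V where "V = {S a + S b | a b. a \<in> M \<and> b \<in> L}"
  have VH: "x \<in> car H" if "x \<in> V" for x using that by (auto simp: V_def)
  have "\<exists>a b. a \<in> M \<and> b \<in> L \<and> x = S a + S b" if "x \<in> V" for x using that by (auto simp: V_def)
  then obtain \<alpha> \<beta> where ab: "\<And>x. x \<in> V \<Longrightarrow> \<alpha> x \<in> M" "\<And>x. x \<in> V \<Longrightarrow> \<beta> x \<in> L"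
    "\<And>x. x \<in> V \<Longrightarrow> x = S (\<alpha> x) + S (\<beta> x)" by metis
  have in_V: "S a + S b \<in> V" if "a \<in> M" "b \<in> L" for a b using that by (auto simp: V_def)
  have parts: "\<alpha> (S a + S b) = a \<and> \<beta> (S a + S b) = b" if "a \<in> M" "b \<in> L" for a b
  proof -
    let ?x = "S a + S b"
    have x: "?x \<in> V" using that by (rule in_V)
    have "S (a - \<alpha> ?x) + S (b - \<beta> ?x) = (S a + S b) - (S (\<alpha> ?x) + S (\<beta> ?x))"
      using that ab(1,2)[OF x] by (simp add: linear_on_diff[OF Sl subspace_car])
    also have "\<dots> = 0" using ab(3)[OF x] by simp
    finally have "a - \<alpha> ?x = 0 \<and> b - \<beta> ?x = 0"
      using that ab(1,2)[OF x] by (intro inj M_mem L_mem)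
    then show ?thesis by simp
  qed
  define A where "A = \<lparr>car = V, ip = \<lambda>x y. ip K (\<alpha> x) (\<alpha> y) - ip K (\<beta> x) (\<beta> y)\<rparr>"
  have carA [simp]: "car A = V" by (simp add: A_def)
  have ipA: "ip A (S a + S b) (S a' + S b') = ip K a a' - ip K b b'"
    if "a \<in> M" "b \<in> L" "a' \<in> M" "b' \<in> L" for a b a' b'
    using that by (simp add: A_def parts)
  have V_add: "(S a + S b) + (S a' + S b') = S (a + a') + S (b + b')"
    if "a \<in> M" "b \<in> L" "a' \<in> M" "b' \<in> L" for a b a' b'
    using that by (simp add: linear_on_add[OF Sl])
  have V_scale: "c *\<^sub>C (S a + S b) = S (c *\<^sub>C a) + S (c *\<^sub>C b)"
    if "a \<in> M" "b \<in> L" for a b c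
    using that by (simp add: linear_on_scale[OF Sl] complex_vector.scale_right_distrib)
  have V_cases: "\<exists>a\<in>M. \<exists>b\<in>L. x = S a + S b" if "x \<in> V" for x using that by (auto simp: V_def)
  have "complex_vector.subspace V"
    unfolding complex_vector.subspace_def
  proof (intro conjI ballI allI)
    show "0 \<in> V" using in_V[OF M_mem(1) L_mem(1)] by (simp add: S0)
  next
    fix x y assume "x \<in> V" "y \<in> V"
    then obtain a b a' b' where "a \<in> M" "b \<in> L" "a' \<in> M" "b' \<in> L" "x = S a + S b" "y = S a' + S b'"
      using V_cases by metis
    then show "x + y \<in> V" using M_mem L_mem by (simp only: V_add in_V)
  next
    fix c x assume "x \<in> V"
    then obtain a b where "a \<in> M" "b \<in> L" "x = S a + S b" using V_cases by metis
    then show "c *\<^sub>C x \<in> V" using M_mem L_mem by (simp only: V_scale in_V)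
  qed
  then have A_ips: "inner_product_space A"
    unfolding inner_product_space_def carA
  proof (intro conjI ballI allI)
    fix x y z assume "x \<in> V" "y \<in> V" "z \<in> V"
    then obtain a b a' b' a'' b'' where *: "a \<in> M" "b \<in> L" "a' \<in> M" "b' \<in> L" "a'' \<in> M" "b'' \<in> L"
      "x = S a + S b" "y = S a' + S b'" "z = S a'' + S b''" using V_cases by metis
    have "ip A (x + y) z = ip K (a + a') a'' - ip K (b + b') b''"
      using * M_mem(2) L_mem(2) by (simp only: V_add ipA)
    then show "ip A (x + y) z = ip A x z + ip A y z"
      using * by (simp add: ipA K.ip_add_left)
  next
    fix c x y assume "x \<in> V" "y \<in> V"
    then obtain a b a' b' where *: "a \<in> M" "b \<in> L" "a' \<in> M" "b' \<in> L" "x = S a + S b" "y = S a' + S b'"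
      using V_cases by metis
    have "ip A (c *\<^sub>C x) y = ip K (c *\<^sub>C a) a' - ip K (c *\<^sub>C b) b'"
      using * M_mem(3) L_mem(3) by (simp only: V_scale ipA)
    then show "ip A (c *\<^sub>C x) y = c * ip A x y"
      using * by (simp add: ipA K.ip_scale_left algebra_simps)
  next
    fix x y assume "x \<in> V" "y \<in> V"
    then obtain a b a' b' where *: "a \<in> M" "b \<in> L" "a' \<in> M" "b' \<in> L" "x = S a + S b" "y = S a' + S b'"
      using V_cases by metis
    then show "ip A y x = cnj (ip A x y)"
      using K.ip_cnj[of a a'] K.ip_cnj[of b b'] by (simp add: ipA)
  qed
  have ipA_M: "ip A (S a) (S a') = ip K a a'" if "a \<in> M" "a' \<in> M" for a a'
    using ipA[of a 0 a' 0] that L_mem(1) by (simp add: S0)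
  have ipA_L: "ip A (S b) (S b') = - ip K b b'" if "b \<in> L" "b' \<in> L" for b b'
    using ipA[of 0 b 0 b'] that M_mem(1) by (simp add: S0)
  have ipA_ML: "ip A (S a) (S b) = 0" if "a \<in> M" "b \<in> L" for a b
    using ipA[of a 0 0 b] that M_mem(1) L_mem(1) by (simp add: S0)
  have "fundamental_decomposition A (S ` M, S ` L)"
    unfolding fundamental_decomposition_def prod.case
  proof (intro conjI)
    have "linear_on M (S ` M) S" "linear_on L (S ` L) S"
      by (auto simp: linear_on_def linear_on_add[OF Sl] linear_on_scale[OF Sl])
    then show "hilbert_space (A\<lparr>car := S ` M\<rparr>)" "hilbert_space (antispace (A\<lparr>car := S ` L\<rparr>))"
      by (intro hilbert_space_transport[OF K.restrict_hilbert[OF M], of _ S]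
          hilbert_space_transport[OF K.restrict_hilbert[OF L], of _ S];
          simp add: antispace_def ipA_M ipA_L)+
    show "\<forall>x\<in>S ` M. \<forall>y\<in>S ` L. ip A x y = 0" using ipA_ML by blast
    have "x = 0" if x: "x \<in> S ` M \<inter> S ` L" for x
    proof -
      obtain a b where *: "a \<in> M" "b \<in> L" "x = S a" "x = S b" using x by blast
      then have "S a + S (- b) = 0" by (simp add: linear_on_minus[OF Sl])
      then have "a = 0" using inj[of a "- b"] * L_mem(5) by blast
      then show ?thesis using * S0 by simp
    qed
    moreover have "0 \<in> S ` M \<inter> S ` L" using S0 M_mem(1) L_mem(1) by (metis IntI imageI)
    ultimately show "S ` M \<inter> S ` L = {0}" by blast
    show "car A = {x + y |x y. x \<in> S ` M \<and> y \<in> S ` L}" unfolding carA V_def by blast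
  qed
  then have A: "krein_space A" using A_ips by (auto simp: krein_space_def)
  have key: "C g \<in> V \<and> (\<forall>x\<in>V. ip H x g = ip A x (C g))" if g: "g \<in> car H" for g
  proof -
    obtain m n where mn: "m \<in> M" "n \<in> N" "J g = m + n" using split[of "J g"] g by auto
    note [simp] = NK[OF mn(2)] MK[OF mn(1)]
    have "C g = G (J g)" using g by (simp add: G_def)
    also have "\<dots> = G m + G n" using mn linear_on_add[OF bounded_op_linear[OF G], of m n] by simp
    also have "\<dots> = S (S m) + S (- S n)" using mn by (simp add: GM GN linear_on_minus[OF Sl])
    finally have Cg: "C g = S (S m) + S (- S n)" .
    have mem: "S m \<in> M" "- S n \<in> L" using SM[OF mn(1)] SL[OF mn(2)] L_mem(5) by blast+
    have "ip H x g = ip A x (C g)" if "x \<in> V" for x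
    proof -
      obtain a b where *: "a \<in> M" "b \<in> L" "x = S a + S b" using V_cases[OF \<open>x \<in> V\<close>] by blast
      have "ip H x g = ip K (S a + S b) (m + n)" using * g by (simp add: ip_J_right mn(3)[symmetric])
      also have "\<dots> = ip K (S a) m + ip K (S b) n"
        using * mn orth[OF SM[OF *(1)] mn(2)] orth'[OF mn(1) SN[OF LN[OF *(2)]]]
        by (simp add: K.ip_add_left K.ip_add_right)
      also have "\<dots> = ip K a (S m) - ip K b (- S n)"
        using * by (simp add: Ssym K.ip_minus_right)
      also have "\<dots> = ip A x (C g)" using * mem by (simp only: ipA Cg)
      finally show ?thesis .
    qed
    then show ?thesis using in_V[OF mem] by (simp add: Cg)
  qed
  have cont: "continuously_contained A H"
    using VH key by (intro inclusion_continuous[OF A]) auto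
  interpret A: krein A by unfold_locales (rule A)
  have "C = compose (car H) (inclusion A) (krein_adjoint A H (inclusion A))"
  proof (rule extensionalityI[OF Cext])
    fix g assume g: "g \<in> car H"
    note I = inclusion_bounded_op[OF cont]
    have mem: "krein_adjoint A H (inclusion A) g \<in> V"
      using krein_adjoint(1)[OF A.krein_axioms krein_axioms I] g unfolding cont_ops_def
      by (auto simp: PiE_iff)
    have "krein_adjoint A H (inclusion A) g - C g = 0"
    proof (rule A.nondegenerate)
      show "krein_adjoint A H (inclusion A) g - C g \<in> car A" using mem key[OF g] A.diff_mem by simp
      fix f assume f: "f \<in> car A"
      have "ip A f (krein_adjoint A H (inclusion A) g) = ip H f g"
        using krein_adjoint(2)[OF A.krein_axioms krein_axioms I f g] f by (simp add: inclusion_def)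
      then show "ip A f (krein_adjoint A H (inclusion A) g - C g) = 0"
        using f mem key[OF g] A.ip_diff_right[of f "krein_adjoint A H (inclusion A) g" "C g"] by simp
    qed
    then show "C g = compose (car H) (inclusion A) (krein_adjoint A H (inclusion A)) g"
      using g mem by (simp add: compose_def inclusion_def)
  qed simp
  with cont show ?thesis by blast
qed

theorem theorem3p2:
  fixes H :: "'a::complex_vector inner_space"
  assumes "krein_space H"
  shows "(\<forall>A C. continuously_contained A H \<and>
            C = compose (car H) (inclusion A) (krein_adjoint A H (inclusion A)) \<longrightarrow>
            ind_pos A =o herm_index_pos H C \<and> ind_neg A =o herm_index_neg H C) \<and>
         (\<forall>C. krein_selfadjoint H C \<longrightarrow>
            (\<exists>A. continuously_contained A H \<and>
              C = compose (car H) (inclusion A) (krein_adjoint A H (inclusion A))))"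
proof -
  interpret krein H by unfold_locales (rule assms)
  show ?thesis using indices_of_contained_space selfadjoint_factorization by blast
qed

end
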